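(* Let $\delta\in(1,\infty)$, let $(U,Y)$ and the losses $(\ell_y)_{y\in\mathcal Y}$ satisfy assumptions (N) and (L) of the context, let $G\sim N(0,1)$ be independent of $(U,Y)$, and let $\delta_\infty$ be defined by $1/\delta_\infty=\inf_{t\in\mathbb{R}}\varphi(t)$ as in the context. Consider the system in the unknowns $(\gamma,a,\sigma)\in\mathbb{R}_{>0}\times\mathbb{R}\times\mathbb{R}_{>0}$: $$\begin{aligned}\gamma^{-2}\delta^{-1}\sigma^2&=\mathbb{E}\bigl[\ell_Y'(\mathrm{prox}[\gamma\ell_Y](aU+\sigma G))^2\bigr],\\ 0&=\mathbb{E}\bigl[U\,\ell_Y'(\mathrm{prox}[\gamma\ell_Y](aU+\sigma G))\bigr],\\ \sigma(1-\delta^{-1})&=\mathbb{E}\bigl[G\,\mathrm{prox}[\gamma\ell_Y](aU+\sigma G)\bigr].\end{aligned}$$ (i) If $\delta\le\delta_\infty$, the system has no solution. (ii) If $\delta>\delta_\infty$, the system has a unique solution.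
   Context: $\mathcal Y\subset\mathbb{R}$; $(U,Y)$ is a random pair with $U\sim N(0,1)$ and $Y\in\mathcal Y$; $G\sim N(0,1)$ is independent of $(U,Y)$. For each $y\in\mathcal Y$ a function $\ell_y:\mathbb{R}\to\mathbb{R}$ is given, with $y\mapsto\ell_y(t)$ measurable for each $t$. For $\gamma>0$ and $f$ convex, $\mathrm{prox}[\gamma f](x)=\operatorname{argmin}_{u\in\mathbb{R}}\{\frac{1}{2\gamma}(x-u)^2+f(u)\}$. Events: $\Omega_\vee=\{\ell_Y\text{ is coercive, i.e. }\ell_Y(t)\to+\infty\text{ as }|t|\to\infty\}$, $\Omega_\nearrow=\{\ell_Y\text{ strictly increasing}\}$, $\Omega_\searrow=\{\ell_Y\text{ strictly decreasing}\}$ (a partition for strictly convex losses). $I\{\cdot\}$ denotes an indicator. Assumption (N): $\ell_y$ is strictly convex for every $y\in\mathcal Y$, and $$\mathbb{E}\bigl[U^2(I\{\Omega_\vee\}+I\{\Omega_\searrow,U>0\}+I\{\Omega_\nearrow,U<0\})\bigr]>0,\qquad \mathbb{E}\bigl[U^2(I\{\Omega_\vee\}+I\{\Omega_\searrow,U<0\}+I\{\Omega_\nearrow,U>0\})\bigr]>0.$$ Assumption (L): (1) for all $y\in\mathcal Y$, $\ell_y$ is $C^1$, strictly convex and not constant; (2) $\mathbb{E}[|\inf_u\ell_Y(u)|]<\infty$ and $\mathbb{E}[|\ell_Y(G)|]<\infty$; (3) $\mathbb{P}(\Omega_\vee)<1$; (4) there are a constant $b>0$ and a positive $\sigma(Y)$-measurable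 random variable $D(Y)$ with $\mathbb{E}[D(Y)]<\infty$ and $\mathbb{E}[D(Y)^2I\{\Omega_\vee\}]<\infty$ such that for all $u\in\mathbb{R}$: $\ell_Y(u)\ge -D(Y)+u/b$ on $\Omega_\nearrow$, $\ell_Y(u)\ge -D(Y)+|u|/b$ on $\Omega_\vee$, and $\ell_Y(u)\ge -D(Y)-u/b$ on $\Omega_\searrow$. Threshold. With $a_+=\max(a,0)$, $a_-=\max(-a,0)$, $a_\pm^2=(a_\pm)^2$, $$\varphi(t)=\mathbb{E}[(G+Ut)^2I\{\Omega_\vee\}]+\mathbb{E}[(G+Ut)_+^2I\{\Omega_\nearrow\}]+\mathbb{E}[(G+Ut)_-^2I\{\Omega_\searrow\}],\qquad \frac1{\delta_\infty}=\inf_{t\in\mathbb{R}}\varphi(t),$$ with $\delta_\infty=+\infty$ if the infimum is $0$. *)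

theory Defs
  imports "HOL-Probability.Probability"
begin

definition strictly_convex :: "(real \<Rightarrow> real) \<Rightarrow> bool" where
  "strictly_convex f \<longleftrightarrow>
     (\<forall>x y. \<forall>t. x \<noteq> y \<and> 0 < t \<and> t < 1 \<longrightarrow>
        f ((1 - t) * x + t * y) < (1 - t) * f x + t * f y)"

definition coercive :: "(real \<Rightarrow> real) \<Rightarrow> bool" where
  "coercive f \<longleftrightarrow> filterlim f at_top at_infinity"

text \<open>\<open>prox \<gamma> f\<close> is \<open>prox[\<gamma> f]\<close>; the minimiser exists and is unique for \<open>\<gamma> > 0\<close> and convex \<open>f\<close>.\<close>

definition prox :: "real \<Rightarrow> (real \<Rightarrow> real) \<Rightarrow> real \<Rightarrow> real" where
  "prox \<gamma> f x = (ARG_MIN (\<lambda>u. 1 / (2 * \<gamma>) * (x - u)\<^sup>2 + f u) u. True)"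

text \<open>Throughout, \<open>l y\<close> is the loss \<open>\<ell>\<^sub>y\<close>; its values for \<open>y \<notin> \<Y>\<close> are irrelevant.\<close>

definition Omega_coer :: "'a measure \<Rightarrow> ('a \<Rightarrow> real) \<Rightarrow> (real \<Rightarrow> real \<Rightarrow> real) \<Rightarrow> 'a set" where
  "Omega_coer M Y l = {\<omega> \<in> space M. coercive (l (Y \<omega>))}"

definition Omega_inc :: "'a measure \<Rightarrow> ('a \<Rightarrow> real) \<Rightarrow> (real \<Rightarrow> real \<Rightarrow> real) \<Rightarrow> 'a set" where
  "Omega_inc M Y l = {\<omega> \<in> space M. strict_mono (l (Y \<omega>))}"

definition Omega_dec :: "'a measure \<Rightarrow> ('a \<Rightarrow> real) \<Rightarrow> (real \<Rightarrow> real \<Rightarrow> real) \<Rightarrow> 'a set" where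
  "Omega_dec M Y l = {\<omega> \<in> space M. strict_antimono_on UNIV (l (Y \<omega>))}"

text \<open>
  The library's \<open>indep_var\<close> needs both variables to take values in the same type, so independence
  of \<open>G\<close> and \<open>(U, Y)\<close> is stated for the generated sigma-algebras.
\<close>

definition gaussian_setting ::
  "'a measure \<Rightarrow> ('a \<Rightarrow> real) \<Rightarrow> ('a \<Rightarrow> real) \<Rightarrow> ('a \<Rightarrow> real) \<Rightarrow> real set
     \<Rightarrow> (real \<Rightarrow> real \<Rightarrow> real) \<Rightarrow> bool" where
  "gaussian_setting M U Y G \<Y> l \<longleftrightarrow>
     prob_space M \<and>
     distributed M lborel U std_normal_density \<and>
     distributed M lborel G std_normal_density \<and>
     Y \<in> borel_measurable M \<and> (\<forall>\<omega>\<in>space M. Y \<omega> \<in> \<Y>) \<and>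
     prob_space.indep_set M
       (sets (vimage_algebra (space M) G borel))
       (sets (vimage_algebra (space M) (\<lambda>\<omega>. (U \<omega>, Y \<omega>)) (borel \<Otimes>\<^sub>M borel))) \<and>
     (\<forall>t. (\<lambda>y. l y t) \<in> borel_measurable (restrict_space borel \<Y>))"

definition assumption_N ::
  "'a measure \<Rightarrow> ('a \<Rightarrow> real) \<Rightarrow> ('a \<Rightarrow> real) \<Rightarrow> real set \<Rightarrow> (real \<Rightarrow> real \<Rightarrow> real) \<Rightarrow> bool" where
  "assumption_N M U Y \<Y> l \<longleftrightarrow>
     (\<forall>y\<in>\<Y>. strictly_convex (l y)) \<and>
     (\<integral>\<omega>. (U \<omega>)\<^sup>2 * (indicat_real (Omega_coer M Y l) \<omega>
            + indicat_real (Omega_dec M Y l \<inter> {\<omega>. U \<omega> > 0}) \<omega>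
            + indicat_real (Omega_inc M Y l \<inter> {\<omega>. U \<omega> < 0}) \<omega>) \<partial>M) > 0 \<and>
     (\<integral>\<omega>. (U \<omega>)\<^sup>2 * (indicat_real (Omega_coer M Y l) \<omega>
            + indicat_real (Omega_dec M Y l \<inter> {\<omega>. U \<omega> < 0}) \<omega>
            + indicat_real (Omega_inc M Y l \<inter> {\<omega>. U \<omega> > 0}) \<omega>) \<partial>M) > 0"

text \<open>
  The infimum of \<open>\<ell>\<^sub>Y\<close> is taken in \<open>ereal\<close>, because \<open>Inf\<close> on \<open>real\<close> is meaningless for a loss that
  is not bounded below; finiteness of the integral then forces it to be finite almost surely.
  Relations between random variables are understood almost surely.
\<close>

definition assumption_L ::
  "'a measure \<Rightarrow> ('a \<Rightarrow> real) \<Rightarrow> ('a \<Rightarrow> real) \<Rightarrow> real set \<Rightarrow> (real \<Rightarrow> real \<Rightarrow> real) \<Rightarrow> bool" where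
  "assumption_L M Y G \<Y> l \<longleftrightarrow>
     (\<forall>y\<in>\<Y>. l y C1_differentiable_on UNIV \<and> strictly_convex (l y) \<and> \<not> l y constant_on UNIV) \<and>
     (\<integral>\<^sup>+\<omega>. e2ennreal \<bar>INF u. ereal (l (Y \<omega>) u)\<bar> \<partial>M) < \<infinity> \<and>
     integrable M (\<lambda>\<omega>. l (Y \<omega>) (G \<omega>)) \<and>
     measure M (Omega_coer M Y l) < 1 \<and>
     (\<exists>b>0. \<exists>D :: real \<Rightarrow> real.
        (\<lambda>\<omega>. D (Y \<omega>)) \<in> borel_measurable (vimage_algebra (space M) Y borel) \<and>
        (AE \<omega> in M. D (Y \<omega>) > 0) \<and>
        integrable M (\<lambda>\<omega>. D (Y \<omega>)) \<and>
        integrable M (\<lambda>\<omega>. (D (Y \<omega>))\<^sup>2 * indicat_real (Omega_coer M Y l) \<omega>) \<and>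
        (AE \<omega> in M. \<forall>u.
           (\<omega> \<in> Omega_inc M Y l \<longrightarrow> l (Y \<omega>) u \<ge> - D (Y \<omega>) + u / b) \<and>
           (\<omega> \<in> Omega_coer M Y l \<longrightarrow> l (Y \<omega>) u \<ge> - D (Y \<omega>) + \<bar>u\<bar> / b) \<and>
           (\<omega> \<in> Omega_dec M Y l \<longrightarrow> l (Y \<omega>) u \<ge> - D (Y \<omega>) - u / b)))"

definition phi ::
  "'a measure \<Rightarrow> ('a \<Rightarrow> real) \<Rightarrow> ('a \<Rightarrow> real) \<Rightarrow> ('a \<Rightarrow> real) \<Rightarrow> (real \<Rightarrow> real \<Rightarrow> real)
     \<Rightarrow> real \<Rightarrow> real" where
  "phi M U Y G l t =
     (\<integral>\<omega>. (G \<omega> + U \<omega> * t)\<^sup>2 * indicat_real (Omega_coer M Y l) \<omega> \<partial>M)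
     + (\<integral>\<omega>. (max (G \<omega> + U \<omega> * t) 0)\<^sup>2 * indicat_real (Omega_inc M Y l) \<omega> \<partial>M)
     + (\<integral>\<omega>. (max (- (G \<omega> + U \<omega> * t)) 0)\<^sup>2 * indicat_real (Omega_dec M Y l) \<omega> \<partial>M)"

definition delta_infty ::
  "'a measure \<Rightarrow> ('a \<Rightarrow> real) \<Rightarrow> ('a \<Rightarrow> real) \<Rightarrow> ('a \<Rightarrow> real) \<Rightarrow> (real \<Rightarrow> real \<Rightarrow> real) \<Rightarrow> ereal" where
  "delta_infty M U Y G l =
     (if (INF t. phi M U Y G l t) = 0 then \<infinity> else ereal (1 / (INF t. phi M U Y G l t)))"

text \<open>
  Integrability is part of being a solution, since the Bochner integral of a non-integrable
  function is \<open>0\<close> by convention.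
\<close>

definition is_solution ::
  "'a measure \<Rightarrow> ('a \<Rightarrow> real) \<Rightarrow> ('a \<Rightarrow> real) \<Rightarrow> ('a \<Rightarrow> real) \<Rightarrow> (real \<Rightarrow> real \<Rightarrow> real)
     \<Rightarrow> real \<Rightarrow> real \<times> real \<times> real \<Rightarrow> bool" where
  "is_solution M U Y G l \<delta> = (\<lambda>(\<gamma>, a, \<sigma>).
     let p = (\<lambda>\<omega>. prox \<gamma> (l (Y \<omega>)) (a * U \<omega> + \<sigma> * G \<omega>));
         d = (\<lambda>\<omega>. deriv (l (Y \<omega>)) (p \<omega>))
     in \<gamma> > 0 \<and> \<sigma> > 0 \<and>
        integrable M (\<lambda>\<omega>. (d \<omega>)\<^sup>2) \<and>
        integrable M (\<lambda>\<omega>. U \<omega> * d \<omega>) \<and>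
        integrable M (\<lambda>\<omega>. G \<omega> * p \<omega>) \<and>
        \<sigma>\<^sup>2 / (\<gamma>\<^sup>2 * \<delta>) = (\<integral>\<omega>. (d \<omega>)\<^sup>2 \<partial>M) \<and>
        0 = (\<integral>\<omega>. U \<omega> * d \<omega> \<partial>M) \<and>
        \<sigma> * (1 - 1 / \<delta>) = (\<integral>\<omega>. G \<omega> * p \<omega> \<partial>M))"

end

theory Submission
  imports Defs
begin

text \<open>
  Write \<open>p = prox[\<gamma> \<ell>\<^sub>Y](a U + \<sigma> G)\<close> and \<open>v = p - a U\<close>. The system says that \<open>v\<close> is orthogonal to \<open>U\<close>,
  that the cone constraint \<open>\<surd>(1 - 1/\<delta>) \<parallel>v\<parallel> \<le> \<langle>G, v\<rangle>\<close> is an equality, and that \<open>\<ell>\<^sub>Y'(p)\<close> is a positive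
  multiple of its gradient: these are the optimality conditions for minimising \<open>\<E>[\<ell>\<^sub>Y(p)]\<close> over
  \<open>p \<in> L\<^sup>2\<close> subject to that constraint. Uniqueness is strict monotonicity of \<open>\<ell>\<^sub>Y'\<close>.

  The losses stay bounded exactly along the recession cone of directions that are \<open>0\<close> on \<open>\<Omega>\<^sub>\<or>\<close>, \<open>\<le> 0\<close>
  where \<open>\<ell>\<^sub>Y\<close> increases and \<open>\<ge> 0\<close> where it decreases, and \<open>\<phi> t\<close> is the squared distance of
  \<open>G + U t\<close> to this cone. Hence \<open>inf \<phi> > 1/\<delta>\<close> means that no nonzero feasible direction is a direction of
  recession. In that case the level sets of the risk are bounded, a minimiser is the limit of a
  minimising sequence chosen with nearly minimal norm, and independence of \<open>G\<close> and \<open>(U, Y)\<close> excludes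
  the degenerate case \<open>v = 0\<close>. Conversely, at a solution \<open>\<gamma> \<sigma>\<^sup>-\<^sup>1 \<ell>\<^sub>Y'(p)\<close> separates \<open>G\<close> strictly from the
  recession cone plus the line through \<open>U\<close>, which forces \<open>\<phi> t > 1/\<delta>\<close> for all \<open>t\<close>.
\<close>

section \<open>Strictly convex differentiable functions and their proximal operator\<close>

text \<open>The cone comes from eliminating \<gamma>. For
  \<open>v = \<sigma> * G - \<gamma> * \<ell>'(p)\<close> the three equations give
  \<open>\<langle>G, v\<rangle> = \<sigma> * (1 - 1/\<delta>)\<close> and
  \<open>\<parallel>v\<parallel>\<^sup>2 = \<sigma>\<^sup>2 * (1 - 1/\<delta>)\<close>, so
  \<open>v\<close> lies on the boundary of a circular cone around \<open>G\<close>. Three obstacles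
  shape the existence proof. The growth of the losses controls only an L1 norm, and only
  transversally to the recession cone, whereas the constraint lives in L2; bounding the level sets
  needs both kinds of information at once. The risk need not be finite near a minimiser in the L2
  sense, so the multiplier has to be assembled from bounded directions. Finally, the cone is not
  smooth at its apex \<open>v = 0\<close>, where its gradient carries no information and the
  probabilistic structure takes over.\<close>

locale C1_strictly_convex =
  fixes f f' :: "real \<Rightarrow> real"
  assumes deriv: "\<And>t. (f has_real_derivative f' t) (at t)"
    and f'_strict_mono: "strict_mono f'"
    and f'_cont: "continuous_on UNIV f'"
begin

lemma f'_less_iff: "f' x < f' y \<longleftrightarrow> x < y"
  using f'_strict_mono by (rule strict_mono_less)

lemma f'_le_iff: "f' x \<le> f' y \<longleftrightarrow> x \<le> y"
  using f'_strict_mono by (rule strict_mono_less_eq)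

lemma isCont_f': "isCont f' x"
  using f'_cont by (simp add: continuous_on_eq_continuous_at)

lemma isCont_f: "isCont f x"
  using deriv by (rule DERIV_isCont)

lemma above_tangent_strict:
  assumes "x \<noteq> y"
  shows "f x + f' x * (y - x) < f y"
proof (cases "x < y")
  case True
  then obtain z where z: "x < z" "z < y" "f y - f x = (y - x) * f' z"
    using MVT2[of x y f f'] deriv by blast
  have "(y - x) * f' x < (y - x) * f' z"
    using z True by (intro mult_strict_left_mono) (auto simp: f'_less_iff)
  then show ?thesis using z by (simp add: algebra_simps)
next
  case False
  then have "y < x" using assms by simp
  then obtain z where z: "y < z" "z < x" "f x - f y = (x - y) * f' z"
    using MVT2[of y x f f'] deriv by blast
  have "(x - y) * f' z < (x - y) * f' x"
    using z \<open>y < x\<close> by (intro mult_strict_left_mono) (auto simp: f'_less_iff)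
  then show ?thesis using z by (simp add: algebra_simps)
qed

lemma above_tangent: "f x + f' x * (y - x) \<le> f y"
  using above_tangent_strict[of x y] by (cases "x = y") auto

lemma midpoint_le: "f ((x + y) / 2) \<le> (f x + f y) / 2"
  using above_tangent[of "(x + y) / 2" x] above_tangent[of "(x + y) / 2" y]
  by (simp add: field_simps)

text \<open>Convexity puts \<open>f (x + h) - f x\<close> between \<open>f' x * h\<close> and
  \<open>f' (x + h) * h\<close>, and monotonicity of \<open>f'\<close> lets its values at
  \<open>x - 1\<close> and \<open>x + 1\<close> control both slopes. This dominates the increments
  of a loss along bounded perturbations.\<close>

lemma increment_le:
  assumes "\<bar>f' (x - 1)\<bar> \<le> B" "\<bar>f' (x + 1)\<bar> \<le> B" "\<bar>h\<bar> \<le> 1"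
  shows "\<bar>f (x + h) - f x\<bar> \<le> B * \<bar>h\<bar>"
proof -
  have *: "\<bar>f' y\<bar> \<le> B" if "\<bar>y - x\<bar> \<le> 1" for y
    using that assms f'_le_iff[of "x - 1" y] f'_le_iff[of y "x + 1"] by force
  have "f (x + h) - f x \<le> f' (x + h) * h"
    using above_tangent[of "x + h" x] by simp
  also have "\<dots> \<le> \<bar>f' (x + h)\<bar> * \<bar>h\<bar>" by (simp flip: abs_mult)
  also have "\<dots> \<le> B * \<bar>h\<bar>" using *[of "x + h"] assms by (intro mult_right_mono) auto
  finally have 1: "f (x + h) - f x \<le> B * \<bar>h\<bar>" .
  have "f x - f (x + h) \<le> - (f' x * h)"
    using above_tangent[of x "x + h"] by simp
  also have "\<dots> \<le> \<bar>f' x\<bar> * \<bar>h\<bar>" by (metis abs_ge_minus_self abs_mult)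
  also have "\<dots> \<le> B * \<bar>h\<bar>" using *[of x] assms by (intro mult_right_mono) auto
  finally show ?thesis using 1 by linarith
qed

lemma strict_mono_iff: "strict_mono f \<longleftrightarrow> (\<forall>u. f' u > 0)"
proof
  assume m: "strict_mono f"
  show "\<forall>u. f' u > 0"
  proof
    fix u
    have "f (u - 1) < f u" using m by (auto simp: strict_mono_def)
    moreover have "f u + f' u * ((u - 1) - u) \<le> f (u - 1)" by (rule above_tangent)
    ultimately show "f' u > 0" by (simp add: algebra_simps)
  qed
next
  assume "\<forall>u. f' u > 0"
  then show "strict_mono f"
    unfolding strict_mono_def using deriv DERIV_pos_imp_increasing by blast
qed

lemma strict_antimono_iff: "strict_antimono_on UNIV f \<longleftrightarrow> (\<forall>u. f' u < 0)"
proof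
  assume m: "strict_antimono_on UNIV f"
  show "\<forall>u. f' u < 0"
  proof
    fix u
    have "f (u + 1) < f u" using m by (auto simp: monotone_on_def)
    moreover have "f u + f' u * ((u + 1) - u) \<le> f (u + 1)" by (rule above_tangent)
    ultimately show "f' u < 0" by (simp add: algebra_simps)
  qed
next
  assume "\<forall>u. f' u < 0"
  then show "strict_antimono_on UNIV f"
    unfolding monotone_on_def using deriv DERIV_neg_imp_decreasing by blast
qed

text \<open>Intermediate value theorem for \<open>f'\<close>. Together with
  \<open>strict_mono_iff\<close>, \<open>strict_antimono_iff\<close> and \<open>coercive_iff\<close>
  this is the partition into increasing, decreasing and coercive losses.\<close>

lemma sign_cases: "(\<exists>u. f' u = 0) \<or> (\<forall>u. f' u > 0) \<or> (\<forall>u. f' u < 0)"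
proof (rule ccontr)
  assume *: "\<not> ?thesis"
  then obtain u v where "f' u \<le> 0" "f' v \<ge> 0" by (meson not_le)
  then have "u \<le> v" using f'_le_iff[of u v] by simp
  then have "\<exists>x\<ge>u. x \<le> v \<and> f' x = 0"
    using \<open>f' u \<le> 0\<close> \<open>f' v \<ge> 0\<close> f'_cont
    by (intro IVT') (auto intro: continuous_on_subset)
  then show False using * by blast
qed

lemma coercive_iff: "coercive f \<longleftrightarrow> (\<exists>u. f' u = 0)"
proof
  assume c: "coercive f"
  have ev: "eventually (\<lambda>x. f x > f 0) at_infinity"
    using c unfolding coercive_def by (auto simp: filterlim_at_top_dense)
  then obtain B where B: "\<And>x. norm x \<ge> B \<Longrightarrow> f x > f 0"
    by (auto simp: eventually_at_infinity)
  have "f (max B 1) > f 0" "f (- max B 1) > f 0" by (auto intro: B)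
  then have "\<not> strict_mono f" "\<not> strict_antimono_on UNIV f"
    by (auto simp: monotone_on_def max_def split: if_splits)
      (smt (verit))+
  then show "\<exists>u. f' u = 0"
    using sign_cases strict_mono_iff strict_antimono_iff by blast
next
  assume "\<exists>u. f' u = 0"
  then obtain u where u: "f' u = 0" ..
  \<comment> \<open>The tangents at \<open>u + 1\<close> and \<open>u - 1\<close> have slopes of
    opposite strict signs; \<open>c\<close> is the smaller steepness, and the two tangents force
    linear growth at rate \<open>c\<close>.\<close>
  define c where "c = min (f' (u + 1)) (- f' (u - 1))"
  have c: "c > 0" using u f'_less_iff[of u "u+1"] f'_less_iff[of "u-1" u] by (simp add: c_def)
  define k where "k = min (f (u+1)) (f (u-1))"
  have "k + c * (\<bar>x\<bar> - \<bar>u\<bar> - 1) \<le> f x" if "\<bar>x\<bar> \<ge> \<bar>u\<bar> + 1" for x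
  proof (cases "x > 0")
    case True
    have "c * (\<bar>x\<bar> - \<bar>u\<bar> - 1) \<le> f' (u + 1) * (x - (u + 1))"
      using c True that by (intro mult_mono) (auto simp: c_def)
    then show ?thesis using above_tangent[of "u+1" x] by (simp add: k_def)
  next
    case False
    have "c * (\<bar>x\<bar> - \<bar>u\<bar> - 1) \<le> (- f' (u - 1)) * ((u - 1) - x)"
      using c False that by (intro mult_mono) (auto simp: c_def)
    then show ?thesis using above_tangent[of "u-1" x] by (simp add: k_def algebra_simps)
  qed
  note * = this
  show "coercive f"
    unfolding coercive_def
  proof (rule filterlim_at_top_mono)
    have 1: "filterlim (\<lambda>x::real. (k - c * (\<bar>u\<bar> + 1)) + c * norm x) at_top at_infinity"
      by (rule filterlim_tendsto_add_at_top[OF tendsto_const])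
        (rule filterlim_tendsto_pos_mult_at_top[OF tendsto_const c filterlim_norm_at_top])
    then show "filterlim (\<lambda>x::real. (k - c * (\<bar>u\<bar> + 1)) + c * norm x) at_top at_infinity" .
    show "\<forall>\<^sub>F x in at_infinity. k - c * (\<bar>u\<bar> + 1) + c * norm x \<le> f x"
      unfolding eventually_at_infinity using * by (auto simp: algebra_simps intro!: exI[of _ "\<bar>u\<bar>+1"])
  qed
qed

section \<open>The proximal point as the root of its stationarity equation\<close>

text \<open>When the square is expanded around \<open>u\<close>, its linear term cancels the slope
  in the tangent inequality by stationarity, so every other point is strictly worse. Strictness
  identifies the point picked by the choice operator behind the arg min.\<close>

lemma prox_unique:
  assumes "\<gamma> > 0" "u + \<gamma> * f' u = x"
  shows "prox \<gamma> f x = u"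
proof -
  let ?h = "\<lambda>u. 1 / (2 * \<gamma>) * (x - u)\<^sup>2 + f u"
  have less: "?h u < ?h v" if "v \<noteq> u" for v
  proof -
    have "f u + f' u * (v - u) < f v" using that above_tangent_strict by metis
    moreover have "f' u = (x - u) / \<gamma>" using assms by (auto simp: field_simps)
    moreover have "(x - v)\<^sup>2 = (x - u)\<^sup>2 - 2 * (x - u) * (v - u) + (v - u)\<^sup>2"
      by (simp add: power2_eq_square algebra_simps)
    then have "1 / (2 * \<gamma>) * (x - v)\<^sup>2
        = 1 / (2 * \<gamma>) * (x - u)\<^sup>2 - (x - u) / \<gamma> * (v - u) + 1 / (2 * \<gamma>) * (v - u)\<^sup>2"
      using assms(1) by (simp add: field_simps)
    moreover have "1 / (2 * \<gamma>) * (v - u)\<^sup>2 \<ge> 0" using assms(1) by simp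
    ultimately show ?thesis by simp
  qed
  show ?thesis
    unfolding prox_def arg_min_def is_arg_min_def
  proof (rule some_equality)
    show "True \<and> \<not> (\<exists>y. True \<and> ?h y < ?h u)"
      using less by (metis less_asym less_irrefl)
    show "v = u" if "True \<and> \<not> (\<exists>y. True \<and> ?h y < ?h v)" for v
      using less that by blast
  qed
qed

lemma prox_equation:
  assumes "\<gamma> > 0"
  shows "prox \<gamma> f x + \<gamma> * f' (prox \<gamma> f x) = x"
proof -
  let ?g = "\<lambda>u. u + \<gamma> * f' u"
  \<comment> \<open>Large enough for \<open>-r\<close> and \<open>r\<close> to bracket the root:
    \<open>f'\<close> is increasing, so the term \<open>\<gamma> * \<bar>f' 0\<bar>\<close> absorbs
    \<open>\<gamma> * f'\<close> at either end.\<close>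
  define r where "r = \<bar>x\<bar> + \<gamma> * \<bar>f' 0\<bar>"
  have r: "r \<ge> 0" using assms by (simp add: r_def)
  have "\<exists>u\<ge>-r. u \<le> r \<and> ?g u = x"
  proof (rule IVT')
    have "\<gamma> * f' (-r) \<le> \<gamma> * f' 0" "\<gamma> * f' 0 \<le> \<gamma> * f' r"
      using r assms by (auto intro!: mult_left_mono simp: f'_le_iff)
    moreover have "\<bar>\<gamma> * f' 0\<bar> = \<gamma> * \<bar>f' 0\<bar>" using assms by (simp add: abs_mult)
    ultimately show "?g (-r) \<le> x" "x \<le> ?g r" unfolding r_def by linarith+
    show "continuous_on {-r..r} ?g"
      by (intro continuous_intros continuous_on_subset[OF f'_cont]) auto
  qed (use r in auto)
  then show ?thesis using prox_unique[OF assms] by auto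
qed

text \<open>The proximal map inverts the strictly increasing map \<open>u + \<gamma> * f' u\<close>.
  This form describes sublevel sets without the arg min and so yields measurability in
  \<omega>.\<close>

lemma prox_le_iff:
  assumes "\<gamma> > 0"
  shows "prox \<gamma> f x \<le> s \<longleftrightarrow> x \<le> s + \<gamma> * f' s"
proof -
  have mono: "u + \<gamma> * f' u < v + \<gamma> * f' v" if "u < v" for u v
    using that assms f'_less_iff[of u v] by (simp add: add_strict_mono)
  show ?thesis
    using prox_equation[OF assms, of x] mono[of s "prox \<gamma> f x"] mono[of "prox \<gamma> f x" s]
    by (metis linorder_not_le order_less_le order_refl)
qed

end

lemma C1_strictly_convexI:
  assumes "f C1_differentiable_on UNIV" and "strictly_convex f"
  shows "C1_strictly_convex f (deriv f)"
proof -
  obtain D where D: "\<And>x. (f has_vector_derivative D x) (at x)" "continuous_on UNIV D"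
    using assms(1) unfolding C1_differentiable_on_def by auto
  have d: "(f has_real_derivative D x) (at x)" for x
    using D(1) by (simp add: has_real_derivative_iff_has_vector_derivative)
  then have [simp]: "deriv f = D" by (auto intro: DERIV_imp_deriv)
  have conv: "convex_on UNIV f"
  proof (rule convex_onI)
    fix t x y :: real assume "0 < t" "t < 1"
    then show "f ((1 - t) *\<^sub>R x + t *\<^sub>R y) \<le> (1 - t) * f x + t * f y"
      using assms(2) \<open>0 < t\<close> \<open>t < 1\<close> unfolding strictly_convex_def real_scaleR_def
      by (cases "x = y") (simp add: algebra_simps, blast intro: less_imp_le)
  qed auto
  have tan: "f x + D x * (y - x) \<le> f y" for x y
    using convex_on_imp_above_tangent[where f=f and A=UNIV and c=x and x=y and f'="D x"] conv d[of x]
    by (simp add: algebra_simps)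
  have "strict_mono D"
  proof (rule strict_monoI)
    fix x y :: real assume "x < y"
    then have "f ((1 - 1/2) * x + 1/2 * y) < (1 - 1/2) * f x + 1/2 * f y"
      using assms(2) unfolding strictly_convex_def by (metis half_gt_zero_iff less_irrefl field_sum_of_halves less_add_same_cancel1 zero_less_one)
    then have m: "2 * f ((x + y) / 2) < f x + f y" by (simp add: algebra_simps add_divide_distrib)
    \<comment> \<open>Both tangents are evaluated at the midpoint; their sum, compared with strict
      midpoint convexity, separates the two slopes.\<close>
    have "f x + D x * ((y - x) / 2) \<le> f ((x + y) / 2)" "f y - D y * ((y - x) / 2) \<le> f ((x + y) / 2)"
      using tan[of x "(x + y) / 2"] tan[of y "(x + y) / 2"] by (simp_all add: field_simps)
    then have "(D y - D x) * (y - x) > 0"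
      using m by (simp add: algebra_simps diff_divide_distrib)
    then show "D x < D y" using \<open>x < y\<close> by (simp add: zero_less_mult_iff)
  qed
  then show ?thesis using d D(2) by unfold_locales auto
qed

section \<open>Square integrable random variables\<close>

context prob_space
begin

text \<open>A predicate on functions and not on classes modulo null sets, because the losses are
  evaluated pointwise at them.\<close>

definition L2 :: "('a \<Rightarrow> real) \<Rightarrow> bool" where
  "L2 x \<longleftrightarrow> x \<in> borel_measurable M \<and> integrable M (\<lambda>\<omega>. (x \<omega>)\<^sup>2)"

definition ip :: "('a \<Rightarrow> real) \<Rightarrow> ('a \<Rightarrow> real) \<Rightarrow> real" where
  "ip x y = (\<integral>\<omega>. x \<omega> * y \<omega> \<partial>M)"

lemma L2_measurable [measurable_dest]: "L2 x \<Longrightarrow> x \<in> borel_measurable M"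
  by (simp add: L2_def)

lemma L2_mult:
  assumes "L2 x" "L2 y"
  shows "integrable M (\<lambda>\<omega>. x \<omega> * y \<omega>)"
proof (rule Bochner_Integration.integrable_bound)
  show "integrable M (\<lambda>\<omega>. (x \<omega>)\<^sup>2 + (y \<omega>)\<^sup>2)" using assms by (auto simp: L2_def)
  have "\<bar>a * b\<bar> \<le> a\<^sup>2 + b\<^sup>2" for a b :: real
  proof -
    have "2 * (\<bar>a\<bar> * \<bar>b\<bar>) \<le> a\<^sup>2 + b\<^sup>2"
      using sum_squares_bound[of "\<bar>a\<bar>" "\<bar>b\<bar>"] by (simp add: mult.assoc)
    moreover have "\<bar>a\<bar> * \<bar>b\<bar> \<ge> 0" by simp
    ultimately show ?thesis unfolding abs_mult by linarith
  qed
  then show "AE \<omega> in M. norm (x \<omega> * y \<omega>) \<le> norm ((x \<omega>)\<^sup>2 + (y \<omega>)\<^sup>2)"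
    by (auto simp: abs_of_nonneg)
qed (use assms in \<open>auto simp: L2_def\<close>)

lemma L2_const [simp]: "L2 (\<lambda>_. c)"
  by (simp add: L2_def)

lemma L2_integrable: "L2 x \<Longrightarrow> integrable M x"
  using L2_mult[of x "\<lambda>_. 1"] by simp

lemma L2_add: "L2 x \<Longrightarrow> L2 y \<Longrightarrow> L2 (\<lambda>\<omega>. x \<omega> + y \<omega>)"
  using L2_mult[of x y] by (auto simp: L2_def power2_sum mult.assoc)

lemma L2_cmult: "L2 x \<Longrightarrow> L2 (\<lambda>\<omega>. c * x \<omega>)"
  by (auto simp: L2_def power_mult_distrib)

lemma L2_diff: "L2 x \<Longrightarrow> L2 y \<Longrightarrow> L2 (\<lambda>\<omega>. x \<omega> - y \<omega>)"
  using L2_add[of x "\<lambda>\<omega>. (-1) * y \<omega>"] L2_cmult[of y "-1"] by simp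

lemma L2_uminus: "L2 x \<Longrightarrow> L2 (\<lambda>\<omega>. - x \<omega>)"
  using L2_cmult[of x "-1"] by simp

lemma L2_bound:
  assumes "L2 y" "x \<in> borel_measurable M" "AE \<omega> in M. \<bar>x \<omega>\<bar> \<le> \<bar>y \<omega>\<bar>"
  shows "L2 x"
proof -
  have "integrable M (\<lambda>\<omega>. (x \<omega>)\<^sup>2)"
  proof (rule Bochner_Integration.integrable_bound)
    show "integrable M (\<lambda>\<omega>. (y \<omega>)\<^sup>2)" using assms(1) by (simp add: L2_def)
    show "(\<lambda>\<omega>. (x \<omega>)\<^sup>2) \<in> borel_measurable M" using assms(2) by simp
    show "AE \<omega> in M. norm ((x \<omega>)\<^sup>2) \<le> norm ((y \<omega>)\<^sup>2)"
      using assms(3) by eventually_elim (simp add: abs_le_square_iff)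
  qed
  then show ?thesis using assms(2) by (simp add: L2_def)
qed

lemma L2_bounded:
  assumes "x \<in> borel_measurable M" "\<And>\<omega>. \<omega> \<in> space M \<Longrightarrow> \<bar>x \<omega>\<bar> \<le> B"
  shows "L2 x"
proof (rule L2_bound[of "\<lambda>_. B"])
  show "AE \<omega> in M. \<bar>x \<omega>\<bar> \<le> \<bar>B\<bar>" using assms(2) by (intro AE_I2) force
qed (use assms in auto)

lemmas L2_intros = L2_add L2_cmult L2_diff L2_uminus L2_const

lemma ip_commute: "ip x y = ip y x"
  by (simp add: ip_def mult.commute)

lemma ip_add_left: "L2 x \<Longrightarrow> L2 y \<Longrightarrow> L2 z \<Longrightarrow> ip (\<lambda>\<omega>. x \<omega> + y \<omega>) z = ip x z + ip y z"
  by (simp add: ip_def distrib_right L2_mult)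

lemma ip_diff_left: "L2 x \<Longrightarrow> L2 y \<Longrightarrow> L2 z \<Longrightarrow> ip (\<lambda>\<omega>. x \<omega> - y \<omega>) z = ip x z - ip y z"
  by (simp add: ip_def left_diff_distrib L2_mult)

lemma ip_cmult_left: "ip (\<lambda>\<omega>. c * x \<omega>) z = c * ip x z"
  by (simp add: ip_def mult.assoc)

lemma ip_uminus_left: "ip (\<lambda>\<omega>. - x \<omega>) z = - ip x z"
  by (simp add: ip_def)

lemma ip_add_right: "L2 x \<Longrightarrow> L2 y \<Longrightarrow> L2 z \<Longrightarrow> ip z (\<lambda>\<omega>. x \<omega> + y \<omega>) = ip z x + ip z y"
  by (simp add: ip_commute[of z] ip_add_left)

lemma ip_diff_right: "L2 x \<Longrightarrow> L2 y \<Longrightarrow> L2 z \<Longrightarrow> ip z (\<lambda>\<omega>. x \<omega> - y \<omega>) = ip z x - ip z y"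
  by (simp add: ip_commute[of z] ip_diff_left)

lemma ip_cmult_right: "ip z (\<lambda>\<omega>. c * x \<omega>) = c * ip z x"
  by (simp add: ip_commute[of z] ip_cmult_left)

lemma ip_uminus_right: "ip z (\<lambda>\<omega>. - x \<omega>) = - ip z x"
  by (simp add: ip_def)

lemmas ip_simps = ip_add_left ip_diff_left ip_cmult_left ip_uminus_left
  ip_add_right ip_diff_right ip_cmult_right ip_uminus_right

lemma ip_self: "ip x x = (\<integral>\<omega>. (x \<omega>)\<^sup>2 \<partial>M)"
  by (simp add: ip_def power2_eq_square)

lemma ip_self_nonneg: "0 \<le> ip x x"
  by (simp add: ip_self)

lemma ip_cong_AE:
  assumes "AE \<omega> in M. x \<omega> = x' \<omega>" "AE \<omega> in M. y \<omega> = y' \<omega>" "L2 x" "L2 y" "L2 x'" "L2 y'"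
  shows "ip x y = ip x' y'"
  unfolding ip_def
proof (rule integral_cong_AE)
  show "AE \<omega> in M. x \<omega> * y \<omega> = x' \<omega> * y' \<omega>" using assms(1,2) by eventually_elim simp
qed (use assms in \<open>auto simp: L2_def\<close>)

lemma ip_self_eq_0_iff:
  assumes "L2 x"
  shows "ip x x = 0 \<longleftrightarrow> (AE \<omega> in M. x \<omega> = 0)"
  using assms unfolding ip_self L2_def by (subst integral_nonneg_eq_0_iff_AE) auto

lemma Cauchy_Schwarz_ip:
  assumes "L2 x" "L2 y"
  shows "(ip x y)\<^sup>2 \<le> ip x x * ip y y"
proof -
  have *: "0 \<le> ip x x * t\<^sup>2 - 2 * t * ip x y + ip y y" for t
  proof -
    have "0 \<le> ip (\<lambda>\<omega>. t * x \<omega> - y \<omega>) (\<lambda>\<omega>. t * x \<omega> - y \<omega>)" by (rule ip_self_nonneg)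
    also have "\<dots> = ip x x * t\<^sup>2 - 2 * t * ip x y + ip y y"
      using assms by (simp add: ip_simps L2_intros ip_commute[of y x] power2_eq_square algebra_simps)
    finally show ?thesis .
  qed
  show ?thesis
  proof (cases "ip x x = 0")
    case True
    then have "AE \<omega> in M. x \<omega> = 0" using assms ip_self_eq_0_iff by blast
    then have "ip x y = ip (\<lambda>_. 0) y" using assms by (intro ip_cong_AE) auto
    then show ?thesis using True by (simp add: ip_def)
  next
    case False
    then have pos: "ip x x > 0" using ip_self_nonneg[of x] by simp
    from *[of "ip x y / ip x x"] have "(ip x y)\<^sup>2 / ip x x \<le> ip y y"
      using pos by (simp add: power2_eq_square field_simps)
    then show ?thesis using pos by (simp add: field_simps)
  qed
qed

lemma Cauchy_Schwarz_ip_sqrt: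
  assumes "L2 x" "L2 y"
  shows "\<bar>ip x y\<bar> \<le> sqrt (ip x x) * sqrt (ip y y)"
  using real_le_rsqrt[of "\<bar>ip x y\<bar>"] Cauchy_Schwarz_ip[OF assms]
  by (simp flip: real_sqrt_mult)

lemma ip_triangle:
  assumes "L2 x" "L2 y"
  shows "sqrt (ip (\<lambda>\<omega>. x \<omega> + y \<omega>) (\<lambda>\<omega>. x \<omega> + y \<omega>)) \<le> sqrt (ip x x) + sqrt (ip y y)"
proof (rule real_le_lsqrt)
  have "ip (\<lambda>\<omega>. x \<omega> + y \<omega>) (\<lambda>\<omega>. x \<omega> + y \<omega>) = ip x x + 2 * ip x y + ip y y"
    using assms by (simp add: ip_simps L2_intros ip_commute[of y x])
  also have "\<dots> \<le> ip x x + 2 * (sqrt (ip x x) * sqrt (ip y y)) + ip y y"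
    using Cauchy_Schwarz_ip_sqrt[OF assms] by simp
  also have "\<dots> = (sqrt (ip x x) + sqrt (ip y y))\<^sup>2"
    by (simp add: power2_sum ip_self_nonneg)
  finally show "ip (\<lambda>\<omega>. x \<omega> + y \<omega>) (\<lambda>\<omega>. x \<omega> + y \<omega>) \<le> (sqrt (ip x x) + sqrt (ip y y))\<^sup>2" .
qed (simp add: ip_self_nonneg)

lemma ip_mono:
  assumes "L2 x" "L2 y" "AE \<omega> in M. \<bar>x \<omega>\<bar> \<le> \<bar>y \<omega>\<bar>"
  shows "ip x x \<le> ip y y"
  unfolding ip_self
proof (rule integral_mono_AE)
  show "AE \<omega> in M. (x \<omega>)\<^sup>2 \<le> (y \<omega>)\<^sup>2"
    using assms(3) by eventually_elim (simp add: abs_le_square_iff)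
qed (use assms in \<open>auto simp: L2_def\<close>)

lemma expectation_abs_le:
  assumes "L2 x"
  shows "(\<integral>\<omega>. \<bar>x \<omega>\<bar> \<partial>M) \<le> sqrt (ip x x)"
proof -
  have "L2 (\<lambda>\<omega>. \<bar>x \<omega>\<bar>)" using assms by (intro L2_bound[OF assms]) auto
  from Cauchy_Schwarz_ip_sqrt[OF this L2_const[of 1]] show ?thesis
    by (simp add: ip_def prob_space)
qed

text \<open>
  Geometric decay makes the sum of the increments finite almost everywhere, and Fatou's lemma turns
  the Cauchy bound into convergence in norm.
\<close>

lemma L2_complete:
  assumes X: "\<And>k. L2 (X k)"
    and C: "\<And>k m. k \<le> m \<Longrightarrow> ip (\<lambda>\<omega>. X m \<omega> - X k \<omega>) (\<lambda>\<omega>. X m \<omega> - X k \<omega>) \<le> (1/4) ^ k"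
  shows "\<exists>x. L2 x \<and> (AE \<omega> in M. (\<lambda>k. X k \<omega>) \<longlonglongrightarrow> x \<omega>) \<and>
    (\<lambda>k. ip (\<lambda>\<omega>. x \<omega> - X k \<omega>) (\<lambda>\<omega>. x \<omega> - X k \<omega>)) \<longlonglongrightarrow> 0"
proof -
  have meas [measurable]: "X k \<in> borel_measurable M" for k using X by (simp add: L2_def)
  define x where "x \<omega> = lim (\<lambda>k. X k \<omega>)" for \<omega>
  have xm [measurable]: "x \<in> borel_measurable M" unfolding x_def by measurable
  have inc: "(\<integral>\<^sup>+\<omega>. ennreal \<bar>X (Suc k) \<omega> - X k \<omega>\<bar> \<partial>M) \<le> ennreal ((1/2)^k)" for k
  proof -
    have L: "L2 (\<lambda>\<omega>. X (Suc k) \<omega> - X k \<omega>)" using X by (intro L2_intros)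
    then have "(\<integral>\<^sup>+\<omega>. ennreal \<bar>X (Suc k) \<omega> - X k \<omega>\<bar> \<partial>M) = ennreal (\<integral>\<omega>. \<bar>X (Suc k) \<omega> - X k \<omega>\<bar> \<partial>M)"
      using L2_integrable[OF L] by (intro nn_integral_eq_integral) auto
    also have "\<dots> \<le> ennreal (sqrt ((1/4)^k))"
      using expectation_abs_le[OF L] C[of k "Suc k"]
      by (intro ennreal_leI) (meson real_sqrt_le_mono order_trans le_SucI order_refl)
    also have "sqrt ((1/4)^k) = (1/2)^k" by (simp add: real_sqrt_power real_sqrt_divide)
    finally show ?thesis .
  qed
  have "(\<integral>\<^sup>+\<omega>. (\<Sum>k. ennreal \<bar>X (Suc k) \<omega> - X k \<omega>\<bar>) \<partial>M)
      = (\<Sum>k. \<integral>\<^sup>+\<omega>. ennreal \<bar>X (Suc k) \<omega> - X k \<omega>\<bar> \<partial>M)"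
    by (rule nn_integral_suminf) measurable
  also have "\<dots> \<le> (\<Sum>k. ennreal ((1/2)^k))"
    using inc by (intro suminf_le) auto
  also have "\<dots> < \<infinity>"
    by (subst suminf_ennreal2) (auto intro: summable_geometric)
  finally have "AE \<omega> in M. (\<Sum>k. ennreal \<bar>X (Suc k) \<omega> - X k \<omega>\<bar>) \<noteq> \<infinity>"
    by (intro nn_integral_PInf_AE) auto
  then have conv: "AE \<omega> in M. (\<lambda>k. X k \<omega>) \<longlonglongrightarrow> x \<omega>"
  proof eventually_elim
    case (elim \<omega>)
    then have "summable (\<lambda>k. \<bar>X (Suc k) \<omega> - X k \<omega>\<bar>)"
      by (intro summable_suminf_not_top) (auto simp: infinity_ennreal_def)
    then have "summable (\<lambda>k. X (Suc k) \<omega> - X k \<omega>)" by (rule summable_rabs_cancel)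
    then have "(\<lambda>n. (\<Sum>k<n. X (Suc k) \<omega> - X k \<omega>)) \<longlonglongrightarrow> (\<Sum>k. X (Suc k) \<omega> - X k \<omega>)"
      by (rule summable_LIMSEQ)
    then have "(\<lambda>n. (X n \<omega> - X 0 \<omega>) + X 0 \<omega>) \<longlonglongrightarrow> (\<Sum>k. X (Suc k) \<omega> - X k \<omega>) + X 0 \<omega>"
      unfolding sum_lessThan_telescope[of "\<lambda>k. X k \<omega>"] by (rule tendsto_add[OF _ tendsto_const])
    then have "convergent (\<lambda>k. X k \<omega>)" by (auto simp: convergent_def)
    then show ?case unfolding x_def by (rule convergent_LIMSEQ_iff[THEN iffD1])
  qed
  have bound: "(\<integral>\<^sup>+\<omega>. ennreal ((x \<omega> - X k \<omega>)\<^sup>2) \<partial>M) \<le> ennreal ((1/4)^k)" for k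
  proof -
    have "(\<integral>\<^sup>+\<omega>. ennreal ((x \<omega> - X k \<omega>)\<^sup>2) \<partial>M)
        = (\<integral>\<^sup>+\<omega>. liminf (\<lambda>m. ennreal ((X m \<omega> - X k \<omega>)\<^sup>2)) \<partial>M)"
    proof (rule nn_integral_cong_AE)
      show "AE \<omega> in M. ennreal ((x \<omega> - X k \<omega>)\<^sup>2) = liminf (\<lambda>m. ennreal ((X m \<omega> - X k \<omega>)\<^sup>2))"
        using conv
      proof eventually_elim
        case (elim \<omega>)
        have "(\<lambda>m. ennreal ((X m \<omega> - X k \<omega>)\<^sup>2)) \<longlonglongrightarrow> ennreal ((x \<omega> - X k \<omega>)\<^sup>2)"
          by (intro tendsto_intros elim tendsto_ennrealI)
        then show ?case by (rule lim_imp_Liminf[OF trivial_limit_sequentially, symmetric])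
      qed
    qed
    also have "\<dots> \<le> liminf (\<lambda>m. \<integral>\<^sup>+\<omega>. ennreal ((X m \<omega> - X k \<omega>)\<^sup>2) \<partial>M)"
      by (rule nn_integral_liminf) measurable
    also have "\<dots> \<le> ennreal ((1/4)^k)"
    proof -
      have "(\<integral>\<^sup>+\<omega>. ennreal ((X m \<omega> - X k \<omega>)\<^sup>2) \<partial>M) \<le> ennreal ((1/4)^k)" if "k \<le> m" for m
      proof -
        have L: "L2 (\<lambda>\<omega>. X m \<omega> - X k \<omega>)" using X by (intro L2_intros)
        then have "(\<integral>\<^sup>+\<omega>. ennreal ((X m \<omega> - X k \<omega>)\<^sup>2) \<partial>M) = ennreal (ip (\<lambda>\<omega>. X m \<omega> - X k \<omega>) (\<lambda>\<omega>. X m \<omega> - X k \<omega>))"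
          unfolding ip_self by (intro nn_integral_eq_integral) (auto simp: L2_def)
        then show ?thesis using C[OF that] by (simp add: ennreal_leI)
      qed
      then have "\<forall>\<^sub>F m in sequentially. (\<integral>\<^sup>+\<omega>. ennreal ((X m \<omega> - X k \<omega>)\<^sup>2) \<partial>M) \<le> ennreal ((1/4)^k)"
        by (auto simp: eventually_sequentially)
      then show ?thesis by (intro Liminf_le) auto
    qed
    finally show ?thesis .
  qed
  have Ldiff: "L2 (\<lambda>\<omega>. x \<omega> - X k \<omega>)" for k
    unfolding L2_def using bound[of k]
    by (intro conjI integrableI_nonneg) (auto intro: le_less_trans)
  have "L2 (\<lambda>\<omega>. (x \<omega> - X 0 \<omega>) + X 0 \<omega>)" by (intro L2_add Ldiff X)
  then have Lx: "L2 x" by simp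
  have b: "ip (\<lambda>\<omega>. x \<omega> - X k \<omega>) (\<lambda>\<omega>. x \<omega> - X k \<omega>) \<le> (1/4)^k" for k
  proof -
    have "ennreal (ip (\<lambda>\<omega>. x \<omega> - X k \<omega>) (\<lambda>\<omega>. x \<omega> - X k \<omega>)) = (\<integral>\<^sup>+\<omega>. ennreal ((x \<omega> - X k \<omega>)\<^sup>2) \<partial>M)"
      unfolding ip_self using Ldiff[of k] by (intro nn_integral_eq_integral[symmetric]) (auto simp: L2_def)
    then show ?thesis using bound[of k] by (metis ennreal_le_iff zero_le_divide_1_iff zero_le_numeral zero_le_power)
  qed
  have "(\<lambda>k. ip (\<lambda>\<omega>. x \<omega> - X k \<omega>) (\<lambda>\<omega>. x \<omega> - X k \<omega>)) \<longlonglongrightarrow> 0"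
    by (rule tendsto_sandwich[OF _ _ tendsto_const LIMSEQ_power_zero[of "1/4::real"]])
      (auto intro!: always_eventually b ip_self_nonneg)
  with conv Lx show ?thesis by blast
qed

lemma ip_parallelogram:
  assumes "L2 x" "L2 y"
  shows "ip (\<lambda>\<omega>. x \<omega> - y \<omega>) (\<lambda>\<omega>. x \<omega> - y \<omega>)
    = 2 * ip x x + 2 * ip y y - 4 * ip (\<lambda>\<omega>. (x \<omega> + y \<omega>) / 2) (\<lambda>\<omega>. (x \<omega> + y \<omega>) / 2)"
proof -
  have "ip (\<lambda>\<omega>. (1/2) * (x \<omega> + y \<omega>)) (\<lambda>\<omega>. (1/2) * (x \<omega> + y \<omega>)) = (ip x x + 2 * ip x y + ip y y) / 4"
    using assms by (simp only: ip_cmult_left ip_cmult_right) (simp add: ip_simps L2_intros ip_commute[of y x])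
  then show ?thesis
    using assms by (simp add: ip_simps L2_intros ip_commute[of y x])
qed

text \<open>
  Elements of nearly minimal norm form a Cauchy sequence by the parallelogram law.
\<close>

lemma nested_midpoint_convex:
  assumes ne: "\<And>n. S n \<noteq> {}" and dec: "\<And>m n. m \<le> n \<Longrightarrow> S n \<subseteq> S m"
    and L: "\<And>n x. x \<in> S n \<Longrightarrow> L2 x" and bdd: "\<And>n x. x \<in> S n \<Longrightarrow> ip x x \<le> B"
    and mid: "\<And>n x y. x \<in> S n \<Longrightarrow> y \<in> S n \<Longrightarrow> (\<lambda>\<omega>. (x \<omega> + y \<omega>) / 2) \<in> S n"
  shows "\<exists>X x. (\<forall>k. X k \<in> S k) \<and> L2 x \<and> (AE \<omega> in M. (\<lambda>k. X k \<omega>) \<longlonglongrightarrow> x \<omega>) \<and>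
    (\<lambda>k. ip (\<lambda>\<omega>. x \<omega> - X k \<omega>) (\<lambda>\<omega>. x \<omega> - X k \<omega>)) \<longlonglongrightarrow> 0"
proof -
  define \<rho> where "\<rho> n = (INF x\<in>S n. ip x x)" for n
  have bb: "bdd_below ((\<lambda>x. ip x x) ` S n)" for n
    by (rule bdd_belowI[of _ 0]) (auto simp: ip_self_nonneg)
  have \<rho>_le: "\<rho> n \<le> ip x x" if "x \<in> S n" for n x
    unfolding \<rho>_def using bb that by (rule cINF_lower)
  have "incseq \<rho>"
    unfolding \<rho>_def by (intro monoI cINF_superset_mono ne bb dec) auto
  moreover have "\<rho> n \<le> B" for n
    using ne[of n] \<rho>_le bdd by (meson ex_in_conv order_trans)
  ultimately obtain r where r: "\<rho> \<longlonglongrightarrow> r" "\<And>n. \<rho> n \<le> r"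
    using incseq_convergent[of \<rho> B] by metis
  have "\<exists>y\<in>S n. ip y y < \<rho> n + 1 / Suc n" for n
    using cINF_less_iff[OF ne bb, of n "\<rho> n + 1 / Suc n"] unfolding \<rho>_def by simp
  then obtain y where y: "\<And>n. y n \<in> S n" "\<And>n. ip (y n) (y n) < \<rho> n + 1 / Suc n" by metis
  \<comment> \<open>What the parallelogram law leaves: for \<open>n \<le> m\<close> both norms are
    within \<open>1 / Suc n\<close> of \<open>\<rho> m \<le> r\<close> and of
    \<open>\<rho> n\<close>, and the midpoint still lies in \<open>S n\<close>, so its norm is at
    least \<open>\<rho> n\<close>.\<close>
  define e where "e n = 2 * (r - \<rho> n) + 4 * (1 / Suc n)" for n
  have d: "ip (\<lambda>\<omega>. y m \<omega> - y n \<omega>) (\<lambda>\<omega>. y m \<omega> - y n \<omega>) \<le> e n" if "n \<le> m" for m n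
  proof -
    have "y m \<in> S n" using y(1) dec[OF that] by blast
    then have "\<rho> n \<le> ip (\<lambda>\<omega>. (y m \<omega> + y n \<omega>) / 2) (\<lambda>\<omega>. (y m \<omega> + y n \<omega>) / 2)"
      using y(1) mid by (intro \<rho>_le) auto
    moreover have "1 / real (Suc m) \<le> 1 / real (Suc n)" using that by (simp add: frac_le)
    ultimately show ?thesis
      using y(2)[of m] y(2)[of n] r(2)[of m] L[OF y(1)]
      unfolding e_def by (subst ip_parallelogram) (auto simp del: of_nat_Suc)
  qed
  have "(\<lambda>n. 2 * (r - \<rho> n) + 4 * (1 / Suc n)) \<longlonglongrightarrow> 2 * (r - r) + 4 * 0"
    by (intro tendsto_intros r(1) LIMSEQ_Suc[OF lim_1_over_n])
  then have e0: "e \<longlonglongrightarrow> 0" by (simp add: e_def[abs_def])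
  have "\<exists>N\<ge>k. \<forall>n\<ge>N. e n < (1/4)^k" for k
  proof -
    obtain N where "\<And>n. n \<ge> N \<Longrightarrow> e n < (1/4)^k"
      using order_tendstoD(2)[OF e0, of "(1/4)^k"] by (auto simp: eventually_sequentially)
    then show ?thesis by (intro exI[of _ "max N k"]) auto
  qed
  then obtain N where N: "\<And>k. N k \<ge> k" "\<And>k n. n \<ge> N k \<Longrightarrow> e n < (1/4)^k" by metis
  \<comment> \<open>The chosen indices \<open>N k\<close> need not increase with \<open>k\<close>;
    their partial sums do, and still dominate them.\<close>
  define R where "R k = (\<Sum>j\<le>k. N j)" for k
  have RN: "R k \<ge> N k" for k unfolding R_def by (rule member_le_sum) auto
  have Rmono: "R k \<le> R m" if "k \<le> m" for k m unfolding R_def using that by (intro sum_mono2) auto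
  define X where "X k = y (R k)" for k
  have XS: "X k \<in> S k" for k
    unfolding X_def using y(1) dec[of k "R k"] N(1)[of k] RN[of k] by auto
  have "ip (\<lambda>\<omega>. X m \<omega> - X k \<omega>) (\<lambda>\<omega>. X m \<omega> - X k \<omega>) \<le> (1/4) ^ k" if "k \<le> m" for k m
    using d[OF Rmono[OF that]] N(2)[OF RN, of k] unfolding X_def by linarith
  from L2_complete[OF L[OF XS] this] XS show ?thesis by blast
qed

lemma tendsto_ip_left:
  assumes "L2 x" "\<And>k. L2 (X k)" "L2 y"
    and "(\<lambda>k. ip (\<lambda>\<omega>. x \<omega> - X k \<omega>) (\<lambda>\<omega>. x \<omega> - X k \<omega>)) \<longlonglongrightarrow> 0"
  shows "(\<lambda>k. ip (X k) y) \<longlonglongrightarrow> ip x y"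
proof -
  have "(\<lambda>k. sqrt (ip (\<lambda>\<omega>. x \<omega> - X k \<omega>) (\<lambda>\<omega>. x \<omega> - X k \<omega>)) * sqrt (ip y y)) \<longlonglongrightarrow> sqrt 0 * sqrt (ip y y)"
    by (rule tendsto_mult_right[OF tendsto_real_sqrt[OF assms(4)]])
  moreover have "norm (ip (\<lambda>\<omega>. x \<omega> - X k \<omega>) y)
      \<le> sqrt (ip (\<lambda>\<omega>. x \<omega> - X k \<omega>) (\<lambda>\<omega>. x \<omega> - X k \<omega>)) * sqrt (ip y y)" for k
    unfolding real_norm_def by (intro Cauchy_Schwarz_ip_sqrt L2_diff assms)
  ultimately have "(\<lambda>k. ip (\<lambda>\<omega>. x \<omega> - X k \<omega>) y) \<longlonglongrightarrow> 0"
    by (metis (no_types, lifting) Lim_null_comparison always_eventually mult_zero_left real_sqrt_zero)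
  then have "(\<lambda>k. ip x y - ip (\<lambda>\<omega>. x \<omega> - X k \<omega>) y) \<longlonglongrightarrow> ip x y - 0"
    by (rule tendsto_diff[OF tendsto_const])
  then show ?thesis using assms by (simp add: ip_simps)
qed

lemma tendsto_ip_self:
  assumes "L2 x" "\<And>k. L2 (X k)"
    and lim: "(\<lambda>k. ip (\<lambda>\<omega>. x \<omega> - X k \<omega>) (\<lambda>\<omega>. x \<omega> - X k \<omega>)) \<longlonglongrightarrow> 0"
  shows "(\<lambda>k. ip (X k) (X k)) \<longlonglongrightarrow> ip x x"
proof -
  have "(\<lambda>k. ip (\<lambda>\<omega>. x \<omega> - X k \<omega>) (\<lambda>\<omega>. x \<omega> - X k \<omega>) - ip x x + 2 * ip (X k) x) \<longlonglongrightarrow> 0 - ip x x + 2 * ip x x"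
    by (rule tendsto_add[OF tendsto_diff[OF lim tendsto_const]
          tendsto_mult_left[OF tendsto_ip_left[OF assms(1,2,1) lim]]])
  then show ?thesis using assms by (simp add: ip_simps L2_intros ip_commute[of x "X _"])
qed

lemma L2_truncation:
  assumes "L2 x"
  shows "(\<lambda>n. ip (\<lambda>\<omega>. x \<omega> - (if \<bar>x \<omega>\<bar> \<le> real n then x \<omega> else 0))
      (\<lambda>\<omega>. x \<omega> - (if \<bar>x \<omega>\<bar> \<le> real n then x \<omega> else 0))) \<longlonglongrightarrow> 0"
proof -
  have [measurable]: "x \<in> borel_measurable M" using assms by (simp add: L2_def)
  have "(\<lambda>n. \<integral>\<omega>. (x \<omega> - (if \<bar>x \<omega>\<bar> \<le> real n then x \<omega> else 0))\<^sup>2 \<partial>M) \<longlonglongrightarrow> (\<integral>\<omega>. 0 \<partial>M)"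
  proof (rule integral_dominated_convergence[where w="\<lambda>\<omega>. (x \<omega>)\<^sup>2"])
    show "AE \<omega> in M. (\<lambda>n. (x \<omega> - (if \<bar>x \<omega>\<bar> \<le> real n then x \<omega> else 0))\<^sup>2) \<longlonglongrightarrow> 0"
    proof (intro AE_I2 tendsto_eventually)
      fix \<omega>
      obtain n0 :: nat where "\<bar>x \<omega>\<bar> \<le> real n0" using real_arch_simple by blast
      then show "\<forall>\<^sub>F n in sequentially. (x \<omega> - (if \<bar>x \<omega>\<bar> \<le> real n then x \<omega> else 0))\<^sup>2 = 0"
        unfolding eventually_sequentially by (intro exI[of _ n0]) auto
    qed
  qed (use assms in \<open>auto simp: L2_def\<close>)
  then show ?thesis by (simp add: ip_self)
qed

end

section \<open>The threshold function\<close>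

text \<open>Rounding \<open>p\<close> down to the grid of mesh \<open>1 / Suc n\<close> leaves
  countably many values, for which measurability in \<omega> alone suffices; continuity in the
  second argument passes to the limit.\<close>

lemma borel_measurable_Caratheodory:
  fixes h :: "'a \<Rightarrow> real \<Rightarrow> real"
  assumes h: "\<And>t. (\<lambda>\<omega>. h \<omega> t) \<in> borel_measurable N"
    and cont: "\<And>\<omega> t. \<omega> \<in> space N \<Longrightarrow> isCont (h \<omega>) t"
    and p [measurable]: "p \<in> borel_measurable N"
  shows "(\<lambda>\<omega>. h \<omega> (p \<omega>)) \<in> borel_measurable N"
proof (rule borel_measurable_LIMSEQ_real)
  fix n :: nat
  have [measurable]: "(\<lambda>\<omega>. \<lfloor>real (Suc n) * p \<omega>\<rfloor>) \<in> measurable N (count_space UNIV)" by measurable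
  show "(\<lambda>\<omega>. h \<omega> (real_of_int \<lfloor>real (Suc n) * p \<omega>\<rfloor> / real (Suc n))) \<in> borel_measurable N"
    by (rule measurable_compose_countable[where f="\<lambda>i \<omega>. h \<omega> (real_of_int i / real (Suc n))"])
      (use h in auto)
next
  fix \<omega> assume "\<omega> \<in> space N"
  have "(\<lambda>n. real_of_int \<lfloor>real (Suc n) * p \<omega>\<rfloor> / real (Suc n)) \<longlonglongrightarrow> p \<omega>"
  proof (rule LIMSEQ_I)
    fix e :: real assume "e > 0"
    then obtain n0 where n0: "inverse (real (Suc n0)) < e" using reals_Archimedean by blast
    have "norm (real_of_int \<lfloor>real (Suc n) * p \<omega>\<rfloor> / real (Suc n) - p \<omega>) < e" if "n \<ge> n0" for n
    proof -
      let ?m = "real (Suc n)"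
      have m: "?m > 0" by simp
      have "\<bar>real_of_int \<lfloor>?m * p \<omega>\<rfloor> - ?m * p \<omega>\<bar> \<le> 1" by linarith
      then have "\<bar>real_of_int \<lfloor>?m * p \<omega>\<rfloor> - ?m * p \<omega>\<bar> / ?m \<le> 1 / ?m"
        using m by (intro divide_right_mono) auto
      moreover have "(real_of_int \<lfloor>?m * p \<omega>\<rfloor> - ?m * p \<omega>) / ?m = real_of_int \<lfloor>?m * p \<omega>\<rfloor> / ?m - p \<omega>"
        using m by (simp add: diff_divide_distrib del: of_nat_Suc)
      then have "\<bar>real_of_int \<lfloor>?m * p \<omega>\<rfloor> - ?m * p \<omega>\<bar> / ?m = \<bar>real_of_int \<lfloor>?m * p \<omega>\<rfloor> / ?m - p \<omega>\<bar>"
        using m by (metis abs_divide abs_of_pos)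
      moreover have "1 / ?m \<le> inverse (real (Suc n0))" using that by (simp add: divide_simps)
      ultimately show ?thesis using n0 unfolding real_norm_def by linarith
    qed
    then show "\<exists>n0. \<forall>n\<ge>n0. norm (real_of_int \<lfloor>real (Suc n) * p \<omega>\<rfloor> / real (Suc n) - p \<omega>) < e" by blast
  qed
  then show "(\<lambda>n. h \<omega> (real_of_int \<lfloor>real (Suc n) * p \<omega>\<rfloor> / real (Suc n))) \<longlonglongrightarrow> h \<omega> (p \<omega>)"
    using cont[OF \<open>\<omega> \<in> space N\<close>] by (rule isCont_tendsto_compose[rotated])
qed

text \<open>\<open>F\<close> plays the role of the sigma-algebra generated by \<open>(U, Y)\<close>, and \<open>f \<omega>\<close> that of \<open>\<ell>\<^sub>Y\<close>.\<close>

locale convex_losses = prob_space M for M :: "'a measure" +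
  fixes F :: "'a measure" and f f' :: "'a \<Rightarrow> real \<Rightarrow> real"
  assumes subalg: "subalgebra M F"
    and f_meas: "\<And>t. (\<lambda>\<omega>. f \<omega> t) \<in> borel_measurable F"
    and f_C1: "\<And>\<omega>. \<omega> \<in> space M \<Longrightarrow> C1_strictly_convex (f \<omega>) (f' \<omega>)"
begin

lemma space_F: "space F = space M"
  using subalg by (simp add: subalgebra_def)

lemma sets_F: "A \<in> sets F \<Longrightarrow> A \<in> sets M"
  using subalg by (auto simp: subalgebra_def)

lemma measurable_F [measurable_dest]: "x \<in> borel_measurable F \<Longrightarrow> x \<in> borel_measurable M"
  using measurable_from_subalg[OF subalg] by blast

lemma f'_meas: "(\<lambda>\<omega>. f' \<omega> t) \<in> borel_measurable F"
proof (rule borel_measurable_LIMSEQ_real)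
  fix \<omega> assume "\<omega> \<in> space F"
  then interpret C1_strictly_convex "f \<omega>" "f' \<omega>" using f_C1 by (simp add: space_F)
  have "((\<lambda>h. (f \<omega> (t + h) - f \<omega> t) / h) \<longlongrightarrow> f' \<omega> t) (at 0)"
    using deriv[of t] by (simp add: DERIV_def)
  moreover have "filterlim (\<lambda>n. inverse (real (Suc n))) (at 0) sequentially"
    by (rule filterlim_atI[OF LIMSEQ_inverse_real_of_nat]) auto
  ultimately show "(\<lambda>n. (f \<omega> (t + inverse (real (Suc n))) - f \<omega> t) / inverse (real (Suc n))) \<longlonglongrightarrow> f' \<omega> t"
    by (rule filterlim_compose)
qed (use f_meas in measurable)

lemma f_compose_measurable [measurable]:
  "p \<in> borel_measurable M \<Longrightarrow> (\<lambda>\<omega>. f \<omega> (p \<omega>)) \<in> borel_measurable M"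
  by (rule borel_measurable_Caratheodory)
    (auto intro: measurable_F f_meas C1_strictly_convex.isCont_f f_C1)

lemma f'_compose_measurable [measurable]:
  "p \<in> borel_measurable M \<Longrightarrow> (\<lambda>\<omega>. f' \<omega> (p \<omega>)) \<in> borel_measurable M"
  by (rule borel_measurable_Caratheodory)
    (auto intro: measurable_F f'_meas C1_strictly_convex.isCont_f' f_C1)

lemma f'_compose_measurable_F:
  "p \<in> borel_measurable F \<Longrightarrow> (\<lambda>\<omega>. f' \<omega> (p \<omega>)) \<in> borel_measurable F"
  by (rule borel_measurable_Caratheodory)
    (auto intro: f'_meas C1_strictly_convex.isCont_f' f_C1 simp: space_F)

lemma prox_measurable [measurable]:
  assumes "\<gamma> > 0" and [measurable]: "x \<in> borel_measurable M"
  shows "(\<lambda>\<omega>. prox \<gamma> (f \<omega>) (x \<omega>)) \<in> borel_measurable M"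
  unfolding borel_measurable_iff_le
proof
  fix s
  have "{\<omega> \<in> space M. prox \<gamma> (f \<omega>) (x \<omega>) \<le> s} = {\<omega> \<in> space M. x \<omega> \<le> s + \<gamma> * f' \<omega> s}"
    using C1_strictly_convex.prox_le_iff[OF f_C1 \<open>\<gamma> > 0\<close>] by auto
  also have "\<dots> \<in> sets M" by measurable
  finally show "{\<omega> \<in> space M. prox \<gamma> (f \<omega>) (x \<omega>) \<le> s} \<in> sets M" .
qed

section \<open>Types of losses and the projection onto their recession cones\<close>

definition Inc :: "'a set" where
  "Inc = {\<omega> \<in> space M. \<forall>u. f' \<omega> u > 0}"

definition Dec :: "'a set" where
  "Dec = {\<omega> \<in> space M. \<forall>u. f' \<omega> u < 0}"

lemma Inc_Dec_disjoint: "\<omega> \<in> Inc \<Longrightarrow> \<omega> \<notin> Dec"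
  by (auto simp: Inc_def Dec_def) (metis less_asym)

text \<open>Since \<open>f'\<close> is increasing, positivity at a rational point below
  \<open>u\<close> implies positivity at \<open>u\<close>, which leaves a countable
  intersection.\<close>

lemma Inc_F: "Inc \<in> sets F"
proof -
  have "Inc = {\<omega> \<in> space F. \<forall>q::rat. f' \<omega> (of_rat q) > 0}"
  proof -
    have "f' \<omega> u > 0" if "\<omega> \<in> space M" "\<forall>q::rat. f' \<omega> (of_rat q) > 0" for \<omega> u
    proof -
      interpret C1_strictly_convex "f \<omega>" "f' \<omega>" using f_C1 that by simp
      obtain q where "of_rat q < u" using of_rat_dense[of "u - 1" u] by auto
      then show ?thesis using that f'_less_iff less_trans by blast
    qed
    then show ?thesis by (auto simp: Inc_def space_F)
  qed
  moreover have "{\<omega> \<in> space F. \<forall>q::rat. f' \<omega> (of_rat q) > 0} \<in> sets F"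
    using f'_meas by measurable
  ultimately show ?thesis by simp
qed

lemma Dec_F: "Dec \<in> sets F"
proof -
  have "Dec = {\<omega> \<in> space F. \<forall>q::rat. f' \<omega> (of_rat q) < 0}"
  proof -
    have "f' \<omega> u < 0" if "\<omega> \<in> space M" "\<forall>q::rat. f' \<omega> (of_rat q) < 0" for \<omega> u
    proof -
      interpret C1_strictly_convex "f \<omega>" "f' \<omega>" using f_C1 that by simp
      obtain q where "u < of_rat q" using of_rat_dense[of u "u + 1"] by auto
      then show ?thesis using that f'_less_iff less_trans by blast
    qed
    then show ?thesis by (auto simp: Dec_def space_F)
  qed
  moreover have "{\<omega> \<in> space F. \<forall>q::rat. f' \<omega> (of_rat q) < 0} \<in> sets F"
    using f'_meas by measurable
  ultimately show ?thesis by simp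
qed

text \<open>
  \<open>excess \<omega> x\<close> is the difference between \<open>x\<close> and its projection onto the recession cone of \<open>f \<omega>\<close>.
\<close>

definition excess :: "'a \<Rightarrow> real \<Rightarrow> real" where
  "excess \<omega> x = (if \<omega> \<in> Inc then max x 0 else if \<omega> \<in> Dec then min x 0 else x)"

lemma excess_measurable [measurable]:
  assumes [measurable]: "x \<in> borel_measurable M"
  shows "(\<lambda>\<omega>. excess \<omega> (x \<omega>)) \<in> borel_measurable M"
proof -
  have [measurable]: "Inc \<in> sets M" "Dec \<in> sets M" using Inc_F Dec_F sets_F by auto
  show ?thesis unfolding excess_def by measurable
qed

lemma abs_excess_le: "\<bar>excess \<omega> x\<bar> \<le> \<bar>x\<bar>"
  by (auto simp: excess_def)

lemma excess_lipschitz: "\<bar>excess \<omega> x - excess \<omega> y\<bar> \<le> \<bar>x - y\<bar>"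
  by (auto simp: excess_def)

lemma excess_cmult: "c \<ge> 0 \<Longrightarrow> excess \<omega> (c * x) = c * excess \<omega> x"
  by (auto simp: excess_def max_def min_def mult_le_0_iff zero_le_mult_iff)

text \<open>An excess lies in the polar of the recession cone, so the recession part of
  \<open>y\<close> can only lower the product and just \<open>excess \<omega> y\<close>
  counts.\<close>

lemma excess_mult_le: "excess \<omega> x * y \<le> \<bar>excess \<omega> x\<bar> * \<bar>excess \<omega> y\<bar>"
proof -
  have "x * y \<le> \<bar>x\<bar> * \<bar>y\<bar>" by (simp flip: abs_mult)
  then show ?thesis
    by (auto simp: excess_def max_def min_def abs_if zero_le_mult_iff mult_le_0_iff
        split: if_splits)
qed

lemma excess_mult_self: "excess \<omega> x * x = (excess \<omega> x)\<^sup>2"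
  by (auto simp: excess_def max_def min_def power2_eq_square)

text \<open>\<open>x - excess \<omega> x\<close> is a point of the recession cone, and the excess of
  \<open>y\<close> measures the distance of \<open>y\<close> to that cone.\<close>

lemma abs_excess_le_dist: "\<bar>excess \<omega> y\<bar> \<le> \<bar>y - (x - excess \<omega> x)\<bar>"
  by (auto simp: excess_def max_def min_def)

text \<open>The residual is the projection onto the recession cone, hence a direction along which
  the loss does not increase; this is the infinitesimal form.\<close>

lemma f'_residual_nonpos:
  assumes "\<omega> \<in> space M"
  shows "f' \<omega> u * (x - excess \<omega> x) \<le> 0"
  by (auto simp: excess_def Inc_def Dec_def max_def min_def mult_le_0_iff intro: less_imp_le)

text \<open>On \<open>Inc\<close> and \<open>Dec\<close> the derivative never vanishes, so there the
  residual must; elsewhere it is zero by definition. This characterises equality in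
  \<open>f'_residual_nonpos\<close>.\<close>

lemma f'_residual_eq_0:
  assumes "\<omega> \<in> space M" "f' \<omega> u * (x - excess \<omega> x) = 0"
  shows "excess \<omega> x = x"
proof (cases "\<omega> \<in> Inc \<or> \<omega> \<in> Dec")
  case True
  then have "f' \<omega> u \<noteq> 0" by (auto simp: Inc_def Dec_def) (metis less_irrefl)+
  then show ?thesis using assms(2) by simp
qed (simp add: excess_def)

lemma L2_excess: "L2 x \<Longrightarrow> L2 (\<lambda>\<omega>. excess \<omega> (x \<omega>))"
  by (rule L2_bound[of x]) (auto simp: abs_excess_le L2_def)

end

text \<open>Normality enters through the moments and through both tails of \<open>G\<close> having
  positive mass beyond every level. The last two assumptions are the inequalities of (N): their
  integrands are the squared excesses of \<open>U\<close> and \<open>- U\<close>.\<close>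

locale gaussian_losses = convex_losses M F f f' for M :: "'a measure" and F f f' +
  fixes U G :: "'a \<Rightarrow> real"
  assumes U_F: "U \<in> borel_measurable F" and L2_U: "L2 U" and ip_U_U: "ip U U = 1"
    and L2_G: "L2 G" and ip_G_G: "ip G G = 1" and expectation_G: "expectation G = 0"
    and G_above: "\<And>r. prob {\<omega> \<in> space M. G \<omega> > r} > 0"
    and G_below: "\<And>r. prob {\<omega> \<in> space M. G \<omega> < r} > 0"
    and indep: "indep_set (sets (vimage_algebra (space M) G borel)) (sets F)"
    and not_coercive: "\<not> (AE \<omega> in M. \<omega> \<notin> Inc \<and> \<omega> \<notin> Dec)"
    and excess_U_pos: "expectation (\<lambda>\<omega>. (excess \<omega> (U \<omega>))\<^sup>2) > 0"
    and excess_U_neg: "expectation (\<lambda>\<omega>. (excess \<omega> (- U \<omega>))\<^sup>2) > 0"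
begin

lemma U_M [measurable]: "U \<in> borel_measurable M" using L2_U by (simp add: L2_def)
lemma G_M [measurable]: "G \<in> borel_measurable M" using L2_G by (simp add: L2_def)

lemma indep_prob:
  assumes "B \<in> sets borel" "A \<in> sets F"
  shows "prob (G -` B \<inter> space M \<inter> A) = prob (G -` B \<inter> space M) * prob A"
  using indep assms by (intro indep_setD[OF indep]) (auto simp: sets_vimage_algebra2)

text \<open>The \<sigma>-algebras generated by the two variables are contained in the independent
  ones. With both variables real-valued, the product rule for expectations becomes
  available.\<close>

lemma indep_var_G:
  fixes g h :: "_ \<Rightarrow> real"
  assumes g: "g \<in> borel_measurable borel" and h: "h \<in> borel_measurable F"
  shows "indep_var borel (\<lambda>\<omega>. g (G \<omega>)) borel h"
proof -
  have hM: "h \<in> borel_measurable M" using h by (rule measurable_F)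
  have gM: "(\<lambda>\<omega>. g (G \<omega>)) \<in> borel_measurable M" using g by measurable
  have "indep_set (sigma_sets (space M) {(\<lambda>\<omega>. g (G \<omega>)) -` A \<inter> space M |A. A \<in> sets borel})
      (sigma_sets (space M) {h -` A \<inter> space M |A. A \<in> sets borel})"
  proof (rule indep_setI)
    have 1: "sigma_sets (space M) {(\<lambda>\<omega>. g (G \<omega>)) -` A \<inter> space M |A. A \<in> sets borel}
        \<subseteq> sets (vimage_algebra (space M) G borel)"
    proof (rule sets.sigma_sets_subset[where M="vimage_algebra (space M) G borel", simplified], safe)
      fix A :: "real set" assume "A \<in> sets borel"
      then have "(g -` A) \<in> sets borel" using g by (metis measurable_sets_borel)
      moreover have "(\<lambda>\<omega>. g (G \<omega>)) -` A \<inter> space M = G -` (g -` A) \<inter> space M" by auto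
      ultimately show "(\<lambda>\<omega>. g (G \<omega>)) -` A \<inter> space M \<in> sets (vimage_algebra (space M) G borel)"
        by (auto simp: sets_vimage_algebra2)
    qed
    have 2: "sigma_sets (space M) {h -` A \<inter> space M |A. A \<in> sets borel} \<subseteq> sets F"
      using h by (intro sets.sigma_sets_subset[where M=F, simplified space_F]) (auto simp: measurable_def space_F)
    show "prob (a \<inter> b) = prob a * prob b"
      if "a \<in> sigma_sets (space M) {(\<lambda>\<omega>. g (G \<omega>)) -` A \<inter> space M |A. A \<in> sets borel}"
        "b \<in> sigma_sets (space M) {h -` A \<inter> space M |A. A \<in> sets borel}" for a b
      using indep_setD[OF indep] that 1 2 by blast
    show "sigma_sets (space M) {(\<lambda>\<omega>. g (G \<omega>)) -` A \<inter> space M |A. A \<in> sets borel} \<subseteq> events"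
      using 1 indep_setD_ev1[OF indep] by blast
    show "sigma_sets (space M) {h -` A \<inter> space M |A. A \<in> sets borel} \<subseteq> events"
      using 2 indep_setD_ev2[OF indep] by blast
  qed
  then show ?thesis unfolding indep_var_eq using hM gM by blast
qed

lemma expectation_indep:
  fixes g h :: "_ \<Rightarrow> real"
  assumes "g \<in> borel_measurable borel" "h \<in> borel_measurable F"
    and "integrable M (\<lambda>\<omega>. g (G \<omega>))" "integrable M h"
  shows "expectation (\<lambda>\<omega>. g (G \<omega>) * h \<omega>) = expectation (\<lambda>\<omega>. g (G \<omega>)) * expectation h"
  by (rule indep_var_lebesgue_integral[OF indep_var_G[OF assms(1,2)] assms(3,4)])

lemma ip_G_U: "ip G U = 0"
  using expectation_indep[of "\<lambda>x. x" U] L2_integrable[OF L2_G] L2_integrable[OF L2_U] U_F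
  by (simp add: ip_def expectation_G)

lemma ip_U_G: "ip U G = 0" using ip_G_U by (simp add: ip_commute)

text \<open>The component of \<open>G + U * t\<close> normal to the recession cone;
  \<open>phi_eq\<close> identifies its squared norm with \<open>phi\<close>.\<close>

definition Z :: "real \<Rightarrow> 'a \<Rightarrow> real" where
  "Z t \<omega> = excess \<omega> (G \<omega> + U \<omega> * t)"

lemma L2_GU: "L2 (\<lambda>\<omega>. G \<omega> + U \<omega> * t)"
  using L2_add[OF L2_G L2_cmult[OF L2_U, of t]] by (simp add: mult.commute)

lemma L2_Z: "L2 (Z t)"
  unfolding Z_def[abs_def] by (rule L2_excess[OF L2_GU])

lemma Z_M [measurable]: "Z t \<in> borel_measurable M" using L2_Z by (simp add: L2_def)

text \<open>On \<open>Inc\<close> the excess of a negative number is zero, and \<open>G\<close>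
  falls below \<open>- \<bar>U * t\<bar>\<close> with positive probability independently of the type
  of the loss; symmetrically on \<open>Dec\<close>. Restricting to
  \<open>\<bar>U * t\<bar> \<le> n\<close> turns the random level into a fixed one, to which
  independence applies. The outcome supplies strictness in \<open>ip_Z_gt\<close>.\<close>

lemma residual_not_0: "\<not> (AE \<omega> in M. Z t \<omega> = G \<omega> + U \<omega> * t)"
proof
  assume AE: "AE \<omega> in M. Z t \<omega> = G \<omega> + U \<omega> * t"
  have *: "prob A = 0"
    if A: "A \<in> sets F" and B: "B \<in> sets borel" and P: "prob (G -` B \<inter> space M) > 0"
      and AB: "AE \<omega> in M. \<omega> \<in> A \<longrightarrow> G \<omega> \<notin> B" for A :: "'a set" and B :: "real set"
  proof -
    have "AE \<omega> in M. \<omega> \<notin> G -` B \<inter> space M \<inter> A" using AB by eventually_elim auto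
    then have "prob (G -` B \<inter> space M \<inter> A) = 0"
      using sets_F[OF A] B by (subst prob_eq_0) auto
    then show ?thesis using indep_prob[OF B A] P by simp
  qed
  have UF: "{\<omega> \<in> space M. \<bar>U \<omega> * t\<bar> \<le> real n} \<in> sets F" for n
    using U_F by (simp flip: space_F)
  have Inc0: "prob (Inc \<inter> {\<omega> \<in> space M. \<bar>U \<omega> * t\<bar> \<le> real n}) = 0" for n
  proof (rule *[of _ "{..< - real n}"])
    show "AE \<omega> in M. \<omega> \<in> Inc \<inter> {\<omega> \<in> space M. \<bar>U \<omega> * t\<bar> \<le> real n} \<longrightarrow> G \<omega> \<notin> {..<- real n}"
      using AE by eventually_elim (auto simp: Z_def excess_def max_def split: if_splits)
    have "G -` {..<- real n} \<inter> space M = {\<omega> \<in> space M. G \<omega> < - real n}" by auto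
    then show "prob (G -` {..<- real n} \<inter> space M) > 0" using G_below by simp
  qed (use Inc_F UF in auto)
  have Dec0: "prob (Dec \<inter> {\<omega> \<in> space M. \<bar>U \<omega> * t\<bar> \<le> real n}) = 0" for n
  proof (rule *[of _ "{real n<..}"])
    show "AE \<omega> in M. \<omega> \<in> Dec \<inter> {\<omega> \<in> space M. \<bar>U \<omega> * t\<bar> \<le> real n} \<longrightarrow> G \<omega> \<notin> {real n<..}"
      using AE
      by eventually_elim (auto simp: Z_def excess_def min_def dest: Inc_Dec_disjoint split: if_splits)
    have "G -` {real n<..} \<inter> space M = {\<omega> \<in> space M. G \<omega> > real n}" by auto
    then show "prob (G -` {real n<..} \<inter> space M) > 0" using G_above by simp
  qed (use Dec_F UF in auto)
  have "AE \<omega> in M. \<forall>n. \<omega> \<notin> Inc \<inter> {\<omega> \<in> space M. \<bar>U \<omega> * t\<bar> \<le> real n} \<and> \<omega> \<notin> Dec \<inter> {\<omega> \<in> space M. \<bar>U \<omega> * t\<bar> \<le> real n}"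
    unfolding AE_all_countable
  proof
    fix n
    have "AE \<omega> in M. \<omega> \<notin> Inc \<inter> {\<omega> \<in> space M. \<bar>U \<omega> * t\<bar> \<le> real n}"
      using Inc0[of n] prob_eq_0[OF sets_F[OF sets.Int[OF Inc_F UF]]] by blast
    moreover have "AE \<omega> in M. \<omega> \<notin> Dec \<inter> {\<omega> \<in> space M. \<bar>U \<omega> * t\<bar> \<le> real n}"
      using Dec0[of n] prob_eq_0[OF sets_F[OF sets.Int[OF Dec_F UF]]] by blast
    ultimately show "AE \<omega> in M. \<omega> \<notin> Inc \<inter> {\<omega> \<in> space M. \<bar>U \<omega> * t\<bar> \<le> real n}
        \<and> \<omega> \<notin> Dec \<inter> {\<omega> \<in> space M. \<bar>U \<omega> * t\<bar> \<le> real n}" by eventually_elim auto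
  qed
  then have "AE \<omega> in M. \<omega> \<notin> Inc \<and> \<omega> \<notin> Dec"
    using AE_space
  proof eventually_elim
    case (elim \<omega>)
    obtain n where "\<bar>U \<omega> * t\<bar> \<le> real n" using real_arch_simple by blast
    then show ?case using elim by blast
  qed
  then show False using not_coercive by blast
qed

lemma sqrt_ip_Z_lipschitz: "\<bar>sqrt (ip (Z t) (Z t)) - sqrt (ip (Z s) (Z s))\<bar> \<le> \<bar>t - s\<bar>"
proof -
  have 1: "sqrt (ip (Z t) (Z t)) \<le> sqrt (ip (Z s) (Z s)) + \<bar>t - s\<bar>" for s t
  proof -
    let ?D = "\<lambda>\<omega>. Z t \<omega> - Z s \<omega>"
    have "sqrt (ip (\<lambda>\<omega>. Z s \<omega> + ?D \<omega>) (\<lambda>\<omega>. Z s \<omega> + ?D \<omega>)) \<le> sqrt (ip (Z s) (Z s)) + sqrt (ip ?D ?D)"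
      by (intro ip_triangle L2_Z L2_diff)
    moreover have "ip ?D ?D \<le> ip (\<lambda>\<omega>. (t - s) * U \<omega>) (\<lambda>\<omega>. (t - s) * U \<omega>)"
    proof (intro ip_mono AE_I2)
      fix \<omega>
      show "\<bar>?D \<omega>\<bar> \<le> \<bar>(t - s) * U \<omega>\<bar>"
        using excess_lipschitz[of \<omega> "G \<omega> + U \<omega> * t" "G \<omega> + U \<omega> * s"]
        by (simp add: Z_def algebra_simps)
    qed (intro L2_Z L2_diff L2_cmult L2_U)+
    moreover have "ip (\<lambda>\<omega>. (t - s) * U \<omega>) (\<lambda>\<omega>. (t - s) * U \<omega>) = (t - s)\<^sup>2"
      by (simp add: ip_cmult_left ip_cmult_right ip_U_U power2_eq_square)
    ultimately show ?thesis
      by (simp add: real_sqrt_le_iff[symmetric, of "ip ?D ?D"] del: real_sqrt_le_iff)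
  qed
  show ?thesis using 1[of t s] 1[of s t] by linarith
qed

text \<open>By positive homogeneity of the excess only the sign of \<open>a\<close> matters, and (N)
  covers both signs. The L1 norm is used because that is what the risk controls.\<close>

lemma excess_U_scale:
  obtains k where "k > 0" "\<And>a. k * \<bar>a\<bar> \<le> expectation (\<lambda>\<omega>. \<bar>excess \<omega> (U \<omega> * a)\<bar>)"
proof -
  let ?P = "\<lambda>\<omega>. excess \<omega> (U \<omega>)" and ?N = "\<lambda>\<omega>. excess \<omega> (- U \<omega>)"
  have L: "L2 ?P" "L2 ?N" by (intro L2_excess L2_uminus L2_U)+
  have pos: "expectation (\<lambda>\<omega>. \<bar>x \<omega>\<bar>) > 0" if "L2 x" "expectation (\<lambda>\<omega>. (x \<omega>)\<^sup>2) > 0" for x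
  proof (rule ccontr)
    assume "\<not> expectation (\<lambda>\<omega>. \<bar>x \<omega>\<bar>) > 0"
    moreover have "expectation (\<lambda>\<omega>. \<bar>x \<omega>\<bar>) \<ge> 0" by simp
    ultimately have "expectation (\<lambda>\<omega>. \<bar>x \<omega>\<bar>) = 0" by linarith
    then have "AE \<omega> in M. x \<omega> = 0"
      using L2_integrable[OF that(1)] by (subst (asm) integral_nonneg_eq_0_iff_AE) auto
    then have "ip x x = 0" using ip_self_eq_0_iff[OF that(1)] by simp
    then show False using that(2) by (simp add: ip_self)
  qed
  define k where "k = min (expectation (\<lambda>\<omega>. \<bar>?P \<omega>\<bar>)) (expectation (\<lambda>\<omega>. \<bar>?N \<omega>\<bar>))"
  show ?thesis
  proof
    show "k > 0" unfolding k_def using pos[OF L(1) excess_U_pos] pos[OF L(2) excess_U_neg] by simp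
    show "k * \<bar>a\<bar> \<le> expectation (\<lambda>\<omega>. \<bar>excess \<omega> (U \<omega> * a)\<bar>)" for a
    proof (cases "a \<ge> 0")
      case True
      then have "excess \<omega> (U \<omega> * a) = a * excess \<omega> (U \<omega>)" for \<omega>
        using excess_cmult[of a \<omega> "U \<omega>"] by (simp add: mult.commute)
      then show ?thesis using True by (simp add: abs_mult k_def mult.commute mult_left_mono)
    next
      case False
      then have "excess \<omega> (U \<omega> * a) = - a * excess \<omega> (- U \<omega>)" for \<omega>
        using excess_cmult[of "- a" \<omega> "- U \<omega>"] by (simp add: mult.commute)
      then show ?thesis using False by (simp add: abs_mult k_def mult.commute mult_left_mono)
    qed
  qed
qed

text \<open>Lipschitz continuity in \<open>t\<close> and linear growth from
  \<open>excess_U_scale\<close>. Attainment replaces the infimum of \<open>phi\<close> by a value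
  and makes a first-order condition in \<open>t\<close> available.\<close>

lemma ip_Z_attains_min: "\<exists>t. \<forall>s. ip (Z t) (Z t) \<le> ip (Z s) (Z s)"
proof -
  let ?n = "\<lambda>t. sqrt (ip (Z t) (Z t))"
  obtain k where k: "k > 0" "\<And>a. k * \<bar>a\<bar> \<le> expectation (\<lambda>\<omega>. \<bar>excess \<omega> (U \<omega> * a)\<bar>)"
    using excess_U_scale by blast
  have low: "k * \<bar>t\<bar> \<le> ?n t + 1" for t
  proof -
    have LU: "L2 (\<lambda>\<omega>. excess \<omega> (U \<omega> * t))"
      using L2_excess[OF L2_cmult[OF L2_U, of t]] by (simp add: mult.commute)
    have "k * \<bar>t\<bar> \<le> expectation (\<lambda>\<omega>. \<bar>excess \<omega> (U \<omega> * t)\<bar>)" by (rule k)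
    also have "\<dots> \<le> expectation (\<lambda>\<omega>. \<bar>Z t \<omega>\<bar> + \<bar>G \<omega>\<bar>)"
    proof (rule integral_mono)
      show "\<bar>excess \<omega> (U \<omega> * t)\<bar> \<le> \<bar>Z t \<omega>\<bar> + \<bar>G \<omega>\<bar>" for \<omega>
        using excess_lipschitz[of \<omega> "U \<omega> * t" "G \<omega> + U \<omega> * t"] by (simp add: Z_def)
    qed (use L2_integrable[OF L2_Z] L2_integrable[OF L2_G] L2_integrable[OF LU] in auto)
    also have "\<dots> = expectation (\<lambda>\<omega>. \<bar>Z t \<omega>\<bar>) + expectation (\<lambda>\<omega>. \<bar>G \<omega>\<bar>)"
      using L2_integrable[OF L2_Z] L2_integrable[OF L2_G] by simp
    also have "\<dots> \<le> ?n t + 1"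
      using expectation_abs_le[OF L2_Z] expectation_abs_le[OF L2_G] ip_G_G by (intro add_mono) auto
    finally show ?thesis .
  qed
  have cont: "continuous_on A ?n" for A
    by (rule lipschitz_on_continuous_on[of 1])
      (auto intro!: lipschitz_onI simp: dist_real_def sqrt_ip_Z_lipschitz)
  \<comment> \<open>Outside \<open>{-T..T}\<close> the lower bound \<open>low\<close> already
    exceeds the value at 0.\<close>
  define T where "T = (?n 0 + 1) / k"
  have T: "T \<ge> 0" using k by (simp add: T_def ip_self_nonneg)
  obtain t where t: "t \<in> {-T..T}" "\<And>s. s \<in> {-T..T} \<Longrightarrow> ?n t \<le> ?n s"
    using continuous_attains_inf[OF _ _ cont, of "{-T..T}"] T by auto
  have "?n t \<le> ?n s" for s
  proof (cases "\<bar>s\<bar> \<le> T")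
    case False
    then have "?n 0 + 1 < k * \<bar>s\<bar>" using k by (simp add: T_def field_simps)
    moreover have "0 \<in> {-T..T}" using T by simp
    ultimately show ?thesis using low[of s] t(2)[of 0] by linarith
  qed (use t(2) in \<open>auto simp: abs_le_iff\<close>)
  then show ?thesis by auto
qed

text \<open>
  Compare \<open>ip (Z s) (Z s)\<close> with the squared distance of \<open>G + U * s\<close> to the fixed element
  \<open>G + U * t - Z t\<close> of the recession cone.
\<close>

lemma Z_min_orthogonal:
  assumes min: "\<And>s. ip (Z t) (Z t) \<le> ip (Z s) (Z s)"
  shows "ip (Z t) U = 0" "ip (Z t) G = ip (Z t) (Z t)"
proof -
  have key: "0 \<le> 2 * h * ip (Z t) U + h\<^sup>2" for h
  proof -
    let ?W = "\<lambda>\<omega>. Z t \<omega> + h * U \<omega>"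
    have W: "L2 ?W" by (intro L2_add L2_cmult L2_Z L2_U)
    have "ip (Z (t + h)) (Z (t + h)) \<le> ip ?W ?W"
    proof (intro ip_mono L2_Z W AE_I2)
      show "\<bar>Z (t + h) \<omega>\<bar> \<le> \<bar>?W \<omega>\<bar>" for \<omega>
        using abs_excess_le_dist[of \<omega> "G \<omega> + U \<omega> * (t + h)" "G \<omega> + U \<omega> * t"]
        by (simp add: Z_def algebra_simps)
    qed
    moreover have "ip ?W ?W = ip (Z t) (Z t) + 2 * h * ip (Z t) U + h\<^sup>2"
      using L2_Z L2_U by (simp add: ip_simps L2_intros ip_commute[of U "Z t"] ip_U_U power2_eq_square
          distrib_left)
    ultimately show ?thesis using min[of "t + h"] by simp
  qed
  \<comment> \<open>The minimiser of the quadratic \<open>2 * h * ip (Z t) U + h\<^sup>2\<close>;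
    nonnegativity there leaves only a zero inner product.\<close>
  have "2 * (ip (Z t) U)\<^sup>2 \<le> (ip (Z t) U)\<^sup>2"
    using key[of "- ip (Z t) U"] by (simp add: power2_eq_square)
  then show U0: "ip (Z t) U = 0" by simp
  have "ip (Z t) (\<lambda>\<omega>. G \<omega> + t * U \<omega>) = ip (Z t) (Z t)"
    unfolding ip_def Z_def using excess_mult_self
    by (intro Bochner_Integration.integral_cong) (auto simp: power2_eq_square mult.commute)
  then show "ip (Z t) G = ip (Z t) (Z t)"
    using L2_Z L2_G L2_U by (simp add: ip_simps L2_intros U0)
qed

text \<open>Pairing \<open>d\<close> with \<open>G + U * t\<close> gives \<open>s\<close>, while its
  pairing with the residual, a direction of recession, is strictly negative; hence
  \<open>ip d (Z t)\<close> exceeds \<open>s\<close>. Cauchy-Schwarz with \<open>ip d d = s\<close>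
  turns this into a bound on the norm.\<close>

lemma ip_Z_gt:
  assumes "c > 0" "s > 0" and p [measurable]: "p \<in> borel_measurable M"
    and d: "\<And>\<omega>. \<omega> \<in> space M \<Longrightarrow> d \<omega> = c * f' \<omega> (p \<omega>)"
    and L: "L2 d" and "ip d d = s" "ip d U = 0" "ip d G = s"
  shows "s < ip (Z t) (Z t)"
proof -
  let ?w = "\<lambda>\<omega>. (G \<omega> + U \<omega> * t) - Z t \<omega>"
  have Lw: "L2 ?w" by (intro L2_diff L2_GU L2_Z)
  have nonpos: "d \<omega> * ?w \<omega> \<le> 0" if "\<omega> \<in> space M" for \<omega>
    using f'_residual_nonpos[OF that, of "p \<omega>" "G \<omega> + U \<omega> * t"] \<open>c > 0\<close>
    by (simp add: d[OF that] Z_def mult.assoc mult_le_0_iff)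
  have "ip d ?w < 0"
  proof (rule ccontr)
    assume "\<not> ip d ?w < 0"
    moreover have "expectation (\<lambda>\<omega>. - (d \<omega> * ?w \<omega>)) \<ge> 0"
      by (rule integral_nonneg_AE) (use nonpos in auto)
    ultimately have "expectation (\<lambda>\<omega>. - (d \<omega> * ?w \<omega>)) = 0" by (simp add: ip_def)
    then have "AE \<omega> in M. - (d \<omega> * ?w \<omega>) = 0"
      using nonpos L2_mult[OF L Lw] by (subst (asm) integral_nonneg_eq_0_iff_AE) auto
    then have "AE \<omega> in M. Z t \<omega> = G \<omega> + U \<omega> * t"
      using AE_space
    proof eventually_elim
      case (elim \<omega>)
      then have "f' \<omega> (p \<omega>) * (G \<omega> + U \<omega> * t - excess \<omega> (G \<omega> + U \<omega> * t)) = 0"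
        using \<open>c > 0\<close> by (auto simp: d Z_def)
      then show ?case using f'_residual_eq_0 elim unfolding Z_def by blast
    qed
    then show False using residual_not_0 by blast
  qed
  moreover have "ip d (\<lambda>\<omega>. G \<omega> + t * U \<omega>) = s"
    using L L2_G L2_U assms by (simp add: ip_simps L2_intros)
  then have "ip d ?w = s - ip d (Z t)"
    using ip_diff_right[OF L2_GU L2_Z L, of t t] by (simp add: mult.commute)
  ultimately have "s < ip d (Z t)" by simp
  then have "s\<^sup>2 < (ip d (Z t))\<^sup>2" using \<open>s > 0\<close> by (simp add: power_strict_mono)
  also have "\<dots> \<le> s * ip (Z t) (Z t)" using Cauchy_Schwarz_ip[OF L L2_Z] assms by simp
  finally show ?thesis using \<open>s > 0\<close> by (simp add: power2_eq_square)
qed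

end

section \<open>Existence of a risk minimiser on the feasible cone\<close>

text \<open>\<open>f_lower\<close> puts the growth bounds for the three types of losses into one
  inequality: the excess is \<open>u\<close>, its positive part or its negative part, up to sign.
  \<open>R\<close> is an integrable random intercept.\<close>

locale solvable_losses = gaussian_losses M F f f' U G
  for M :: "'a measure" and F f f' U G +
  fixes R :: "'a \<Rightarrow> real" and b \<delta> :: real
  assumes integrable_f_G: "integrable M (\<lambda>\<omega>. f \<omega> (G \<omega>))"
    and integrable_R: "integrable M R" and b_pos: "b > 0"
    and f_lower: "AE \<omega> in M. \<forall>u. R \<omega> + \<bar>excess \<omega> u\<bar> / b \<le> f \<omega> u"
    and \<delta>_gt_1: "\<delta> > 1"
begin

section \<open>The feasible cone, whose half-angle has squared cosine \<open>c2\<close>\<close>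

definition c2 :: real where "c2 = 1 - 1 / \<delta>"

lemma c2: "0 < c2" "c2 < 1" "1 / \<delta> = 1 - c2"
  using \<delta>_gt_1 by (auto simp: c2_def)

lemma f_ge_R: "AE \<omega> in M. \<forall>u. R \<omega> \<le> f \<omega> u"
  using f_lower
proof eventually_elim
  case (elim \<omega>)
  have "0 \<le> \<bar>excess \<omega> u\<bar> / b" for u using b_pos by simp
  then show ?case using elim by (meson add_increasing2 order_refl order_trans)
qed

text \<open>At a solution, \<open>orth p\<close> is \<open>\<sigma> * G - \<gamma> * \<ell>'\<close>.\<close>

definition orth :: "('a \<Rightarrow> real) \<Rightarrow> 'a \<Rightarrow> real" where
  "orth p \<omega> = p \<omega> - ip p U * U \<omega>"

lemma L2_orth: "L2 p \<Longrightarrow> L2 (orth p)"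
  unfolding orth_def[abs_def] by (intro L2_diff L2_cmult L2_U)

lemma ip_orth_U: "L2 p \<Longrightarrow> ip (orth p) U = 0"
  unfolding orth_def[abs_def] by (simp add: ip_simps L2_intros L2_U ip_U_U)

lemma ip_orth_G: "L2 p \<Longrightarrow> ip (orth p) G = ip p G"
  unfolding orth_def[abs_def] by (simp add: ip_simps L2_intros L2_U L2_G ip_U_G)

lemma ip_orth_left:
  assumes "L2 p" "L2 q"
  shows "ip (orth p) q = ip p q - ip p U * ip q U"
  using assms unfolding orth_def[abs_def]
  by (simp add: ip_simps L2_intros L2_U ip_commute[of U q])

lemma ip_orth_orth:
  assumes "L2 p"
  shows "ip (orth p) (orth p) = ip p p - (ip p U)\<^sup>2"
  using assms ip_orth_U[OF assms] ip_orth_left[OF assms L2_orth[OF assms]]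
    ip_orth_left[OF assms assms] ip_commute[of p "orth p"]
  by (simp add: power2_eq_square)

text \<open>With the square root, the constraint bounds a seminorm by a linear functional, so
  convexity is the triangle inequality. The polynomial form \<open>feas_iff\<close> is the one
  suited to perturbations.\<close>

definition feas :: "('a \<Rightarrow> real) \<Rightarrow> bool" where
  "feas p \<longleftrightarrow> L2 p \<and> sqrt (c2 * ip (orth p) (orth p)) \<le> ip p G"

lemma feas_L2: "feas p \<Longrightarrow> L2 p"
  by (simp add: feas_def)

lemma feas_iff: "feas p \<longleftrightarrow> L2 p \<and> 0 \<le> ip p G \<and> c2 * ip (orth p) (orth p) \<le> (ip p G)\<^sup>2"
proof -
  have "0 \<le> c2 * ip (orth p) (orth p)" using c2 by (simp add: ip_self_nonneg)
  then have "sqrt (c2 * ip (orth p) (orth p)) \<le> ip p G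
      \<longleftrightarrow> 0 \<le> ip p G \<and> c2 * ip (orth p) (orth p) \<le> (ip p G)\<^sup>2"
    by (meson order_trans real_le_lsqrt real_sqrt_ge_zero sqrt_le_D)
  then show ?thesis by (simp add: feas_def)
qed

lemma feas_G: "feas G"
  unfolding feas_iff using c2 by (simp add: L2_G ip_orth_orth ip_G_G ip_G_U)

lemma feas_midpoint:
  assumes "feas p" "feas q"
  shows "feas (\<lambda>\<omega>. (p \<omega> + q \<omega>) / 2)"
proof -
  let ?m = "\<lambda>\<omega>. (1/2) * (p \<omega> + q \<omega>)"
  note L = feas_L2[OF assms(1)] feas_L2[OF assms(2)]
  have Lm: "L2 ?m" by (intro L2_cmult L2_add L)
  have "ip ?m U = (1/2) * (ip p U + ip q U)"
    unfolding ip_cmult_left using ip_add_left[OF L L2_U] by simp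
  then have "orth ?m = (\<lambda>\<omega>. (1/2) * (orth p \<omega> + orth q \<omega>))"
    by (auto simp: orth_def fun_eq_iff algebra_simps)
  then have "ip (orth ?m) (orth ?m)
      = (1/2)\<^sup>2 * ip (\<lambda>\<omega>. orth p \<omega> + orth q \<omega>) (\<lambda>\<omega>. orth p \<omega> + orth q \<omega>)"
    by (simp only: ip_cmult_left ip_cmult_right power2_eq_square mult.assoc)
  then have "sqrt (c2 * ip (orth ?m) (orth ?m))
      = sqrt c2 * ((1/2) * sqrt (ip (\<lambda>\<omega>. orth p \<omega> + orth q \<omega>) (\<lambda>\<omega>. orth p \<omega> + orth q \<omega>)))"
    by (simp add: real_sqrt_mult real_sqrt_divide)
  also have "\<dots> \<le> sqrt c2 * ((1/2) * (sqrt (ip (orth p) (orth p)) + sqrt (ip (orth q) (orth q))))"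
    using c2 by (intro mult_left_mono ip_triangle L2_orth L) auto
  also have "\<dots> \<le> (1/2) * (ip p G + ip q G)"
    using assms by (simp add: feas_def real_sqrt_mult algebra_simps)
  also have "\<dots> = ip ?m G"
    unfolding ip_cmult_left using ip_add_left[OF L L2_G] by simp
  finally show ?thesis using Lm by (simp add: feas_def)
qed

section \<open>Admissible points and their risk\<close>

definition risk :: "('a \<Rightarrow> real) \<Rightarrow> real" where
  "risk p = expectation (\<lambda>\<omega>. f \<omega> (p \<omega>))"

text \<open>Integrability has to be demanded, since \<open>risk\<close> takes the default value 0 at
  points where the loss is not integrable.\<close>

definition adm :: "('a \<Rightarrow> real) \<Rightarrow> bool" where
  "adm p \<longleftrightarrow> feas p \<and> integrable M (\<lambda>\<omega>. f \<omega> (p \<omega>))"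

lemma adm_G: "adm G"
  using feas_G integrable_f_G by (simp add: adm_def)

lemma adm_L2: "adm p \<Longrightarrow> L2 p"
  by (simp add: adm_def feas_L2)

lemma risk_ge:
  assumes "integrable M (\<lambda>\<omega>. f \<omega> (p \<omega>))"
  shows "expectation R \<le> risk p"
  unfolding risk_def by (rule integral_mono_AE[OF integrable_R assms])
    (use f_ge_R in eventually_elim, auto)

lemma adm_midpoint:
  assumes p: "adm p" and q: "adm q"
  shows "adm (\<lambda>\<omega>. (p \<omega> + q \<omega>) / 2)" and "risk (\<lambda>\<omega>. (p \<omega> + q \<omega>) / 2) \<le> (risk p + risk q) / 2"
proof -
  have i: "integrable M (\<lambda>\<omega>. f \<omega> (p \<omega>))" "integrable M (\<lambda>\<omega>. f \<omega> (q \<omega>))"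
    using p q by (auto simp: adm_def)
  have [measurable]: "p \<in> borel_measurable M" "q \<in> borel_measurable M"
    using adm_L2[OF p] adm_L2[OF q] by (auto simp: L2_def)
  have le: "AE \<omega> in M. f \<omega> ((p \<omega> + q \<omega>) / 2) \<le> (f \<omega> (p \<omega>) + f \<omega> (q \<omega>)) / 2"
    using C1_strictly_convex.midpoint_le[OF f_C1] by (intro AE_I2) auto
  have abs_le: "\<bar>m\<bar> \<le> \<bar>r\<bar> + \<bar>x\<bar> + \<bar>y\<bar>" if "m \<le> (x + y) / 2" "r \<le> m" for m r x y :: real
    using that by (auto simp: abs_real_def field_simps)
  have int: "integrable M (\<lambda>\<omega>. f \<omega> ((p \<omega> + q \<omega>) / 2))"
  proof (rule Bochner_Integration.integrable_bound)
    show "integrable M (\<lambda>\<omega>. \<bar>R \<omega>\<bar> + \<bar>f \<omega> (p \<omega>)\<bar> + \<bar>f \<omega> (q \<omega>)\<bar>)"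
      using i integrable_R by auto
    show "AE \<omega> in M. norm (f \<omega> ((p \<omega> + q \<omega>) / 2)) \<le> norm (\<bar>R \<omega>\<bar> + \<bar>f \<omega> (p \<omega>)\<bar> + \<bar>f \<omega> (q \<omega>)\<bar>)"
      using le f_ge_R
    proof eventually_elim
      case (elim \<omega>)
      from elim(2) have "R \<omega> \<le> f \<omega> ((p \<omega> + q \<omega>) / 2)" by blast
      with elim(1) have "\<bar>f \<omega> ((p \<omega> + q \<omega>) / 2)\<bar> \<le> \<bar>R \<omega>\<bar> + \<bar>f \<omega> (p \<omega>)\<bar> + \<bar>f \<omega> (q \<omega>)\<bar>"
        by (rule abs_le)
      then show ?case unfolding real_norm_def by (rule order_trans[OF _ abs_ge_self])
    qed
  qed measurable
  then show "adm (\<lambda>\<omega>. (p \<omega> + q \<omega>) / 2)" using feas_midpoint p q by (auto simp: adm_def)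
  have "risk (\<lambda>\<omega>. (p \<omega> + q \<omega>) / 2) \<le> expectation (\<lambda>\<omega>. (f \<omega> (p \<omega>) + f \<omega> (q \<omega>)) / 2)"
    unfolding risk_def using i by (intro integral_mono_AE int le) auto
  then show "risk (\<lambda>\<omega>. (p \<omega> + q \<omega>) / 2) \<le> (risk p + risk q) / 2"
    using i by (simp add: risk_def)
qed

text \<open>The coercivity carried by the risk itself: an L1 bound, blind along the recession cone.
  Everything beyond it must come from the constraint.\<close>

lemma expectation_excess_le:
  assumes "adm p"
  shows "expectation (\<lambda>\<omega>. \<bar>excess \<omega> (p \<omega>)\<bar>) \<le> b * (risk p - expectation R)"
proof -
  have i: "integrable M (\<lambda>\<omega>. f \<omega> (p \<omega>))" using assms by (simp add: adm_def)
  have L: "L2 (\<lambda>\<omega>. excess \<omega> (p \<omega>))" using L2_excess adm_L2 assms by blast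
  have "expectation (\<lambda>\<omega>. \<bar>excess \<omega> (p \<omega>)\<bar>) \<le> expectation (\<lambda>\<omega>. b * (f \<omega> (p \<omega>) - R \<omega>))"
  proof (rule integral_mono_AE)
    show "AE \<omega> in M. \<bar>excess \<omega> (p \<omega>)\<bar> \<le> b * (f \<omega> (p \<omega>) - R \<omega>)"
      using f_lower
    proof eventually_elim
      case (elim \<omega>)
      then have "R \<omega> + \<bar>excess \<omega> (p \<omega>)\<bar> / b \<le> f \<omega> (p \<omega>)" by blast
      then show ?case using b_pos by (simp add: field_simps)
    qed
  qed (use i integrable_R L2_integrable[OF L] in auto)
  also have "\<dots> = b * (risk p - expectation R)"
    using i integrable_R by (simp add: risk_def)
  finally show ?thesis .
qed

text \<open>
  The feasible cone surrounds \<open>G\<close> with half-angle \<open>arccos (sqrt c2)\<close>, and the angle between \<open>Z t\<close> and \<open>G\<close>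
  has cosine \<open>sqrt (ip (Z t) (Z t)) > sqrt (1 - c2)\<close>, so the two angles add up to less than \<open>pi / 2\<close>.
\<close>

lemma ip_Z_orth_ge:
  assumes min: "\<And>s. ip (Z t) (Z t) \<le> ip (Z s) (Z s)" and gt: "1 / \<delta> < ip (Z t) (Z t)"
  obtains k where "k > 0" "\<And>p. feas p \<Longrightarrow> k * sqrt (ip (orth p) (orth p)) \<le> ip (Z t) p"
proof -
  define \<mu> where "\<mu> = ip (Z t) (Z t)"
  \<comment> \<open>The margin \<open>sqrt \<mu> * (sqrt \<mu> - sqrt (1 / \<delta>))\<close>,
    positive exactly when the threshold condition is strict.\<close>
  define k where "k = \<mu> - sqrt \<mu> * sqrt (1 / \<delta>)"
  have "sqrt (1 / \<delta>) < sqrt \<mu>" using gt by (simp add: \<mu>_def)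
  moreover have "0 < \<mu>" using gt \<delta>_gt_1 unfolding \<mu>_def by (smt (verit) divide_pos_pos)
  ultimately have "sqrt \<mu> * sqrt (1 / \<delta>) < sqrt \<mu> * sqrt \<mu>" by (intro mult_strict_left_mono) auto
  then have k: "k > 0" using \<open>0 < \<mu>\<close> by (simp add: k_def)
  note Z_orth = Z_min_orthogonal[OF min]
  show ?thesis
  proof (rule that[OF k])
    fix p assume p: "feas p"
    let ?v = "orth p"
    note L = feas_L2[OF p]
    note Lv = L2_orth[OF L]
    \<comment> \<open>The multiple of \<open>G\<close> for which the ball around
      \<open>s * G\<close> of radius \<open>s * sqrt (1 / \<delta>)\<close> is tangent to the cone:
      if \<open>orth p\<close> is on the boundary, then \<open>orth p\<close> and
      \<open>orth p - s * G\<close> are orthogonal.\<close>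
    define s where "s = ip p G / c2"
    have pG: "ip p G = c2 * s" using c2 by (simp add: s_def)
    have s0: "s \<ge> 0" using p c2 by (simp add: feas_iff s_def)
    have "c2 * ip ?v ?v \<le> c2 * (c2 * s\<^sup>2)"
      using p pG by (simp add: feas_iff power2_eq_square algebra_simps)
    then have vv: "ip ?v ?v \<le> c2 * s\<^sup>2" using c2 by simp
    also have "\<dots> \<le> s\<^sup>2" using c2 by (simp add: mult_left_le_one_le)
    finally have vs: "sqrt (ip ?v ?v) \<le> s" using s0 real_le_lsqrt ip_self_nonneg by blast
    let ?D = "\<lambda>\<omega>. ?v \<omega> - s * G \<omega>"
    have LD: "L2 ?D" by (intro L2_diff L2_cmult Lv L2_G)
    have "ip ?D ?D = ip ?v ?v - 2 * s * ip p G + s\<^sup>2"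
      using Lv L2_G L by (simp add: ip_simps L2_intros ip_orth_G ip_commute[of G ?v] ip_G_G power2_eq_square
          right_diff_distrib)
    also have "\<dots> \<le> s\<^sup>2 * (1 / \<delta>)"
      using vv unfolding c2(3) pG by (simp add: power2_eq_square algebra_simps)
    finally have "sqrt (ip ?D ?D) \<le> s * sqrt (1 / \<delta>)"
      using s0 by (metis real_sqrt_abs abs_of_nonneg real_sqrt_le_iff real_sqrt_mult)
    then have "sqrt \<mu> * sqrt (ip ?D ?D) \<le> sqrt \<mu> * (s * sqrt (1 / \<delta>))"
      using \<open>0 < \<mu>\<close> by (intro mult_left_mono) auto
    moreover have "\<bar>ip (Z t) ?D\<bar> \<le> sqrt \<mu> * sqrt (ip ?D ?D)"
      unfolding \<mu>_def by (rule Cauchy_Schwarz_ip_sqrt[OF L2_Z LD])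
    moreover have "ip (Z t) ?D = ip (Z t) p - s * \<mu>"
      using L2_Z Lv L2_G L L2_U Z_orth
      by (simp add: ip_diff_right L2_intros ip_cmult_right \<mu>_def)
        (simp add: orth_def[abs_def] ip_simps L2_intros)
    ultimately have "s * k \<le> ip (Z t) p" by (simp add: k_def algebra_simps)
    moreover have "k * sqrt (ip ?v ?v) \<le> k * s" using vs k by (intro mult_left_mono) auto
    ultimately show "k * sqrt (ip ?v ?v) \<le> ip (Z t) p" by (simp add: mult.commute)
  qed
qed

text \<open>Feasibility bounds the norm of \<open>orth p\<close> by the pairing of \<open>p\<close>
  with the single element \<open>Z t\<close>. This element is itself an excess, so a bounded
  truncation of it pairs with \<open>p\<close> at a cost governed by the L1 norm of the excess of
  \<open>p\<close>. The remainder has small L2 norm and is absorbed into the left-hand side, the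
  coefficient of \<open>U\<close> in \<open>p\<close> being controlled by
  \<open>excess_U_scale\<close>.\<close>

lemma level_set_bounded:
  assumes gt: "\<And>t. 1 / \<delta> < ip (Z t) (Z t)"
  obtains B where "\<And>p. adm p \<Longrightarrow> risk p \<le> K \<Longrightarrow> ip p p \<le> B"
proof -
  obtain t where min: "\<And>s. ip (Z t) (Z t) \<le> ip (Z s) (Z s)" using ip_Z_attains_min by blast
  obtain k where k: "k > 0" "\<And>p. feas p \<Longrightarrow> k * sqrt (ip (orth p) (orth p)) \<le> ip (Z t) p"
    using ip_Z_orth_ge[OF min gt] by blast
  obtain j where j: "j > 0" "\<And>a. j * \<bar>a\<bar> \<le> expectation (\<lambda>\<omega>. \<bar>excess \<omega> (U \<omega> * a)\<bar>)"
    using excess_U_scale by blast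
  define K1 where "K1 = b * (K - expectation R)"
  \<comment> \<open>Chosen so that the remainder contributes \<open>k / 2\<close> times the norm of
    \<open>orth p\<close>; the factor \<open>1 / j + 1\<close> accounts for the passage from
    \<open>orth p\<close> to \<open>p\<close>.\<close>
  define \<epsilon> where "\<epsilon> = k / (2 * (1 / j + 1))"
  have *: "k / (2 * q) * q = k / 2" if "q > 0" for q :: real using that by simp
  have "1 / j + 1 > 0" using j(1) by (simp add: add_pos_pos)
  then have \<epsilon>: "\<epsilon> > 0" "\<epsilon> * (1 / j + 1) = k / 2"
    using k(1) *[of "1 / j + 1"] unfolding \<epsilon>_def by (auto simp del: times_divide_eq_left times_divide_eq_right)
  define T where "T n \<omega> = (if \<bar>Z t \<omega>\<bar> \<le> real n then Z t \<omega> else 0)" for n \<omega>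
  have "\<forall>\<^sub>F n in sequentially. ip (\<lambda>\<omega>. Z t \<omega> - T n \<omega>) (\<lambda>\<omega>. Z t \<omega> - T n \<omega>) < \<epsilon>\<^sup>2"
    using order_tendstoD(2)[OF L2_truncation[OF L2_Z[of t]], of "\<epsilon>\<^sup>2"] \<epsilon> by (simp add: T_def)
  then obtain n where n: "ip (\<lambda>\<omega>. Z t \<omega> - T n \<omega>) (\<lambda>\<omega>. Z t \<omega> - T n \<omega>) < \<epsilon>\<^sup>2"
    by (auto simp: eventually_sequentially)
  have LT: "L2 (T n)" unfolding T_def by (rule L2_bounded[of _ "real n"]) auto
  \<comment> \<open>The bound for the norm of \<open>orth p\<close> after absorbing half of
    \<open>k * nv\<close>.\<close>
  define V where "V = 2 * (real n * K1 + \<epsilon> * (K1 / j)) / k"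
  show ?thesis
  proof
    fix p assume p: "adm p" and K: "risk p \<le> K"
    have fp: "feas p" and L: "L2 p" using p adm_L2 by (auto simp: adm_def)
    let ?v = "orth p"
    define a where "a = ip p U"
    define nv where "nv = sqrt (ip ?v ?v)"
    have nv0: "nv \<ge> 0" by (simp add: nv_def ip_self_nonneg)
    note Lv = L2_orth[OF L]
    have Lex: "L2 (\<lambda>\<omega>. excess \<omega> (p \<omega>))" by (rule L2_excess[OF L])
    have LaU: "L2 (\<lambda>\<omega>. U \<omega> * a)" using L2_cmult[OF L2_U, of a] by (simp add: mult.commute)
    have ex: "expectation (\<lambda>\<omega>. \<bar>excess \<omega> (p \<omega>)\<bar>) \<le> K1"
      using expectation_excess_le[OF p] K b_pos unfolding K1_def
      by (meson diff_right_mono less_imp_le mult_left_mono order_trans)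
    have "j * \<bar>a\<bar> \<le> expectation (\<lambda>\<omega>. \<bar>excess \<omega> (U \<omega> * a)\<bar>)" by (rule j)
    also have "\<dots> \<le> expectation (\<lambda>\<omega>. \<bar>excess \<omega> (p \<omega>)\<bar> + \<bar>?v \<omega>\<bar>)"
    proof (rule integral_mono)
      show "\<bar>excess \<omega> (U \<omega> * a)\<bar> \<le> \<bar>excess \<omega> (p \<omega>)\<bar> + \<bar>?v \<omega>\<bar>" for \<omega>
        using excess_lipschitz[of \<omega> "U \<omega> * a" "p \<omega>"] by (simp add: orth_def a_def mult.commute)
    qed (use L2_integrable[OF Lex] L2_integrable[OF Lv] L2_integrable[OF L2_excess[OF LaU]] in auto)
    also have "\<dots> \<le> K1 + nv"
      using ex L2_integrable[OF Lex] L2_integrable[OF Lv] expectation_abs_le[OF Lv] by (simp add: nv_def)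
    finally have "j * \<bar>a\<bar> \<le> K1 + nv" .
    then have a: "\<bar>a\<bar> \<le> K1 / j + nv / j" using j(1) by (simp add: field_simps)
    have "nv\<^sup>2 = ip ?v ?v" unfolding nv_def by (rule real_sqrt_pow2[OF ip_self_nonneg])
    then have "ip p p = nv\<^sup>2 + a\<^sup>2" using ip_orth_orth[OF L] by (simp add: a_def)
    also have "\<dots> \<le> (nv + \<bar>a\<bar>)\<^sup>2" using nv0 by (simp add: power2_sum)
    finally have pp: "sqrt (ip p p) \<le> nv + \<bar>a\<bar>" "ip p p \<le> (nv + \<bar>a\<bar>)\<^sup>2"
      using nv0 by (simp_all add: real_le_lsqrt)
    have "k * nv \<le> ip (Z t) p" using k(2)[OF fp] by (simp add: nv_def)
    also have "\<dots> = ip (\<lambda>\<omega>. Z t \<omega> - T n \<omega>) p + ip (T n) p"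
      using L2_Z LT L by (simp add: ip_simps)
    also have "\<dots> \<le> \<epsilon> * (nv + \<bar>a\<bar>) + real n * K1"
    proof (rule add_mono)
      have "ip (\<lambda>\<omega>. Z t \<omega> - T n \<omega>) p \<le> sqrt (ip (\<lambda>\<omega>. Z t \<omega> - T n \<omega>) (\<lambda>\<omega>. Z t \<omega> - T n \<omega>)) * sqrt (ip p p)"
        using Cauchy_Schwarz_ip_sqrt[OF L2_diff[OF L2_Z LT] L] by (rule order_trans[OF abs_ge_self])
      also have "\<dots> \<le> \<epsilon> * (nv + \<bar>a\<bar>)"
        using n \<epsilon> pp by (intro mult_mono) (auto simp: ip_self_nonneg intro!: real_le_lsqrt)
      finally show "ip (\<lambda>\<omega>. Z t \<omega> - T n \<omega>) p \<le> \<epsilon> * (nv + \<bar>a\<bar>)" .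
      have "ip (T n) p \<le> expectation (\<lambda>\<omega>. real n * \<bar>excess \<omega> (p \<omega>)\<bar>)"
        unfolding ip_def
      proof (rule integral_mono)
        fix \<omega>
        show "T n \<omega> * p \<omega> \<le> real n * \<bar>excess \<omega> (p \<omega>)\<bar>"
        proof (cases "\<bar>Z t \<omega>\<bar> \<le> real n")
          case True
          have "Z t \<omega> * p \<omega> \<le> \<bar>Z t \<omega>\<bar> * \<bar>excess \<omega> (p \<omega>)\<bar>" unfolding Z_def by (rule excess_mult_le)
          also have "\<dots> \<le> real n * \<bar>excess \<omega> (p \<omega>)\<bar>" using True by (intro mult_right_mono) auto
          finally show ?thesis using True by (simp add: T_def)
        qed (simp add: T_def)
      qed (use L2_mult[OF LT L] L2_integrable[OF Lex] in auto)
      also have "\<dots> \<le> real n * K1" using ex by (simp add: mult_left_mono)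
      finally show "ip (T n) p \<le> real n * K1" .
    qed
    also have "\<epsilon> * (nv + \<bar>a\<bar>) \<le> \<epsilon> * (nv + (K1 / j + nv / j))" using a \<epsilon> by (intro mult_left_mono) auto
    also have "\<dots> = nv * (\<epsilon> * (1 / j + 1)) + \<epsilon> * (K1 / j)" by (simp add: algebra_simps)
    finally have "k * nv \<le> nv * (k / 2) + \<epsilon> * (K1 / j) + real n * K1" unfolding \<epsilon>(2) by simp
    then have "nv \<le> V" using k(1) by (simp add: V_def field_simps)
    then have "nv + \<bar>a\<bar> \<le> V + (K1 / j + V / j)"
      using a j(1) by (meson add_left_mono add_mono divide_right_mono less_imp_le order_trans)
    then have "(nv + \<bar>a\<bar>)\<^sup>2 \<le> (V + (K1 / j + V / j))\<^sup>2" using nv0 by (intro power_mono) auto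
    then show "ip p p \<le> (V + (K1 / j + V / j))\<^sup>2" using pp by linarith
  qed
qed

text \<open>The nearly optimal sets are nested, stable under midpoints and bounded in norm, so the
  minimal-norm selection does the work of weak compactness. Convergence in norm preserves the cone
  constraint, and convergence almost everywhere gives lower semicontinuity of the risk.\<close>

lemma risk_attains_min:
  assumes gt: "\<And>t. 1 / \<delta> < ip (Z t) (Z t)"
  obtains p where "adm p" "\<And>q. adm q \<Longrightarrow> risk p \<le> risk q"
proof -
  define I where "I = Inf (risk ` Collect adm)"
  have bdd: "bdd_below (risk ` Collect adm)"
    by (rule bdd_belowI[of _ "expectation R"]) (auto simp: adm_def risk_ge)
  have ne: "risk ` Collect adm \<noteq> {}" using adm_G by auto
  have I_le: "I \<le> risk q" if "adm q" for q
    unfolding I_def using bdd that by (intro cInf_lower) auto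
  define S where "S n = {p. adm p \<and> risk p \<le> I + 1 / Suc n}" for n :: nat
  obtain B where B: "\<And>p. adm p \<Longrightarrow> risk p \<le> I + 1 \<Longrightarrow> ip p p \<le> B"
    using level_set_bounded[OF gt] by blast
  have "\<exists>X x. (\<forall>k. X k \<in> S k) \<and> L2 x \<and> (AE \<omega> in M. (\<lambda>k. X k \<omega>) \<longlonglongrightarrow> x \<omega>) \<and>
    (\<lambda>k. ip (\<lambda>\<omega>. x \<omega> - X k \<omega>) (\<lambda>\<omega>. x \<omega> - X k \<omega>)) \<longlonglongrightarrow> 0"
  proof (rule nested_midpoint_convex)
    fix n :: nat
    have "I < I + 1 / Suc n" by simp
    then have "\<exists>y\<in>risk ` Collect adm. y < I + 1 / Suc n"
      using cInf_less_iff[OF ne bdd] unfolding I_def by blast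
    then obtain q where "adm q" "risk q < I + 1 / Suc n" by auto
    then show "S n \<noteq> {}" by (auto simp: S_def intro: less_imp_le)
    have "1 / real (Suc n) \<le> 1" by simp
    then show "ip x x \<le> B" if "x \<in> S n" for x
      using that B[of x] unfolding S_def by (smt (verit) mem_Collect_eq)
    show "L2 x" if "x \<in> S n" for x using that adm_L2 by (auto simp: S_def)
    show "(\<lambda>\<omega>. (x \<omega> + y \<omega>) / 2) \<in> S n" if "x \<in> S n" "y \<in> S n" for x y
    proof -
      have xy: "adm x" "adm y" "risk x \<le> I + 1 / Suc n" "risk y \<le> I + 1 / Suc n"
        using that unfolding S_def by blast+
      show ?thesis
        unfolding S_def using adm_midpoint[OF xy(1,2)] xy(3,4) by force
    qed
    show "S n \<subseteq> S m" if "m \<le> n" for m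
    proof -
      have "1 / real (Suc n) \<le> 1 / real (Suc m)" using that by (simp add: frac_le)
      then show ?thesis unfolding S_def by (auto intro: order_trans)
    qed
  qed
  then obtain X x where X: "\<And>k. X k \<in> S k" and Lx: "L2 x"
    and conv: "AE \<omega> in M. (\<lambda>k. X k \<omega>) \<longlonglongrightarrow> x \<omega>"
    and norm_conv: "(\<lambda>k. ip (\<lambda>\<omega>. x \<omega> - X k \<omega>) (\<lambda>\<omega>. x \<omega> - X k \<omega>)) \<longlonglongrightarrow> 0"
    by blast
  have Xadm: "adm (X k)" and Xrisk: "risk (X k) \<le> I + 1 / Suc k" for k
    using X[of k] unfolding S_def by blast+
  note LX = adm_L2[OF Xadm]
  have Xi: "integrable M (\<lambda>\<omega>. f \<omega> (X k \<omega>))" for k using Xadm by (simp add: adm_def)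
  have [measurable]: "x \<in> borel_measurable M" "X k \<in> borel_measurable M" for k
    using Lx LX by (auto simp: L2_def)
  have "feas x"
    unfolding feas_def
  proof (intro conjI Lx)
    have "(\<lambda>k. sqrt (c2 * (ip (X k) (X k) - (ip (X k) U)\<^sup>2))) \<longlonglongrightarrow> sqrt (c2 * (ip x x - (ip x U)\<^sup>2))"
      by (intro tendsto_real_sqrt tendsto_mult_left tendsto_diff tendsto_power
          tendsto_ip_self[OF Lx LX norm_conv] tendsto_ip_left[OF Lx LX L2_U norm_conv])
    moreover have "(\<lambda>k. ip (X k) G) \<longlonglongrightarrow> ip x G"
      by (rule tendsto_ip_left[OF Lx LX L2_G norm_conv])
    moreover have "sqrt (c2 * (ip (X k) (X k) - (ip (X k) U)\<^sup>2)) \<le> ip (X k) G" for k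
      using Xadm[of k] ip_orth_orth[OF LX[of k]] by (simp add: adm_def feas_def)
    ultimately show "sqrt (c2 * ip (orth x) (orth x)) \<le> ip x G"
      using ip_orth_orth[OF Lx] by (auto intro: LIMSEQ_le)
  qed
  have RM [measurable]: "R \<in> borel_measurable M" using integrable_R by auto
  \<comment> \<open>Subtracting the integrable minorant \<open>R\<close> makes the integrands
    nonnegative almost surely, as Fatou's lemma requires.\<close>
  let ?J = "I - expectation R"
  have J0: "0 \<le> ?J"
    unfolding I_def using ne risk_ge by (auto simp: adm_def intro!: cInf_greatest)
  have "(\<integral>\<^sup>+\<omega>. ennreal (f \<omega> (x \<omega>) - R \<omega>) \<partial>M) = (\<integral>\<^sup>+\<omega>. liminf (\<lambda>k. ennreal (f \<omega> (X k \<omega>) - R \<omega>)) \<partial>M)"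
  proof (rule nn_integral_cong_AE)
    show "AE \<omega> in M. ennreal (f \<omega> (x \<omega>) - R \<omega>) = liminf (\<lambda>k. ennreal (f \<omega> (X k \<omega>) - R \<omega>))"
      using conv AE_space
    proof eventually_elim
      case (elim \<omega>)
      have "(\<lambda>k. f \<omega> (X k \<omega>)) \<longlonglongrightarrow> f \<omega> (x \<omega>)"
        by (rule isCont_tendsto_compose[OF C1_strictly_convex.isCont_f[OF f_C1[OF elim(2)]] elim(1)])
      then have "(\<lambda>k. ennreal (f \<omega> (X k \<omega>) - R \<omega>)) \<longlonglongrightarrow> ennreal (f \<omega> (x \<omega>) - R \<omega>)"
        by (intro tendsto_ennrealI tendsto_diff tendsto_const)
      then show ?case by (rule lim_imp_Liminf[OF trivial_limit_sequentially, symmetric])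
    qed
  qed
  also have "\<dots> \<le> liminf (\<lambda>k. \<integral>\<^sup>+\<omega>. ennreal (f \<omega> (X k \<omega>) - R \<omega>) \<partial>M)"
    by (rule nn_integral_liminf) measurable
  also have "\<dots> \<le> liminf (\<lambda>k. ennreal (?J + 1 / Suc k))"
  proof (intro Liminf_mono always_eventually allI)
    fix k
    have "(\<integral>\<^sup>+\<omega>. ennreal (f \<omega> (X k \<omega>) - R \<omega>) \<partial>M) = ennreal (expectation (\<lambda>\<omega>. f \<omega> (X k \<omega>) - R \<omega>))"
      using Xi integrable_R f_ge_R by (intro nn_integral_eq_integral) auto
    also have "expectation (\<lambda>\<omega>. f \<omega> (X k \<omega>) - R \<omega>) = risk (X k) - expectation R"
      using Xi integrable_R by (simp add: risk_def)
    also have "ennreal \<dots> \<le> ennreal (?J + 1 / Suc k)" using Xrisk[of k] by (intro ennreal_leI) linarith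
    finally show "(\<integral>\<^sup>+\<omega>. ennreal (f \<omega> (X k \<omega>) - R \<omega>) \<partial>M) \<le> ennreal (?J + 1 / Suc k)" .
  qed
  also have "liminf (\<lambda>k. ennreal (?J + 1 / Suc k)) = ennreal (?J + 0)"
    by (intro lim_imp_Liminf tendsto_ennrealI tendsto_add tendsto_const LIMSEQ_Suc[OF lim_1_over_n]) auto
  finally have le: "(\<integral>\<^sup>+\<omega>. ennreal (f \<omega> (x \<omega>) - R \<omega>) \<partial>M) \<le> ennreal ?J" by simp
  have nn: "AE \<omega> in M. 0 \<le> f \<omega> (x \<omega>) - R \<omega>" using f_ge_R by eventually_elim simp
  have i: "integrable M (\<lambda>\<omega>. f \<omega> (x \<omega>) - R \<omega>)"
    by (intro integrableI_nonneg nn) (use le in \<open>auto intro: le_less_trans\<close>)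
  then have xi: "integrable M (\<lambda>\<omega>. f \<omega> (x \<omega>))"
    using Bochner_Integration.integrable_add[OF i integrable_R] by simp
  have "ennreal (expectation (\<lambda>\<omega>. f \<omega> (x \<omega>) - R \<omega>)) \<le> ennreal ?J"
    using le nn_integral_eq_integral[OF i nn] by simp
  then have "expectation (\<lambda>\<omega>. f \<omega> (x \<omega>) - R \<omega>) \<le> ?J" using J0 by (simp add: ennreal_le_iff)
  then have "risk x \<le> I" using xi integrable_R by (simp add: risk_def)
  then show ?thesis using that[of x] \<open>feas x\<close> xi I_le by (force simp: adm_def)
qed

end

section \<open>Solutions of the system and the first variation\<close>

context solvable_losses
begin

section \<open>The system as relations between inner products\<close>

definition P :: "real \<Rightarrow> real \<Rightarrow> real \<Rightarrow> 'a \<Rightarrow> real" where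
  "P \<gamma> a \<sigma> \<omega> = prox \<gamma> (f \<omega>) (a * U \<omega> + \<sigma> * G \<omega>)"

definition D :: "real \<Rightarrow> real \<Rightarrow> real \<Rightarrow> 'a \<Rightarrow> real" where
  "D \<gamma> a \<sigma> \<omega> = f' \<omega> (P \<gamma> a \<sigma> \<omega>)"

definition sol :: "real \<Rightarrow> real \<Rightarrow> real \<Rightarrow> bool" where
  "sol \<gamma> a \<sigma> \<longleftrightarrow> \<gamma> > 0 \<and> \<sigma> > 0 \<and>
     integrable M (\<lambda>\<omega>. (D \<gamma> a \<sigma> \<omega>)\<^sup>2) \<and>
     integrable M (\<lambda>\<omega>. U \<omega> * D \<gamma> a \<sigma> \<omega>) \<and>
     integrable M (\<lambda>\<omega>. G \<omega> * P \<gamma> a \<sigma> \<omega>) \<and>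
     \<sigma>\<^sup>2 / (\<gamma>\<^sup>2 * \<delta>) = (\<integral>\<omega>. (D \<gamma> a \<sigma> \<omega>)\<^sup>2 \<partial>M) \<and>
     0 = (\<integral>\<omega>. U \<omega> * D \<gamma> a \<sigma> \<omega> \<partial>M) \<and>
     \<sigma> * (1 - 1 / \<delta>) = (\<integral>\<omega>. G \<omega> * P \<gamma> a \<sigma> \<omega> \<partial>M)"

lemma L2_aU_\<sigma>G: "L2 (\<lambda>\<omega>. a * U \<omega> + \<sigma> * G \<omega>)"
  by (intro L2_add L2_cmult L2_U L2_G)

lemma P_measurable:
  assumes "\<gamma> > 0"
  shows "P \<gamma> a \<sigma> \<in> borel_measurable M" "D \<gamma> a \<sigma> \<in> borel_measurable M"
proof -
  show "P \<gamma> a \<sigma> \<in> borel_measurable M"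
    unfolding P_def[abs_def] using L2_aU_\<sigma>G[of a \<sigma>] assms by (intro prox_measurable) (simp_all add: L2_def)
  then show "D \<gamma> a \<sigma> \<in> borel_measurable M"
    unfolding D_def[abs_def] by (rule f'_compose_measurable)
qed

lemma prox_relation:
  assumes "\<gamma> > 0" "\<omega> \<in> space M"
  shows "P \<gamma> a \<sigma> \<omega> = (a * U \<omega> + \<sigma> * G \<omega>) - \<gamma> * D \<gamma> a \<sigma> \<omega>"
  using C1_strictly_convex.prox_equation[OF f_C1[OF assms(2)] assms(1)]
  unfolding P_def D_def by (simp add: algebra_simps)

text \<open>Everything comes from pairing the pointwise relation
  \<open>P = a * U + \<sigma> * G - \<gamma> * D\<close>. It also makes \<open>P\<close> square
  integrable, because \<open>D\<close> is; the first and third equations then express the two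
  products of \<open>D\<close> with \<open>D\<close> and \<open>G\<close> through the
  parameters.\<close>

lemma solD:
  assumes "sol \<gamma> a \<sigma>"
  shows "\<gamma> > 0" "\<sigma> > 0" "L2 (P \<gamma> a \<sigma>)" "L2 (D \<gamma> a \<sigma>)"
    "ip (D \<gamma> a \<sigma>) (D \<gamma> a \<sigma>) = \<sigma>\<^sup>2 / (\<gamma>\<^sup>2 * \<delta>)" "ip (D \<gamma> a \<sigma>) U = 0" "ip (P \<gamma> a \<sigma>) G = \<sigma> * c2"
    "ip (P \<gamma> a \<sigma>) U = a" "ip (D \<gamma> a \<sigma>) G = \<sigma> / (\<gamma> * \<delta>)"
    "\<And>x. L2 x \<Longrightarrow> ip (P \<gamma> a \<sigma>) x = a * ip U x + \<sigma> * ip G x - \<gamma> * ip (D \<gamma> a \<sigma>) x"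
proof -
  let ?P = "P \<gamma> a \<sigma>" and ?D = "D \<gamma> a \<sigma>"
  show \<gamma>: "\<gamma> > 0" and \<sigma>: "\<sigma> > 0" using assms by (auto simp: sol_def)
  show LD: "L2 ?D" using assms P_measurable[OF \<gamma>] by (simp add: sol_def L2_def)
  let ?Q = "\<lambda>\<omega>. (a * U \<omega> + \<sigma> * G \<omega>) - \<gamma> * ?D \<omega>"
  have LQ: "L2 ?Q" by (intro L2_diff L2_cmult L2_aU_\<sigma>G LD)
  have eq: "\<And>\<omega>. \<omega> \<in> space M \<Longrightarrow> ?P \<omega> = ?Q \<omega>" using prox_relation[OF \<gamma>] .
  show LP: "L2 ?P" by (rule L2_bound[OF LQ]) (use P_measurable[OF \<gamma>] eq in auto)
  show ipP: "ip ?P x = a * ip U x + \<sigma> * ip G x - \<gamma> * ip ?D x" if "L2 x" for x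
  proof -
    have "ip ?P x = ip ?Q x" by (rule ip_cong_AE) (use eq LP LQ that in auto)
    also have "\<dots> = a * ip U x + \<sigma> * ip G x - \<gamma> * ip ?D x"
      using that LD by (simp add: ip_simps L2_intros L2_U L2_G)
    finally show ?thesis .
  qed
  show "ip ?D ?D = \<sigma>\<^sup>2 / (\<gamma>\<^sup>2 * \<delta>)" using assms by (simp add: sol_def ip_self)
  show DU: "ip ?D U = 0" using assms by (simp add: sol_def ip_def mult.commute)
  show PG: "ip ?P G = \<sigma> * c2" using assms by (simp add: sol_def ip_def mult.commute c2_def)
  show "ip ?P U = a" using ipP[OF L2_U] by (simp add: ip_U_U ip_G_U DU)
  have "\<gamma> * ip ?D G = \<sigma> / \<delta>" using ipP[OF L2_G] PG by (simp add: ip_U_G ip_G_G c2_def algebra_simps)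
  then show "ip ?D G = \<sigma> / (\<gamma> * \<delta>)" using \<gamma> \<delta>_gt_1 by (simp add: field_simps)
qed

text \<open>The factor \<open>\<gamma> / \<sigma>\<close> makes the squared norm of the derivative
  and its pairing with \<open>G\<close> coincide, both equal to \<open>1 / \<delta>\<close>, which
  is the normalisation of the separation argument.\<close>

lemma sol_imp_ip_Z_gt:
  assumes "sol \<gamma> a \<sigma>"
  shows "1 / \<delta> < ip (Z t) (Z t)"
proof -
  note s = solD[OF assms]
  let ?d = "\<lambda>\<omega>. \<gamma> / \<sigma> * D \<gamma> a \<sigma> \<omega>"
  show ?thesis
  proof (rule ip_Z_gt[of "\<gamma> / \<sigma>" _ "P \<gamma> a \<sigma>" ?d])
    show "L2 ?d" by (rule L2_cmult[OF s(4)])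
    show "P \<gamma> a \<sigma> \<in> borel_measurable M" by (rule P_measurable[OF s(1)])
    have "ip ?d ?d = (\<gamma> / \<sigma>) * ((\<gamma> / \<sigma>) * (\<sigma>\<^sup>2 / (\<gamma>\<^sup>2 * \<delta>)))" by (simp only: ip_cmult_left ip_cmult_right s(5))
    then show "ip ?d ?d = 1 / \<delta>" using s(1,2) by (simp add: power2_eq_square)
    show "ip ?d U = 0" by (simp only: ip_cmult_left s(6))
    have "ip ?d G = (\<gamma> / \<sigma>) * (\<sigma> / (\<gamma> * \<delta>))" by (simp only: ip_cmult_left s(9))
    then show "ip ?d G = 1 / \<delta>" using s(1,2) by simp
  qed (use s \<delta>_gt_1 in \<open>auto simp: D_def\<close>)
qed

text \<open>The pairing equals \<open>\<sigma>' * ip G D - \<gamma>' * ip D' D\<close>. By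
  Cauchy-Schwarz and the first equations the subtracted term is at most
  \<open>\<sigma>' * \<sigma> / (\<gamma> * \<delta>)\<close>, the value of the other one. This is
  the optimality condition of one solution tested at another.\<close>

lemma ip_D_other_nonneg:
  assumes "sol \<gamma> a \<sigma>" "sol \<gamma>' a' \<sigma>'"
  shows "0 \<le> ip (D \<gamma> a \<sigma>) (P \<gamma>' a' \<sigma>')"
proof -
  note s = solD[OF assms(1)] and s' = solD[OF assms(2)]
  let ?x = "ip (D \<gamma>' a' \<sigma>') (D \<gamma> a \<sigma>)"
  have "\<gamma>' * \<bar>?x\<bar> \<le> \<gamma>' * (sqrt (\<sigma>'\<^sup>2 / (\<gamma>'\<^sup>2 * \<delta>)) * sqrt (\<sigma>\<^sup>2 / (\<gamma>\<^sup>2 * \<delta>)))"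
    using Cauchy_Schwarz_ip_sqrt[OF s'(4) s(4)] s'(1) unfolding s(5) s'(5) by (intro mult_left_mono) auto
  also have "\<dots> = \<sigma>' * (\<sigma> / (\<gamma> * \<delta>))"
    using s(1,2) s'(1,2) \<delta>_gt_1 by (simp add: real_sqrt_divide real_sqrt_mult)
  finally have "\<gamma>' * ?x \<le> \<sigma>' * (\<sigma> / (\<gamma> * \<delta>))"
    using s'(1) by (meson abs_ge_self less_imp_le mult_left_mono order_trans)
  then show ?thesis
    using s'(10)[OF s(4)] s(6) s(9)
    by (simp add: ip_commute[of "D \<gamma> a \<sigma>" "P \<gamma>' a' \<sigma>'"] ip_commute[of U "D \<gamma> a \<sigma>"] ip_commute[of G "D \<gamma> a \<sigma>"])
qed

text \<open>Complementary slackness: a solution lies on the boundary of the cone and its derivative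
  is normal to the ray through it.\<close>

lemma ip_D_self:
  assumes "sol \<gamma> a \<sigma>"
  shows "ip (D \<gamma> a \<sigma>) (P \<gamma> a \<sigma>) = 0"
proof -
  note s = solD[OF assms]
  have "ip (P \<gamma> a \<sigma>) (D \<gamma> a \<sigma>) = \<sigma> * (\<sigma> / (\<gamma> * \<delta>)) - \<gamma> * (\<sigma>\<^sup>2 / (\<gamma>\<^sup>2 * \<delta>))"
    using s(10)[OF s(4)] s(5,6,9) by (simp add: ip_commute[of U] ip_commute[of G])
  also have "\<dots> = 0" using s(1) by (simp add: power2_eq_square)
  finally show ?thesis by (simp add: ip_commute[of "D \<gamma> a \<sigma>" "P \<gamma> a \<sigma>"])
qed

text \<open>Adding the optimality conditions of both solutions makes the monotonicity pairing of
  their derivatives nonpositive, so strict monotonicity forces equal proximal points. Their pairings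
  with \<open>U\<close> and \<open>G\<close> return \<open>a\<close> and \<sigma>, and the
  derivative paired with \<open>G\<close> returns \<gamma>.\<close>

lemma sol_unique:
  assumes "sol \<gamma> a \<sigma>" "sol \<gamma>' a' \<sigma>'"
  shows "\<gamma> = \<gamma>' \<and> a = a' \<and> \<sigma> = \<sigma>'"
proof -
  note s = solD[OF assms(1)] and s' = solD[OF assms(2)]
  let ?P = "P \<gamma> a \<sigma>" and ?D = "D \<gamma> a \<sigma>" and ?P' = "P \<gamma>' a' \<sigma>'" and ?D' = "D \<gamma>' a' \<sigma>'"
  have "ip (\<lambda>\<omega>. ?D \<omega> - ?D' \<omega>) (\<lambda>\<omega>. ?P \<omega> - ?P' \<omega>) = - ip ?D ?P' - ip ?D' ?P"
    using s(3,4) s'(3,4) ip_D_self[OF assms(1)] ip_D_self[OF assms(2)] by (simp add: ip_simps L2_intros)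
  also have "\<dots> \<le> 0" using ip_D_other_nonneg[OF assms] ip_D_other_nonneg[OF assms(2,1)] by simp
  finally have le: "ip (\<lambda>\<omega>. ?D \<omega> - ?D' \<omega>) (\<lambda>\<omega>. ?P \<omega> - ?P' \<omega>) \<le> 0" .
  have mono: "AE \<omega> in M. 0 \<le> (?D \<omega> - ?D' \<omega>) * (?P \<omega> - ?P' \<omega>)"
  proof (rule AE_I2)
    fix \<omega> assume "\<omega> \<in> space M"
    then interpret C1_strictly_convex "f \<omega>" "f' \<omega>" by (rule f_C1)
    show "0 \<le> (?D \<omega> - ?D' \<omega>) * (?P \<omega> - ?P' \<omega>)"
      unfolding D_def using f'_le_iff by (cases "?P \<omega> \<le> ?P' \<omega>") (auto simp: zero_le_mult_iff)
  qed
  have "ip (\<lambda>\<omega>. ?D \<omega> - ?D' \<omega>) (\<lambda>\<omega>. ?P \<omega> - ?P' \<omega>) = 0"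
    using le integral_nonneg_AE[OF mono] unfolding ip_def by linarith
  then have "AE \<omega> in M. (?D \<omega> - ?D' \<omega>) * (?P \<omega> - ?P' \<omega>) = 0"
    unfolding ip_def using integral_nonneg_eq_0_iff_AE[OF L2_mult[OF L2_diff[OF s(4) s'(4)] L2_diff[OF s(3) s'(3)]] mono]
    by blast
  then have P_eq: "AE \<omega> in M. ?P \<omega> = ?P' \<omega>"
    using AE_space
  proof eventually_elim
    case (elim \<omega>)
    interpret C1_strictly_convex "f \<omega>" "f' \<omega>" using elim(2) by (rule f_C1)
    show ?case using elim(1) f'_less_iff unfolding D_def
      by (metis less_irrefl linorder_neqE_linordered_idom mult_eq_0_iff right_minus_eq)
  qed
  then have D_eq: "AE \<omega> in M. ?D \<omega> = ?D' \<omega>" unfolding D_def by eventually_elim simp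
  have "a = a'"
    using ip_cong_AE[OF P_eq, of U U] s(3,8) s'(3,8) L2_U by auto
  moreover have "\<sigma> * c2 = \<sigma>' * c2"
    using ip_cong_AE[OF P_eq, of G G] s(3,7) s'(3,7) L2_G by auto
  then have \<sigma>: "\<sigma> = \<sigma>'" using c2 by simp
  moreover have "\<sigma> / (\<gamma> * \<delta>) = \<sigma>' / (\<gamma>' * \<delta>)"
    using ip_cong_AE[OF D_eq, of G G] s(4,9) s'(4,9) L2_G by auto
  then have "\<gamma> = \<gamma>'" using \<sigma> s(1,2) s'(1) \<delta>_gt_1 by (simp add: field_simps)
  ultimately show ?thesis by blast
qed

text \<open>
  The risk may be infinite arbitrarily close to a minimiser \<open>p\<close>. It is differentiable along bounded
  directions supported where \<open>\<ell>'\<close> is bounded near \<open>p\<close>, and there are enough of these.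
\<close>

definition near_bdd :: "('a \<Rightarrow> real) \<Rightarrow> nat \<Rightarrow> 'a set" where
  "near_bdd p n = {\<omega> \<in> space M. \<bar>f' \<omega> (p \<omega> - 1)\<bar> \<le> real n \<and> \<bar>f' \<omega> (p \<omega> + 1)\<bar> \<le> real n}"

definition test :: "('a \<Rightarrow> real) \<Rightarrow> ('a \<Rightarrow> real) \<Rightarrow> bool" where
  "test p w \<longleftrightarrow> w \<in> borel_measurable M \<and>
     (\<exists>n. \<forall>\<omega>\<in>space M. \<bar>w \<omega>\<bar> \<le> real n \<and> (w \<omega> \<noteq> 0 \<longrightarrow> \<omega> \<in> near_bdd p n))"

lemma near_bdd_mono: "m \<le> n \<Longrightarrow> near_bdd p m \<subseteq> near_bdd p n"
  unfolding near_bdd_def by (force intro: order_trans)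

lemma near_bdd_measurable:
  assumes [measurable]: "p \<in> borel_measurable M"
  shows "near_bdd p n \<in> sets M"
  unfolding near_bdd_def by measurable

lemma near_bdd_exhausts:
  assumes "\<omega> \<in> space M"
  shows "\<exists>n. \<omega> \<in> near_bdd p n"
proof -
  obtain n :: nat where "\<bar>f' \<omega> (p \<omega> - 1)\<bar> + \<bar>f' \<omega> (p \<omega> + 1)\<bar> \<le> real n" using real_arch_simple by blast
  then show ?thesis using assms by (intro exI[of _ n]) (auto simp: near_bdd_def)
qed

lemma near_bdd_f':
  assumes "\<omega> \<in> near_bdd p n" "\<bar>h\<bar> \<le> 1"
  shows "\<bar>f' \<omega> (p \<omega> + h)\<bar> \<le> real n"
proof -
  have "\<omega> \<in> space M" using assms by (simp add: near_bdd_def)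
  then interpret C1_strictly_convex "f \<omega>" "f' \<omega>" by (rule f_C1)
  have "f' \<omega> (p \<omega> - 1) \<le> f' \<omega> (p \<omega> + h)" "f' \<omega> (p \<omega> + h) \<le> f' \<omega> (p \<omega> + 1)"
    using assms by (auto simp: f'_le_iff)
  then show ?thesis using assms(1) by (auto simp: near_bdd_def)
qed

lemma test_L2: "test p w \<Longrightarrow> L2 w"
  unfolding test_def by (auto intro: L2_bounded)

lemma test_cmult:
  assumes "test p w"
  shows "test p (\<lambda>\<omega>. c * w \<omega>)"
proof -
  obtain n where n: "w \<in> borel_measurable M" "\<And>\<omega>. \<omega> \<in> space M \<Longrightarrow> \<bar>w \<omega>\<bar> \<le> real n"
    "\<And>\<omega>. \<omega> \<in> space M \<Longrightarrow> w \<omega> \<noteq> 0 \<Longrightarrow> \<omega> \<in> near_bdd p n"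
    using assms unfolding test_def by auto
  obtain m :: nat where m: "\<bar>c\<bar> * real n \<le> real m" using real_arch_simple by blast
  have "\<bar>c * w \<omega>\<bar> \<le> real (max m n)" if "\<omega> \<in> space M" for \<omega>
  proof -
    have "\<bar>c * w \<omega>\<bar> \<le> \<bar>c\<bar> * real n" unfolding abs_mult using n(2)[OF that] by (intro mult_left_mono) auto
    then show ?thesis using m by simp
  qed
  then show ?thesis
    unfolding test_def using n(1,3) near_bdd_mono[of n "max m n" p]
    by (intro conjI exI[of _ "max m n"]) auto
qed

lemma test_add:
  assumes "test p w" "test p w'"
  shows "test p (\<lambda>\<omega>. w \<omega> + w' \<omega>)"
proof -
  obtain n where n: "w \<in> borel_measurable M" "\<And>\<omega>. \<omega> \<in> space M \<Longrightarrow> \<bar>w \<omega>\<bar> \<le> real n"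
    "\<And>\<omega>. \<omega> \<in> space M \<Longrightarrow> w \<omega> \<noteq> 0 \<Longrightarrow> \<omega> \<in> near_bdd p n"
    using assms(1) unfolding test_def by auto
  obtain m where m: "w' \<in> borel_measurable M" "\<And>\<omega>. \<omega> \<in> space M \<Longrightarrow> \<bar>w' \<omega>\<bar> \<le> real m"
    "\<And>\<omega>. \<omega> \<in> space M \<Longrightarrow> w' \<omega> \<noteq> 0 \<Longrightarrow> \<omega> \<in> near_bdd p m"
    using assms(2) unfolding test_def by auto
  have "\<omega> \<in> near_bdd p (m + n)" if "\<omega> \<in> space M" "w \<omega> + w' \<omega> \<noteq> 0" for \<omega>
    using that n(3)[of \<omega>] m(3)[of \<omega>] near_bdd_mono[of n "m + n" p] near_bdd_mono[of m "m + n" p] by force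
  moreover have "\<bar>w \<omega> + w' \<omega>\<bar> \<le> real (m + n)" if "\<omega> \<in> space M" for \<omega>
    using n(2)[OF that] m(2)[OF that] by simp
  ultimately show ?thesis
    unfolding test_def using n(1) m(1) by (intro conjI exI[of _ "m + n"]) auto
qed

lemma test_bound:
  assumes "test p w"
  obtains n where "n > 0" "\<And>\<omega>. \<omega> \<in> space M \<Longrightarrow> \<bar>w \<omega>\<bar> \<le> real n"
    "\<And>\<omega> h. \<omega> \<in> space M \<Longrightarrow> w \<omega> \<noteq> 0 \<Longrightarrow> \<bar>h\<bar> \<le> 1 \<Longrightarrow> \<bar>f' \<omega> (p \<omega> + h)\<bar> \<le> real n"
    "\<And>\<omega> h. \<omega> \<in> space M \<Longrightarrow> \<bar>h\<bar> \<le> 1 \<Longrightarrow> \<bar>f' \<omega> (p \<omega> + h) * w \<omega>\<bar> \<le> real n * real n"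
proof -
  obtain m where m: "\<And>\<omega>. \<omega> \<in> space M \<Longrightarrow> \<bar>w \<omega>\<bar> \<le> real m"
    "\<And>\<omega>. \<omega> \<in> space M \<Longrightarrow> w \<omega> \<noteq> 0 \<Longrightarrow> \<omega> \<in> near_bdd p m"
    using assms unfolding test_def by auto
  \<comment> \<open>The successor keeps the bound positive, so that step lengths can be divided by
    it.\<close>
  define n where "n = Suc m"
  have w: "\<bar>w \<omega>\<bar> \<le> real n" if "\<omega> \<in> space M" for \<omega> using m(1)[OF that] by (simp add: n_def)
  have b: "\<bar>f' \<omega> (p \<omega> + h)\<bar> \<le> real n" if "\<omega> \<in> space M" "w \<omega> \<noteq> 0" "\<bar>h\<bar> \<le> 1" for \<omega> h
    using near_bdd_f'[OF m(2)[OF that(1,2)] that(3)] by (simp add: n_def)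
  have "\<bar>f' \<omega> (p \<omega> + h) * w \<omega>\<bar> \<le> real n * real n" if "\<omega> \<in> space M" "\<bar>h\<bar> \<le> 1" for \<omega> h
  proof (cases "w \<omega> = 0")
    case False
    show ?thesis unfolding abs_mult using w[OF that(1)] b[OF that(1) False that(2)] by (intro mult_mono) auto
  qed simp
  then show ?thesis using that[of n] w b by (auto simp: n_def)
qed

lemma test_f'_integrable:
  assumes t: "test p w" and [measurable]: "p \<in> borel_measurable M" and h: "\<And>\<omega>. \<omega> \<in> space M \<Longrightarrow> \<bar>h \<omega>\<bar> \<le> 1"
    and [measurable]: "h \<in> borel_measurable M"
  shows "integrable M (\<lambda>\<omega>. f' \<omega> (p \<omega> + h \<omega>) * w \<omega>)"
proof -
  obtain n where n: "\<And>\<omega> h. \<omega> \<in> space M \<Longrightarrow> \<bar>h\<bar> \<le> 1 \<Longrightarrow> \<bar>f' \<omega> (p \<omega> + h) * w \<omega>\<bar> \<le> real n * real n"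
    by (rule test_bound[OF t]) (rule that; assumption)
  have [measurable]: "w \<in> borel_measurable M" using t by (simp add: test_def)
  show ?thesis
  proof (rule integrable_const_bound[where B="real n * real n"])
    show "AE \<omega> in M. norm (f' \<omega> (p \<omega> + h \<omega>) * w \<omega>) \<le> real n * real n"
      using n h by (intro AE_I2) (simp only: real_norm_def)
  qed measurable
qed

text \<open>Truncating \<open>y\<close> in size and to \<open>near_bdd p n\<close> gives test
  directions whose product with \<open>y\<close> is \<open>y\<^sup>2\<close> on sets exhausting the
  space. Thus test directions separate measurable functions up to null sets.\<close>

lemma test_detects:
  assumes p [measurable]: "p \<in> borel_measurable M" and y [measurable]: "y \<in> borel_measurable M"
    and ne: "\<not> (AE \<omega> in M. y \<omega> = 0)"
  obtains w where "test p w" "expectation (\<lambda>\<omega>. y \<omega> * w \<omega>) > 0"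
proof -
  define w where "w n \<omega> = (if \<bar>y \<omega>\<bar> \<le> real n then y \<omega> else 0) * indicator (near_bdd p n) \<omega>" for n \<omega>
  have [measurable]: "near_bdd p n \<in> sets M" for n by (rule near_bdd_measurable[OF p])
  have wm [measurable]: "w n \<in> borel_measurable M" for n unfolding w_def by measurable
  have t: "test p (w n)" for n
    unfolding test_def using wm by (intro conjI exI[of _ n]) (auto simp: w_def indicator_def)
  have i: "integrable M (\<lambda>\<omega>. y \<omega> * w n \<omega>)" for n
  proof (rule integrable_const_bound[where B="real n * real n"])
    have "\<bar>y \<omega> * w n \<omega>\<bar> \<le> real n * real n" for \<omega>
      unfolding abs_mult
      by (cases "\<bar>y \<omega>\<bar> \<le> real n"; cases "\<omega> \<in> near_bdd p n")
        (auto simp: w_def simp del: abs_mult_self_eq intro: mult_mono)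
    then show "AE \<omega> in M. norm (y \<omega> * w n \<omega>) \<le> real n * real n" by auto
  qed measurable
  have "y \<omega> * w n \<omega> = (if \<bar>y \<omega>\<bar> \<le> real n \<and> \<omega> \<in> near_bdd p n then (y \<omega>)\<^sup>2 else 0)" for n \<omega>
    by (simp add: w_def power2_eq_square)
  then have nn: "AE \<omega> in M. 0 \<le> y \<omega> * w n \<omega>" for n by simp
  have "\<exists>n. expectation (\<lambda>\<omega>. y \<omega> * w n \<omega>) > 0"
  proof (rule ccontr)
    assume "\<not> ?thesis"
    then have "expectation (\<lambda>\<omega>. y \<omega> * w n \<omega>) = 0" for n
      using integral_nonneg_AE[OF nn, of n] by (meson antisym not_less)
    then have "AE \<omega> in M. \<forall>n. y \<omega> * w n \<omega> = 0"
      unfolding AE_all_countable using integral_nonneg_eq_0_iff_AE[OF i nn] by blast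
    then have "AE \<omega> in M. y \<omega> = 0"
      using AE_space
    proof eventually_elim
      case (elim \<omega>)
      obtain m where m: "\<omega> \<in> near_bdd p m" using near_bdd_exhausts elim by blast
      obtain k where k: "\<bar>y \<omega>\<bar> \<le> real k" using real_arch_simple by blast
      have "\<omega> \<in> near_bdd p (max m k)" using m near_bdd_mono[of m "max m k" p] by auto
      moreover have "\<bar>y \<omega>\<bar> \<le> real (max m k)" using k by simp
      ultimately show ?case using elim(1)[rule_format, of "max m k"] by (simp add: w_def)
    qed
    then show False using ne by blast
  qed
  then show ?thesis using that t by blast
qed

text \<open>The tangent inequality is taken at the perturbed point and evaluated at
  \<open>p\<close>, which bounds the increment of the risk from above by a derivative term; no
  difference quotient of the risk is needed. The derivative terms are uniformly bounded, so
  dominated convergence lets the step tend to zero.\<close>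

lemma first_variation:
  assumes p: "adm p" and min: "\<And>q. adm q \<Longrightarrow> risk p \<le> risk q" and w: "test p w"
    and feas: "\<forall>\<^sub>F \<epsilon> in at_right 0. feas (\<lambda>\<omega>. p \<omega> + \<epsilon> * w \<omega>)"
  shows "0 \<le> expectation (\<lambda>\<omega>. f' \<omega> (p \<omega>) * w \<omega>)"
proof -
  have pm [measurable]: "p \<in> borel_measurable M" using adm_L2[OF p] by (simp add: L2_def)
  have wm [measurable]: "w \<in> borel_measurable M" using w by (simp add: test_def)
  obtain n where n: "n > 0" "\<And>\<omega>. \<omega> \<in> space M \<Longrightarrow> \<bar>w \<omega>\<bar> \<le> real n"
    "\<And>\<omega> h. \<omega> \<in> space M \<Longrightarrow> w \<omega> \<noteq> 0 \<Longrightarrow> \<bar>h\<bar> \<le> 1 \<Longrightarrow> \<bar>f' \<omega> (p \<omega> + h)\<bar> \<le> real n"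
    "\<And>\<omega> h. \<omega> \<in> space M \<Longrightarrow> \<bar>h\<bar> \<le> 1 \<Longrightarrow> \<bar>f' \<omega> (p \<omega> + h) * w \<omega>\<bar> \<le> real n * real n"
    by (rule test_bound[OF w]) (rule that; assumption)
  \<comment> \<open>Dividing by the bound \<open>n\<close> of \<open>w\<close> keeps every
    perturbation inside the window of width 1 on which \<open>f'\<close> is controlled.\<close>
  define \<epsilon> where "\<epsilon> k = inverse (real (Suc k)) * inverse (real n)" for k
  have \<epsilon>0: "\<epsilon> k > 0" for k using n(1) by (simp add: \<epsilon>_def)
  have small: "\<bar>\<epsilon> k * w \<omega>\<bar> \<le> 1" if "\<omega> \<in> space M" for k \<omega>
  proof -
    have "\<bar>\<epsilon> k * w \<omega>\<bar> = inverse (real (Suc k)) * (inverse (real n) * \<bar>w \<omega>\<bar>)"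
      by (simp add: \<epsilon>_def abs_mult)
    also have "\<dots> \<le> 1 * (inverse (real n) * real n)"
      using n(1) n(2)[OF that] by (intro mult_mono) (auto simp: inverse_le_1_iff)
    finally show ?thesis using n(1) by simp
  qed
  have "(\<lambda>k. inverse (real (Suc k)) * inverse (real n)) \<longlonglongrightarrow> 0 * inverse (real n)"
    by (intro tendsto_intros LIMSEQ_inverse_real_of_nat)
  then have \<epsilon>_lim: "\<epsilon> \<longlonglongrightarrow> 0" unfolding \<epsilon>_def[abs_def] by simp
  then have "filterlim \<epsilon> (at_right 0) sequentially"
    using \<epsilon>0 by (intro tendsto_imp_filterlim_at_right always_eventually allI)
  then have ev: "\<forall>\<^sub>F k in sequentially. feas (\<lambda>\<omega>. p \<omega> + \<epsilon> k * w \<omega>)"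
    using feas by (rule eventually_compose_filterlim[rotated])
  have ip_: "integrable M (\<lambda>\<omega>. f \<omega> (p \<omega>))" using p by (simp add: adm_def)
  have ik: "integrable M (\<lambda>\<omega>. f \<omega> (p \<omega> + \<epsilon> k * w \<omega>))" for k
  proof -
    have "integrable M (\<lambda>\<omega>. f \<omega> (p \<omega> + \<epsilon> k * w \<omega>) - f \<omega> (p \<omega>))"
    proof (rule integrable_const_bound[where B="real n"])
      show "AE \<omega> in M. norm (f \<omega> (p \<omega> + \<epsilon> k * w \<omega>) - f \<omega> (p \<omega>)) \<le> real n"
      proof (rule AE_I2)
        fix \<omega> assume \<omega>: "\<omega> \<in> space M"
        then interpret C1_strictly_convex "f \<omega>" "f' \<omega>" by (rule f_C1)
        show "norm (f \<omega> (p \<omega> + \<epsilon> k * w \<omega>) - f \<omega> (p \<omega>)) \<le> real n"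
        proof (cases "w \<omega> = 0")
          case False
          have "\<bar>f \<omega> (p \<omega> + \<epsilon> k * w \<omega>) - f \<omega> (p \<omega>)\<bar> \<le> real n * \<bar>\<epsilon> k * w \<omega>\<bar>"
            using n(3)[OF \<omega> False, of "-1"] n(3)[OF \<omega> False, of 1] small[OF \<omega>]
            by (intro increment_le) auto
          also have "\<dots> \<le> real n * 1" using small[OF \<omega>] by (intro mult_left_mono) auto
          finally show ?thesis by simp
        qed simp
      qed
    qed measurable
    from Bochner_Integration.integrable_add[OF this ip_] show ?thesis by simp
  qed
  have i': "integrable M (\<lambda>\<omega>. f' \<omega> (p \<omega> + \<epsilon> k * w \<omega>) * w \<omega>)" for k
    by (rule test_f'_integrable[OF w pm]) (use small in auto)
  have "\<forall>\<^sub>F k in sequentially. 0 \<le> expectation (\<lambda>\<omega>. f' \<omega> (p \<omega> + \<epsilon> k * w \<omega>) * w \<omega>)"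
    using ev
  proof eventually_elim
    case (elim k)
    have "0 \<le> risk (\<lambda>\<omega>. p \<omega> + \<epsilon> k * w \<omega>) - risk p"
      using min[of "\<lambda>\<omega>. p \<omega> + \<epsilon> k * w \<omega>"] elim ik by (simp add: adm_def)
    also have "\<dots> = expectation (\<lambda>\<omega>. f \<omega> (p \<omega> + \<epsilon> k * w \<omega>) - f \<omega> (p \<omega>))"
      unfolding risk_def using ik ip_ by simp
    also have "\<dots> \<le> expectation (\<lambda>\<omega>. \<epsilon> k * (f' \<omega> (p \<omega> + \<epsilon> k * w \<omega>) * w \<omega>))"
    proof (rule integral_mono)
      fix \<omega> assume "\<omega> \<in> space M"
      then interpret C1_strictly_convex "f \<omega>" "f' \<omega>" by (rule f_C1)
      show "f \<omega> (p \<omega> + \<epsilon> k * w \<omega>) - f \<omega> (p \<omega>) \<le> \<epsilon> k * (f' \<omega> (p \<omega> + \<epsilon> k * w \<omega>) * w \<omega>)"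
        using above_tangent[of "p \<omega> + \<epsilon> k * w \<omega>" "p \<omega>"] by (simp add: algebra_simps)
    qed (use ik ip_ i' in auto)
    finally show ?case using \<epsilon>0[of k] by (simp add: zero_le_mult_iff not_le)
  qed
  moreover have "(\<lambda>k. expectation (\<lambda>\<omega>. f' \<omega> (p \<omega> + \<epsilon> k * w \<omega>) * w \<omega>)) \<longlonglongrightarrow> expectation (\<lambda>\<omega>. f' \<omega> (p \<omega>) * w \<omega>)"
  proof (rule integral_dominated_convergence[where w="\<lambda>_. real n * real n"])
    show "AE \<omega> in M. (\<lambda>k. f' \<omega> (p \<omega> + \<epsilon> k * w \<omega>) * w \<omega>) \<longlonglongrightarrow> f' \<omega> (p \<omega>) * w \<omega>"
    proof (rule AE_I2)
      fix \<omega> assume \<omega>: "\<omega> \<in> space M"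
      then interpret C1_strictly_convex "f \<omega>" "f' \<omega>" by (rule f_C1)
      have "(\<lambda>k. p \<omega> + \<epsilon> k * w \<omega>) \<longlonglongrightarrow> p \<omega> + 0 * w \<omega>" by (intro tendsto_intros \<epsilon>_lim)
      then have "(\<lambda>k. p \<omega> + \<epsilon> k * w \<omega>) \<longlonglongrightarrow> p \<omega>" by simp
      then show "(\<lambda>k. f' \<omega> (p \<omega> + \<epsilon> k * w \<omega>) * w \<omega>) \<longlonglongrightarrow> f' \<omega> (p \<omega>) * w \<omega>"
        by (intro tendsto_mult tendsto_const isCont_tendsto_compose[OF isCont_f'])
    qed
    show "AE \<omega> in M. norm (f' \<omega> (p \<omega> + \<epsilon> k * w \<omega>) * w \<omega>) \<le> real n * real n" for k
      using n(4) small by (intro AE_I2) auto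
  qed auto
  ultimately show ?thesis by (intro tendsto_lowerbound[of _ _ sequentially]) auto
qed

section \<open>Lagrange multipliers away from the apex\<close>

lemma ip_f'_add:
  assumes "p \<in> borel_measurable M" "test p w" "test p w'"
  shows "expectation (\<lambda>\<omega>. f' \<omega> (p \<omega>) * (w \<omega> + c * w' \<omega>))
    = expectation (\<lambda>\<omega>. f' \<omega> (p \<omega>) * w \<omega>) + c * expectation (\<lambda>\<omega>. f' \<omega> (p \<omega>) * w' \<omega>)"
proof -
  have i: "integrable M (\<lambda>\<omega>. f' \<omega> (p \<omega>) * v \<omega>)" if "test p v" for v
    using test_f'_integrable[OF that assms(1), of "\<lambda>_. 0"] by simp
  have "expectation (\<lambda>\<omega>. f' \<omega> (p \<omega>) * (w \<omega> + c * w' \<omega>))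
    = expectation (\<lambda>\<omega>. f' \<omega> (p \<omega>) * w \<omega> + c * (f' \<omega> (p \<omega>) * w' \<omega>))"
    by (simp add: algebra_simps)
  then show ?thesis using i[OF assms(2)] i[OF assms(3)] by simp
qed

text \<open>A linear functional that is nonnegative on the open half-space given by \<open>h\<close>
  is a nonnegative multiple of the pairing with \<open>h\<close>. The identity is available for test
  directions, and \<open>test_detects\<close> makes it pointwise.\<close>

lemma multiplier:
  assumes p: "p \<in> borel_measurable M" and h: "L2 h" and w0: "test p w0" "ip h w0 > 0"
    and var: "\<And>w. test p w \<Longrightarrow> ip h w > 0 \<Longrightarrow> 0 \<le> expectation (\<lambda>\<omega>. f' \<omega> (p \<omega>) * w \<omega>)"
  shows "\<exists>c\<ge>0. AE \<omega> in M. f' \<omega> (p \<omega>) = c * h \<omega>"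
proof -
  let ?E = "\<lambda>w. expectation (\<lambda>\<omega>. f' \<omega> (p \<omega>) * w \<omega>)"
  define c where "c = ?E w0 / ip h w0"
  have c0: "c \<ge> 0" using var[OF w0] w0 by (simp add: c_def)
  have ge: "c * ip h w \<le> ?E w" if w: "test p w" for w
  proof (rule field_le_epsilon)
    fix e :: real assume e: "e > 0"
    \<comment> \<open>Adding \<open>?s * w0\<close> moves any \<open>w\<close> to pairing
      \<open>\<eta> * ip h w0 > 0\<close>, at a cost of at most \<open>e\<close>; the summand 1
      covers a vanishing functional at \<open>w0\<close>.\<close>
    define \<eta> where "\<eta> = e / (?E w0 + 1)"
    have E0: "?E w0 \<ge> 0" using var[OF w0] .
    then have \<eta>: "\<eta> > 0" "\<eta> * ?E w0 \<le> e" using e by (simp_all add: \<eta>_def field_simps)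
    let ?s = "\<eta> - ip h w / ip h w0"
    have "ip h (\<lambda>\<omega>. w \<omega> + ?s * w0 \<omega>) = ip h w + ?s * ip h w0"
      using h test_L2[OF w] test_L2[OF w0(1)] by (simp add: ip_add_right L2_cmult ip_cmult_right)
    also have "\<dots> = \<eta> * ip h w0" using w0 by (simp add: algebra_simps)
    finally have "ip h (\<lambda>\<omega>. w \<omega> + ?s * w0 \<omega>) > 0" using \<eta> w0 by simp
    then have "0 \<le> ?E (\<lambda>\<omega>. w \<omega> + ?s * w0 \<omega>)"
      by (intro var test_add test_cmult w w0(1))
    also have "\<dots> = ?E w + ?s * ?E w0" by (rule ip_f'_add[OF p w w0(1)])
    also have "\<dots> = ?E w + \<eta> * ?E w0 - c * ip h w" by (simp add: c_def algebra_simps)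
    finally show "c * ip h w \<le> ?E w + e" using \<eta>(2) by linarith
  qed
  have eq: "?E w = c * ip h w" if w: "test p w" for w
  proof -
    have "c * ip h (\<lambda>\<omega>. (-1) * w \<omega>) \<le> ?E (\<lambda>\<omega>. (-1) * w \<omega>)" by (rule ge[OF test_cmult[OF w]])
    then have "?E w \<le> c * ip h w" by (simp add: ip_uminus_right)
    then show ?thesis using ge[OF w] by simp
  qed
  have hm [measurable]: "h \<in> borel_measurable M" using h by (simp add: L2_def)
  have "AE \<omega> in M. f' \<omega> (p \<omega>) - c * h \<omega> = 0"
  proof (rule ccontr)
    assume ne: "\<not> ?thesis"
    have "(\<lambda>\<omega>. f' \<omega> (p \<omega>) - c * h \<omega>) \<in> borel_measurable M" using p by measurable
    then obtain w where w: "test p w" "expectation (\<lambda>\<omega>. (f' \<omega> (p \<omega>) - c * h \<omega>) * w \<omega>) > 0"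
      by (rule test_detects[OF p _ ne])
    have "expectation (\<lambda>\<omega>. (f' \<omega> (p \<omega>) - c * h \<omega>) * w \<omega>)
        = expectation (\<lambda>\<omega>. f' \<omega> (p \<omega>) * w \<omega> - c * (h \<omega> * w \<omega>))" by (simp add: algebra_simps)
    also have "\<dots> = ?E w - c * ip h w"
      using test_f'_integrable[OF w(1) p, of "\<lambda>_. 0"] L2_mult[OF h test_L2[OF w(1)]] by (simp add: ip_def)
    finally show False using w eq by simp
  qed
  then show ?thesis using c0 by (intro exI[of _ c] conjI) (auto elim: eventually_mono)
qed

text \<open>With positive probability the loss is not coercive and has no critical point. This
  excludes a zero multiplier, and at the apex it provides a nonzero descent direction.\<close>

lemma f'_not_AE_0: "\<not> (AE \<omega> in M. f' \<omega> (p \<omega>) = 0)"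
proof
  assume "AE \<omega> in M. f' \<omega> (p \<omega>) = 0"
  then have "AE \<omega> in M. \<omega> \<notin> Inc \<and> \<omega> \<notin> Dec"
    by eventually_elim (auto simp: Inc_def Dec_def, (metis less_irrefl)+)
  then show False using not_coercive by blast
qed

text \<open>The gradient of \<open>\<langle>p, G\<rangle>\<^sup>2 - c2 * \<parallel>orth p\<parallel>\<^sup>2\<close>, up to the factor 2.\<close>

definition cone_grad :: "('a \<Rightarrow> real) \<Rightarrow> 'a \<Rightarrow> real" where
  "cone_grad p \<omega> = ip p G * G \<omega> - c2 * orth p \<omega>"

lemma L2_cone_grad: "L2 p \<Longrightarrow> L2 (cone_grad p)"
  unfolding cone_grad_def[abs_def] by (intro L2_diff L2_cmult L2_G L2_orth)

text \<open>Along the ray the constraint is the quadratic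
  \<open>S + \<epsilon> * (2 * L + \<epsilon> * Q)\<close> with slack \<open>S\<close>, inward slope
  \<open>L\<close> and a remainder \<open>Q\<close> of unknown sign. Positive slack or positive
  slope decides for small \<epsilon>, while \<open>0 < ip p G\<close> keeps the ray on the right
  nappe of the cone.\<close>

lemma feas_perturb:
  assumes p: "feas p" and w: "L2 w" and pG: "0 < ip p G"
    and dir: "c2 * ip (orth p) (orth p) < (ip p G)\<^sup>2 \<or> 0 < ip (cone_grad p) w"
  shows "\<forall>\<^sub>F \<epsilon> in at_right 0. feas (\<lambda>\<omega>. p \<omega> + \<epsilon> * w \<omega>)"
proof -
  note Lp = feas_L2[OF p]
  define S where "S = (ip p G)\<^sup>2 - c2 * ip (orth p) (orth p)"
  define L where "L = ip (cone_grad p) w"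
  define Q where "Q = (ip w G)\<^sup>2 - c2 * ip (orth w) (orth w)"
  have S0: "S \<ge> 0" using p by (simp add: feas_iff S_def)
  have G_lin: "ip (\<lambda>\<omega>. p \<omega> + \<epsilon> * w \<omega>) G = ip p G + \<epsilon> * ip w G" for \<epsilon>
    using Lp w L2_G by (simp add: ip_simps L2_intros)
  have L_eq: "L = ip p G * ip w G - c2 * ip (orth p) w"
    unfolding L_def cone_grad_def[abs_def]
    using w L2_G L2_orth[OF Lp] by (simp add: ip_simps L2_intros ip_commute[of G w])
  have quad: "(ip (\<lambda>\<omega>. p \<omega> + \<epsilon> * w \<omega>) G)\<^sup>2
      - c2 * ip (orth (\<lambda>\<omega>. p \<omega> + \<epsilon> * w \<omega>)) (orth (\<lambda>\<omega>. p \<omega> + \<epsilon> * w \<omega>)) = S + \<epsilon> * (2 * L + \<epsilon> * Q)" for \<epsilon>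
  proof -
    have "orth (\<lambda>\<omega>. p \<omega> + \<epsilon> * w \<omega>) = (\<lambda>\<omega>. orth p \<omega> + \<epsilon> * orth w \<omega>)"
      using Lp w L2_U by (auto simp: orth_def[abs_def] fun_eq_iff ip_simps L2_intros algebra_simps)
    moreover have "ip (\<lambda>\<omega>. orth p \<omega> + \<epsilon> * orth w \<omega>) (\<lambda>\<omega>. orth p \<omega> + \<epsilon> * orth w \<omega>)
        = ip (orth p) (orth p) + 2 * \<epsilon> * ip (orth p) (orth w) + \<epsilon>\<^sup>2 * ip (orth w) (orth w)"
      using L2_orth[OF Lp] L2_orth[OF w]
      by (simp add: ip_simps L2_intros ip_commute[of "orth w" "orth p"] power2_eq_square right_diff_distrib distrib_left)
    moreover have "ip (orth p) (orth w) = ip (orth p) w"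
    proof -
      have "ip (orth p) (\<lambda>\<omega>. w \<omega> - ip w U * U \<omega>) = ip (orth p) w"
        using L2_orth[OF Lp] w L2_U ip_orth_U[OF Lp] by (simp add: ip_simps L2_intros)
      then show ?thesis by (simp add: orth_def[abs_def])
    qed
    ultimately show ?thesis
      unfolding G_lin S_def L_eq Q_def by (simp add: power2_eq_square algebra_simps)
  qed
  have "((\<lambda>\<epsilon>. ip p G + \<epsilon> * ip w G) \<longlongrightarrow> ip p G + 0 * ip w G) (at_right 0)"
    by (intro tendsto_intros)
  then have 1: "\<forall>\<^sub>F \<epsilon> in at_right 0. 0 < ip p G + \<epsilon> * ip w G"
    using pG order_tendstoD(1) by fastforce
  have "\<forall>\<^sub>F \<epsilon> in at_right 0. 0 \<le> S + \<epsilon> * (2 * L + \<epsilon> * Q)"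
  proof (cases "0 < L")
    case True
    have "((\<lambda>\<epsilon>. 2 * L + \<epsilon> * Q) \<longlongrightarrow> 2 * L + 0 * Q) (at_right 0)"
      by (intro tendsto_intros)
    then have "\<forall>\<^sub>F \<epsilon> in at_right 0. 0 < 2 * L + \<epsilon> * Q"
      using True order_tendstoD(1)[of _ "2 * L + 0 * Q" _ 0] by simp
    moreover have "\<forall>\<^sub>F \<epsilon> in at_right (0::real). \<epsilon> > 0" by (rule eventually_at_right_less)
    ultimately show ?thesis
      by eventually_elim (use S0 in \<open>auto intro!: add_nonneg_nonneg mult_nonneg_nonneg\<close>)
  next
    case False
    then have "S > 0" using dir by (simp add: S_def L_def)
    have "((\<lambda>\<epsilon>. S + \<epsilon> * (2 * L + \<epsilon> * Q)) \<longlongrightarrow> S + 0 * (2 * L + 0 * Q)) (at_right 0)"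
      by (intro tendsto_intros)
    then have "\<forall>\<^sub>F \<epsilon> in at_right 0. 0 < S + \<epsilon> * (2 * L + \<epsilon> * Q)"
      using \<open>S > 0\<close> order_tendstoD(1)[of _ "S + 0 * (2 * L + 0 * Q)" _ 0] by simp
    then show ?thesis by eventually_elim simp
  qed
  with 1 show ?thesis
  proof eventually_elim
    case (elim \<epsilon>)
    have "L2 (\<lambda>\<omega>. p \<omega> + \<epsilon> * w \<omega>)" by (intro L2_add L2_cmult Lp w)
    then show ?case unfolding feas_iff using elim quad[of \<epsilon>] G_lin[of \<epsilon>] by auto
  qed
qed

text \<open>Away from the apex the gradient \<open>cone_grad p\<close> is nonzero and yields a
  multiplier. The multiplier relation is the stationarity equation of the proximal point after
  rescaling, and activity of the constraint supplies the first equation of the system.\<close>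

lemma minimiser_imp_sol:
  assumes p: "adm p" and min: "\<And>q. adm q \<Longrightarrow> risk p \<le> risk q"
    and nz: "ip (orth p) (orth p) > 0"
  shows "\<exists>\<gamma> a \<sigma>. sol \<gamma> a \<sigma>"
proof -
  have fp: "feas p" and Lp: "L2 p" using p adm_L2 by (auto simp: adm_def)
  have pm [measurable]: "p \<in> borel_measurable M" using Lp by (simp add: L2_def)
  define g where "g = ip p G"
  have "0 < sqrt (c2 * ip (orth p) (orth p))" using nz c2 by simp
  then have g: "g > 0" using fp unfolding feas_def g_def by linarith
  let ?h = "cone_grad p"
  note Lh = L2_cone_grad[OF Lp]
  have "ip ?h G = g - c2 * g"
    unfolding cone_grad_def[abs_def] using L2_G L2_orth[OF Lp]
    by (simp add: ip_simps L2_intros ip_G_G ip_orth_G[OF Lp] g_def)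
  then have hG: "ip ?h G = g * (1 - c2)" by (simp add: algebra_simps)
  have hne: "\<not> (AE \<omega> in M. ?h \<omega> = 0)"
  proof
    assume "AE \<omega> in M. ?h \<omega> = 0"
    then have "ip ?h G = ip (\<lambda>_. 0) G" using Lh L2_G by (intro ip_cong_AE) auto
    then show False using hG g c2 by (simp add: ip_def)
  qed
  have hm: "?h \<in> borel_measurable M" using Lh by (simp add: L2_def)
  obtain w0 where w0: "test p w0" "ip ?h w0 > 0"
    using test_detects[OF pm hm hne] unfolding ip_def by blast
  have "\<exists>c\<ge>0. AE \<omega> in M. f' \<omega> (p \<omega>) = c * ?h \<omega>"
  proof (rule multiplier[OF pm Lh w0])
    fix w assume w: "test p w" "0 < ip ?h w"
    show "0 \<le> expectation (\<lambda>\<omega>. f' \<omega> (p \<omega>) * w \<omega>)"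
      by (rule first_variation[OF p min w(1)], assumption, rule feas_perturb[OF fp test_L2[OF w(1)]])
        (use g w(2) in \<open>auto simp: g_def\<close>)
  qed
  then obtain c where c: "c \<ge> 0" "AE \<omega> in M. f' \<omega> (p \<omega>) = c * ?h \<omega>" by blast
  have "c \<noteq> 0" using c(2) f'_not_AE_0[of p] by auto
  then have c0: "c > 0" using c(1) by simp
  \<comment> \<open>If there were slack, \<open>- w0\<close> would be an admissible direction as
    well, and by the multiplier relation it would strictly decrease the risk.\<close>
  have active: "c2 * ip (orth p) (orth p) = g\<^sup>2"
  proof (rule ccontr)
    assume "c2 * ip (orth p) (orth p) \<noteq> g\<^sup>2"
    then have strict: "c2 * ip (orth p) (orth p) < (ip p G)\<^sup>2" using fp by (simp add: feas_iff g_def)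
    let ?w = "\<lambda>\<omega>. (-1) * w0 \<omega>"
    have tw: "test p ?w" by (rule test_cmult[OF w0(1)])
    have "0 \<le> expectation (\<lambda>\<omega>. f' \<omega> (p \<omega>) * ?w \<omega>)"
      by (rule first_variation[OF p min tw], assumption, rule feas_perturb[OF fp test_L2[OF tw]])
        (use g strict in \<open>auto simp: g_def\<close>)
    also have "\<dots> = expectation (\<lambda>\<omega>. (- c) * (?h \<omega> * w0 \<omega>))"
    proof (rule integral_cong_AE)
      show "AE \<omega> in M. f' \<omega> (p \<omega>) * ?w \<omega> = (- c) * (?h \<omega> * w0 \<omega>)"
        using c(2) by eventually_elim simp
    qed (use tw w0(1) hm in \<open>auto simp: test_def intro!: borel_measurable_times\<close>)
    also have "\<dots> = - c * ip ?h w0" by (simp add: ip_def)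
    finally show False using c0 w0(2) by (simp add: mult_le_0_iff)
  qed
  define a where "a = ip p U"
  \<comment> \<open>With these values \<open>\<gamma> * c = 1 / c2\<close> and
    \<open>(1 / c2) * ?h = \<sigma> * G - orth p\<close>, so the multiplier relation is exactly the
    proximal equation at \<open>a * U + \<sigma> * G\<close>.\<close>
  define \<sigma> where "\<sigma> = g / c2"
  define \<gamma> where "\<gamma> = 1 / (c * c2)"
  have \<gamma>: "\<gamma> > 0" and \<sigma>: "\<sigma> > 0" using c0 c2 g by (auto simp: \<gamma>_def \<sigma>_def)
  have rel: "AE \<omega> in M. p \<omega> + \<gamma> * f' \<omega> (p \<omega>) = a * U \<omega> + \<sigma> * G \<omega>"
    using c(2)
  proof eventually_elim
    case (elim \<omega>)
    have "\<gamma> * f' \<omega> (p \<omega>) = (1 / c2) * ?h \<omega>" using c0 by (simp add: elim \<gamma>_def)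
    also have "\<dots> = \<sigma> * G \<omega> - orth p \<omega>" using c2 by (simp add: cone_grad_def \<sigma>_def g_def diff_divide_distrib)
    finally show ?case by (simp add: orth_def a_def)
  qed
  have P_eq: "AE \<omega> in M. P \<gamma> a \<sigma> \<omega> = p \<omega>"
    using rel AE_space
    by eventually_elim (simp add: P_def C1_strictly_convex.prox_unique[OF f_C1 \<gamma>])
  then have D_eq: "AE \<omega> in M. D \<gamma> a \<sigma> \<omega> = c * ?h \<omega>"
    using c(2) by eventually_elim (simp add: D_def)
  note Pm = P_measurable[OF \<gamma>, of a \<sigma>]
  have LP: "L2 (P \<gamma> a \<sigma>)" by (rule L2_bound[OF Lp Pm(1)]) (use P_eq in eventually_elim, simp)
  have Lch: "L2 (\<lambda>\<omega>. c * ?h \<omega>)" by (rule L2_cmult[OF Lh])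
  have LD: "L2 (D \<gamma> a \<sigma>)" by (rule L2_bound[OF Lch Pm(2)]) (use D_eq in eventually_elim, simp)
  \<comment> \<open>Activity turns the last term into \<open>c2 * g\<^sup>2\<close>; the squared
    norm then collapses to \<open>g\<^sup>2 / \<delta>\<close>.\<close>
  have "ip ?h ?h = g\<^sup>2 - 2 * c2 * g\<^sup>2 + c2 * (c2 * ip (orth p) (orth p))"
    unfolding cone_grad_def[abs_def] using L2_G L2_orth[OF Lp] ip_orth_G[OF Lp]
    by (simp add: ip_simps L2_intros ip_G_G ip_commute[of G "orth p"] g_def power2_eq_square
        right_diff_distrib)
  then have hh: "ip ?h ?h = g\<^sup>2 * (1 - c2)" unfolding active by (simp add: algebra_simps)
  have "ip (D \<gamma> a \<sigma>) (D \<gamma> a \<sigma>) = ip (\<lambda>\<omega>. c * ?h \<omega>) (\<lambda>\<omega>. c * ?h \<omega>)"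
    by (rule ip_cong_AE[OF D_eq D_eq LD LD Lch Lch])
  also have "\<dots> = c * (c * (g\<^sup>2 * (1 / \<delta>)))" by (simp only: ip_cmult_left ip_cmult_right hh c2(3))
  also have "\<dots> = \<sigma>\<^sup>2 / (\<gamma>\<^sup>2 * \<delta>)"
    using c2(1) c0 by (simp add: \<sigma>_def \<gamma>_def power2_eq_square)
  finally have 1: "\<sigma>\<^sup>2 / (\<gamma>\<^sup>2 * \<delta>) = ip (D \<gamma> a \<sigma>) (D \<gamma> a \<sigma>)" by simp
  have "ip ?h U = 0"
    unfolding cone_grad_def[abs_def] using L2_G L2_U L2_orth[OF Lp]
    by (simp add: ip_simps L2_intros ip_G_U ip_orth_U[OF Lp])
  then have 2: "ip U (D \<gamma> a \<sigma>) = 0"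
    using ip_cong_AE[OF D_eq _ LD L2_U Lch L2_U, of ] ip_cmult_left[of c ?h U]
    by (simp add: ip_commute[of U "D \<gamma> a \<sigma>"])
  have "ip G (P \<gamma> a \<sigma>) = g"
    using ip_cong_AE[OF P_eq _ LP L2_G Lp L2_G] by (simp add: ip_commute[of G "P \<gamma> a \<sigma>"] g_def)
  then have 3: "\<sigma> * (1 - 1 / \<delta>) = ip G (P \<gamma> a \<sigma>)" using c2 by (simp add: \<sigma>_def c2_def[symmetric])
  have "sol \<gamma> a \<sigma>"
    unfolding sol_def using \<gamma> \<sigma> 1 2 3 LD L2_mult[OF L2_U LD] L2_mult[OF L2_G LP]
    unfolding ip_self L2_def ip_def by simp
  then show ?thesis by blast
qed

section \<open>The apex of the cone\<close>

lemma indep_ip: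
  fixes g :: "real \<Rightarrow> real"
  assumes "g \<in> borel_measurable borel" "y \<in> borel_measurable F" "L2 (\<lambda>\<omega>. g (G \<omega>))" "L2 y"
  shows "ip (\<lambda>\<omega>. g (G \<omega>)) y = expectation (\<lambda>\<omega>. g (G \<omega>)) * expectation y"
  unfolding ip_def using assms by (intro expectation_indep L2_integrable)

text \<open>
  At \<open>a * U\<close> the derivative \<open>\<ell>'\<close> is independent of \<open>G\<close>. A truncation of \<open>G\<close>, which lies inside the cone,
  corrected by a small multiple of \<open>- \<ell>'\<close> is then a feasible direction of strict descent.
\<close>

lemma multiple_of_U_not_minimiser:
  assumes p: "adm (\<lambda>\<omega>. a * U \<omega>)" and min: "\<And>q. adm q \<Longrightarrow> risk (\<lambda>\<omega>. a * U \<omega>) \<le> risk q"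
  shows False
proof -
  let ?p = "\<lambda>\<omega>. a * U \<omega>"
  have pF: "?p \<in> borel_measurable F" using U_F by simp
  have pm: "?p \<in> borel_measurable M" by (rule measurable_F[OF pF])
  define d where "d \<omega> = f' \<omega> (?p \<omega>)" for \<omega>
  \<comment> \<open>At a multiple of \<open>U\<close> the derivative is measurable with respect to
    \<open>F\<close>, hence independent of \<open>G\<close>. The sets \<open>A n\<close> are in
    \<open>F\<close> too, so cutting off to bounded derivatives keeps independence.\<close>
  have dF [measurable]: "d \<in> borel_measurable F" unfolding d_def[abs_def] by (rule f'_compose_measurable_F[OF pF])
  define A where "A = near_bdd ?p"
  have AF [measurable]: "A n \<in> sets F" for n
  proof -
    have [measurable]: "(\<lambda>\<omega>. f' \<omega> (?p \<omega> - 1)) \<in> borel_measurable F" "(\<lambda>\<omega>. f' \<omega> (?p \<omega> + 1)) \<in> borel_measurable F"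
      using pF by (auto intro!: f'_compose_measurable_F)
    show ?thesis unfolding A_def near_bdd_def space_F[symmetric] by measurable
  qed
  have AM: "A n \<in> sets M" for n by (rule sets_F[OF AF])
  have inc: "incseq A" unfolding A_def by (intro monoI near_bdd_mono)
  have "(\<Union>n. A n) = space M" using near_bdd_exhausts[of _ ?p] by (auto simp: A_def near_bdd_def)
  then have PA: "(\<lambda>n. prob (A n)) \<longlonglongrightarrow> 1"
    using finite_Lim_measure_incseq[of A] inc AM prob_space by auto
  define dA where "dA n \<omega> = d \<omega> * indicator (A n) \<omega>" for n \<omega>
  have dAF: "dA n \<in> borel_measurable F" for n unfolding dA_def[abs_def] by measurable
  have dA_le: "\<bar>dA n \<omega>\<bar> \<le> real n" for n \<omega>
    using near_bdd_f'[of \<omega> ?p n 0] by (auto simp: dA_def d_def A_def indicator_def)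
  have LdA: "L2 (dA n)" for n by (rule L2_bounded[OF measurable_F[OF dAF] dA_le])
  define T where "T n x = (if \<bar>x\<bar> \<le> real n then x else 0)" for n and x :: real
  have Tm [measurable]: "T n \<in> borel_measurable borel" for n unfolding T_def[abs_def] by measurable
  define m where "m n = expectation (\<lambda>\<omega>. T n (G \<omega>))" for n
  \<comment> \<open>Centring makes this function of \<open>G\<close> orthogonal to every square
    integrable variable of \<open>F\<close>, in particular to \<open>dA n\<close>.\<close>
  define g where "g n x = T n x - m n" for n x
  have gm [measurable]: "g n \<in> borel_measurable borel" for n unfolding g_def[abs_def] by measurable
  define \<tau> where "\<tau> n = ip (\<lambda>\<omega>. T n (G \<omega>)) (\<lambda>\<omega>. T n (G \<omega>))" for n
  have LT: "L2 (\<lambda>\<omega>. T n (G \<omega>))" for n by (rule L2_bounded[of _ "real n"]) (auto simp: T_def)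
  have Lg: "L2 (\<lambda>\<omega>. g n (G \<omega>))" for n unfolding g_def by (intro L2_diff LT L2_const)
  have TG: "ip (\<lambda>\<omega>. T n (G \<omega>)) G = \<tau> n" for n
    unfolding \<tau>_def ip_def by (intro Bochner_Integration.integral_cong) (auto simp: T_def)
  have "ip (\<lambda>\<omega>. G \<omega> - T n (G \<omega>)) (\<lambda>\<omega>. G \<omega> - T n (G \<omega>)) = 1 - \<tau> n" for n
    using L2_G LT TG[of n] by (simp add: ip_simps L2_intros ip_G_G ip_commute[of G "\<lambda>\<omega>. T n (G \<omega>)"] \<tau>_def)
  then have "(\<lambda>n. 1 - \<tau> n) \<longlonglongrightarrow> 0" using L2_truncation[OF L2_G] by (simp add: T_def)
  then have "(\<lambda>n. 1 - (1 - \<tau> n)) \<longlonglongrightarrow> 1 - 0" by (intro tendsto_intros)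
  then have "(\<lambda>n. \<tau> n * prob (A n)) \<longlonglongrightarrow> 1 * 1" by (intro tendsto_mult PA) simp
  then have "\<forall>\<^sub>F n in sequentially. c2 < \<tau> n * prob (A n)" using c2 by (intro order_tendstoD) auto
  \<comment> \<open>With \<kappa> for the right-hand side, the truncated direction will have pairing
    \<kappa> with \<open>G\<close> and squared norm at most \<kappa>; it is strictly inside the cone
    because \<open>c2 * \<kappa> < \<kappa>\<^sup>2\<close>.\<close>
  then obtain n1 where n1: "\<And>n. n \<ge> n1 \<Longrightarrow> c2 < \<tau> n * prob (A n)" by (auto simp: eventually_sequentially)
  have "\<exists>n. \<not> (AE \<omega> in M. dA n \<omega> = 0)"
  proof (rule ccontr)
    assume "\<not> ?thesis"
    then have "AE \<omega> in M. \<forall>n. dA n \<omega> = 0" unfolding AE_all_countable by blast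
    then have "AE \<omega> in M. f' \<omega> (?p \<omega>) = 0"
      using AE_space
    proof eventually_elim
      case (elim \<omega>)
      then obtain n where "\<omega> \<in> A n" using near_bdd_exhausts unfolding A_def by blast
      then show ?case using elim(1)[rule_format, of n] by (simp add: dA_def d_def)
    qed
    then show False using f'_not_AE_0[of ?p] by blast
  qed
  then obtain n2 where n2: "\<not> (AE \<omega> in M. dA n2 \<omega> = 0)" by blast
  \<comment> \<open>One index for two purposes: \<open>n1\<close> puts the direction inside the
    cone, \<open>n2\<close> makes the truncated derivative nonzero.\<close>
  define n where "n = max n1 n2"
  have "\<not> (AE \<omega> in M. dA n \<omega> = 0)"
  proof
    assume AE: "AE \<omega> in M. dA n \<omega> = 0"
    have "A n2 \<subseteq> A n" using inc by (simp add: incseq_def n_def)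
    with AE have "AE \<omega> in M. dA n2 \<omega> = 0"
      by (elim eventually_mono) (auto simp: dA_def indicator_def split: if_splits)
    then show False using n2 by blast
  qed
  then have "ip (dA n) (dA n) \<noteq> 0" using ip_self_eq_0_iff[OF LdA] by blast
  then have dd: "ip (dA n) (dA n) > 0" using ip_self_nonneg[of "dA n"] by linarith
  define \<kappa> where "\<kappa> = \<tau> n * prob (A n)"
  have \<kappa>: "c2 < \<kappa>" "\<kappa> > 0" using n1[of n] c2 by (auto simp: \<kappa>_def n_def)
  \<comment> \<open>The room left by the cone: \<open>r\<close> solves \<open>c2 * (\<kappa> +
    r\<^sup>2 * ip (dA n) (dA n)) = \<kappa>\<^sup>2\<close>.\<close>
  define r where "r = sqrt ((\<kappa>\<^sup>2 - c2 * \<kappa>) / (c2 * ip (dA n) (dA n)))"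
  have rpos: "(\<kappa>\<^sup>2 - c2 * \<kappa>) / (c2 * ip (dA n) (dA n)) > 0"
    using \<kappa> dd c2 by (auto simp: power2_eq_square intro!: divide_pos_pos)
  then have r: "r > 0" "r\<^sup>2 = (\<kappa>\<^sup>2 - c2 * \<kappa>) / (c2 * ip (dA n) (dA n))" by (auto simp: r_def)
  have r': "c2 * (\<kappa> + r\<^sup>2 * ip (dA n) (dA n)) = \<kappa>\<^sup>2" using dd c2 by (simp add: r(2) field_simps)
  have Eg: "expectation (\<lambda>\<omega>. g n (G \<omega>)) = 0"
    using L2_integrable[OF LT] by (simp add: g_def m_def prob_space)
  let ?x = "\<lambda>\<omega>. g n (G \<omega>) * indicator (A n) \<omega>"
  have xm: "?x \<in> borel_measurable M" using AM Lg by (intro borel_measurable_times) (auto simp: L2_def)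
  have Lx: "L2 ?x" by (rule L2_bound[OF Lg xm]) (auto simp: indicator_def)
  have LA: "L2 (indicator (A n))" by (rule L2_bounded[of _ 1]) (use AM in \<open>auto simp: indicator_def\<close>)
  have indA: "(indicator (A n) :: 'a \<Rightarrow> real) \<in> borel_measurable F" by simp
  have EA: "expectation (indicator (A n) :: 'a \<Rightarrow> real) = prob (A n)" using AM by simp
  have xG: "ip ?x G = \<kappa>"
  proof -
    have "ip ?x G = expectation (\<lambda>\<omega>. (g n (G \<omega>) * G \<omega>) * indicator (A n) \<omega>)"
      unfolding ip_def by (simp add: mult_ac)
    also have "\<dots> = expectation (\<lambda>\<omega>. g n (G \<omega>) * G \<omega>) * prob (A n)"
      using expectation_indep[of "\<lambda>x. g n x * x" "indicator (A n)"] indA L2_mult[OF Lg L2_G] L2_integrable[OF LA] EA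
      by simp
    also have "expectation (\<lambda>\<omega>. g n (G \<omega>) * G \<omega>) = \<tau> n"
    proof -
      have "ip (\<lambda>\<omega>. T n (G \<omega>) - m n) G = \<tau> n - ip (\<lambda>_. m n) G"
        using LT L2_G TG by (simp add: ip_diff_left)
      also have "ip (\<lambda>_. m n) G = 0" using expectation_G by (simp add: ip_def)
      finally show ?thesis by (simp add: ip_def g_def)
    qed
    finally show ?thesis by (simp add: \<kappa>_def)
  qed
  \<comment> \<open>The variance of the truncated \<open>G\<close> is at most its second moment
    \<open>\<tau> n\<close>.\<close>
  have xx: "ip ?x ?x \<le> \<kappa>"
  proof -
    have "ip ?x ?x = expectation (\<lambda>\<omega>. (g n (G \<omega>) * g n (G \<omega>)) * indicator (A n) \<omega>)"
      unfolding ip_def by (intro Bochner_Integration.integral_cong) (auto simp: indicator_def)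
    also have "\<dots> = expectation (\<lambda>\<omega>. g n (G \<omega>) * g n (G \<omega>)) * prob (A n)"
      using expectation_indep[of "\<lambda>x. g n x * g n x" "indicator (A n)"] indA L2_mult[OF Lg Lg] L2_integrable[OF LA] EA
      by simp
    also have "expectation (\<lambda>\<omega>. g n (G \<omega>) * g n (G \<omega>)) \<le> \<tau> n"
    proof -
      have "ip (\<lambda>\<omega>. T n (G \<omega>) - m n) (\<lambda>\<omega>. T n (G \<omega>) - m n)
          = \<tau> n - 2 * ip (\<lambda>\<omega>. T n (G \<omega>)) (\<lambda>_. m n) + ip (\<lambda>_. m n) (\<lambda>_. m n)"
        using LT[of n] by (simp add: ip_diff_left ip_diff_right L2_intros \<tau>_def ip_commute[of "\<lambda>_. m n" "\<lambda>\<omega>. T n (G \<omega>)"])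
      also have "ip (\<lambda>\<omega>. T n (G \<omega>)) (\<lambda>_. m n) = m n * m n" by (simp add: ip_def m_def)
      also have "ip (\<lambda>_. m n) (\<lambda>_. m n) = m n * m n" by (simp add: ip_def prob_space)
      finally show ?thesis by (simp add: ip_def g_def)
    qed
    finally show ?thesis by (simp add: \<kappa>_def mult_right_mono)
  qed
  have xd: "ip ?x (dA n) = 0"
  proof -
    have "ip ?x (dA n) = ip (\<lambda>\<omega>. g n (G \<omega>)) (dA n)"
      unfolding ip_def by (intro Bochner_Integration.integral_cong) (auto simp: dA_def indicator_def)
    also have "\<dots> = 0" using indep_ip[OF gm dAF Lg LdA] Eg by simp
    finally show ?thesis .
  qed
  have dG: "ip (dA n) G = 0"
    using indep_ip[of "\<lambda>x. x", OF _ dAF L2_G LdA] expectation_G by (simp add: ip_commute)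
  define w where "w \<omega> = ?x \<omega> + (- r) * dA n \<omega>" for \<omega>
  have Lw: "L2 w" unfolding w_def by (intro L2_add L2_cmult Lx LdA)
  have wG: "ip w G = \<kappa>"
    unfolding w_def[abs_def] using Lx LdA L2_G xG dG by (simp add: ip_add_left ip_diff_left L2_cmult ip_cmult_left)
  have "ip w w = ip ?x ?x + r\<^sup>2 * ip (dA n) (dA n)"
  proof -
    have "ip w w = ip ?x w + (- r) * ip (dA n) w"
      using Lx LdA Lw ip_add_left[OF Lx L2_cmult[OF LdA, of "- r"] Lw] unfolding ip_cmult_left by (simp add: w_def[abs_def])
    also have "ip ?x w = ip ?x ?x"
      using ip_add_right[OF Lx L2_cmult[OF LdA, of "- r"] Lx] xd unfolding ip_cmult_right by (simp add: w_def[abs_def])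
    also have "ip (dA n) w = - r * ip (dA n) (dA n)"
      using ip_add_right[OF Lx L2_cmult[OF LdA, of "- r"] LdA[of n]] xd unfolding ip_cmult_right
      by (simp add: w_def[abs_def] ip_commute[of "dA n" ?x])
    finally show ?thesis by (simp add: power2_eq_square)
  qed
  then have ww: "c2 * ip w w \<le> \<kappa>\<^sup>2"
    using xx c2 r' by (smt (verit) mult_left_mono)
  have tw: "test ?p w"
  proof -
    obtain k :: nat where k: "real n + \<bar>m n\<bar> + r * real n + real n \<le> real k" using real_arch_simple by blast
    have wb: "\<bar>w \<omega>\<bar> \<le> real k" for \<omega>
    proof -
      have "\<bar>?x \<omega>\<bar> \<le> real n + \<bar>m n\<bar>" by (auto simp: g_def T_def indicator_def)
      moreover have "\<bar>(- r) * dA n \<omega>\<bar> \<le> r * real n"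
        unfolding abs_mult using r(1) dA_le by (intro mult_mono) auto
      moreover have "\<bar>w \<omega>\<bar> \<le> \<bar>?x \<omega>\<bar> + \<bar>(- r) * dA n \<omega>\<bar>" unfolding w_def by (rule abs_triangle_ineq)
      moreover have "real n \<ge> 0" by simp
      ultimately show ?thesis using k by linarith
    qed
    have "real n \<le> real k" using k r(1) by (smt (verit) mult_nonneg_nonneg of_nat_0_le_iff)
    then have nk: "n \<le> k" by simp
    have "\<omega> \<in> near_bdd ?p k" if "w \<omega> \<noteq> 0" for \<omega>
    proof -
      have "\<omega> \<in> A n" using that by (cases "\<omega> \<in> A n") (auto simp: w_def dA_def)
      then show ?thesis using near_bdd_mono[OF nk] unfolding A_def by blast
    qed
    then show ?thesis unfolding test_def using wb Lw by (auto simp: L2_def)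
  qed
  have "\<forall>\<^sub>F \<epsilon> in at_right 0. feas (\<lambda>\<omega>. ?p \<omega> + \<epsilon> * w \<omega>)"
    using eventually_at_right_less[of "0::real"]
  proof eventually_elim
    case (elim \<epsilon>)
    let ?q = "\<lambda>\<omega>. ?p \<omega> + \<epsilon> * w \<omega>"
    have Lq: "L2 ?q" by (intro L2_add L2_cmult L2_U Lw)
    have qG: "ip ?q G = \<epsilon> * \<kappa>"
      using Lw L2_U L2_G by (simp add: ip_simps L2_intros ip_U_G wG)
    have qU: "ip ?q U = a + \<epsilon> * ip w U"
      using Lw L2_U by (simp add: ip_simps L2_intros ip_U_U)
    have "ip ?q ?q = a\<^sup>2 + 2 * a * \<epsilon> * ip w U + \<epsilon>\<^sup>2 * ip w w"
      using Lw L2_U by (simp add: ip_simps L2_intros ip_U_U ip_commute[of U w] power2_eq_square distrib_left)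
    then have "ip (orth ?q) (orth ?q) = \<epsilon>\<^sup>2 * ip w w - \<epsilon>\<^sup>2 * (ip w U)\<^sup>2"
      using ip_orth_orth[OF Lq] qU by (simp add: power2_eq_square algebra_simps)
    then have "c2 * ip (orth ?q) (orth ?q) \<le> c2 * (\<epsilon>\<^sup>2 * ip w w)"
      using c2 by (intro mult_left_mono) auto
    also have "\<dots> = \<epsilon>\<^sup>2 * (c2 * ip w w)" by simp
    also have "\<dots> \<le> \<epsilon>\<^sup>2 * \<kappa>\<^sup>2" using ww by (intro mult_left_mono) auto
    finally show ?case
      unfolding feas_iff qG using Lq elim \<kappa> by (auto simp: power_mult_distrib)
  qed
  then have "0 \<le> expectation (\<lambda>\<omega>. f' \<omega> (?p \<omega>) * w \<omega>)"
    by (rule first_variation[OF p min tw, rotated])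
  also have "\<dots> = ip (dA n) w"
    unfolding ip_def
    by (intro Bochner_Integration.integral_cong) (auto simp: dA_def d_def w_def indicator_def)
  also have "\<dots> = - r * ip (dA n) (dA n)"
    using ip_add_right[OF Lx L2_cmult[OF LdA, of "- r"] LdA[of n]] xd unfolding ip_cmult_right
    by (simp add: w_def[abs_def] ip_commute[of "dA n" ?x])
  also have "\<dots> < 0" using r(1) dd by simp
  finally show False by simp
qed

lemma sol_exists:
  assumes gt: "\<And>t. 1 / \<delta> < ip (Z t) (Z t)"
  shows "\<exists>\<gamma> a \<sigma>. sol \<gamma> a \<sigma>"
proof -
  obtain p where p: "adm p" and min: "\<And>q. adm q \<Longrightarrow> risk p \<le> risk q"
    using risk_attains_min[OF gt] by blast
  show ?thesis
  proof (cases "ip (orth p) (orth p) > 0")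
    case True
    then show ?thesis using minimiser_imp_sol p min by blast
  next
    case False
    note Lp = adm_L2[OF p]
    then have "AE \<omega> in M. orth p \<omega> = 0"
      using False ip_self_nonneg[of "orth p"] ip_self_eq_0_iff[OF L2_orth[OF Lp]] by linarith
    then have eq: "AE \<omega> in M. p \<omega> = ip p U * U \<omega>" unfolding orth_def by eventually_elim simp
    \<comment> \<open>The minimiser is replaced by an exact multiple of \<open>U\<close>: it agrees
      with one only almost everywhere, whereas measurability with respect to \<open>F\<close> needs
      the multiple itself.\<close>
    let ?q = "\<lambda>\<omega>. ip p U * U \<omega>"
    have Lq: "L2 ?q" by (intro L2_cmult L2_U)
    have [measurable]: "p \<in> borel_measurable M" using Lp by (simp add: L2_def)
    have f_eq: "AE \<omega> in M. f \<omega> (p \<omega>) = f \<omega> (?q \<omega>)" using eq by eventually_elim simp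
    have "feas ?q"
      using Lq by (simp add: feas_iff ip_orth_orth) (simp add: ip_simps L2_intros ip_U_U ip_U_G power2_eq_square)
    moreover have "integrable M (\<lambda>\<omega>. f \<omega> (?q \<omega>))"
      using p integrable_cong_AE[OF _ _ f_eq] by (simp add: adm_def)
    ultimately have "adm ?q" by (simp add: adm_def)
    moreover have "risk ?q = risk p"
      unfolding risk_def by (rule integral_cong_AE[symmetric]) (use f_eq in auto)
    ultimately show ?thesis using multiple_of_U_not_minimiser[of "ip p U"] min by auto
  qed
qed

end

section \<open>From the probabilistic setting to the abstract one\<close>

context prob_space
begin

lemma std_normal_moments:
  assumes X: "distributed M lborel X std_normal_density"
  shows "L2 X" "ip X X = 1" "expectation X = 0"
proof -
  have m2: "has_bochner_integral lborel (\<lambda>x. std_normal_density x * x\<^sup>2) 1"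
    using std_normal_moment_even[of 1] by (simp add: fact_numeral)
  have m1: "has_bochner_integral lborel (\<lambda>x. std_normal_density x * x) 0"
    using std_normal_moment_odd[of 0] by simp
  have [measurable]: "X \<in> borel_measurable M" using distributed_measurable[OF X] by simp
  have "integrable M (\<lambda>\<omega>. (X \<omega>)\<^sup>2)"
    using distributed_integrable[OF X, of "\<lambda>x. x\<^sup>2"] m2 by (simp add: has_bochner_integral_iff)
  then show "L2 X" by (simp add: L2_def)
  show "ip X X = 1"
    using distributed_integral[OF X, of "\<lambda>x. x\<^sup>2"] m2 by (simp add: ip_self has_bochner_integral_iff)
  show "expectation X = 0"
    using distributed_integral[OF X, of "\<lambda>x. x"] m1 by (simp add: has_bochner_integral_iff)
qed

lemma std_normal_open_pos:
  assumes X: "distributed M lborel X std_normal_density" and A: "open A" "A \<noteq> {}"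
  shows "prob (X -` A \<inter> space M) > 0"
proof (rule ccontr)
  assume "\<not> ?thesis"
  then have "prob (X -` A \<inter> space M) = 0" using measure_nonneg[of M] by (meson antisym not_less)
  then have "emeasure M (X -` A \<inter> space M) = 0" by (simp add: emeasure_eq_measure)
  then have "(\<integral>\<^sup>+x. ennreal (std_normal_density x) * indicator A x \<partial>lborel) = 0"
    using distributed_emeasure[OF X, of A] A by simp
  then have "AE x in lborel. ennreal (std_normal_density x) * indicator A x = 0"
    using A by (subst (asm) nn_integral_0_iff_AE) auto
  then have "AE x in lborel. x \<notin> A"
  proof eventually_elim
    case (elim x)
    have "std_normal_density x > 0" by (simp add: normal_density_pos)
    then show ?case using elim by (auto simp: indicator_def split: if_splits)
  qed
  then have "A \<in> null_sets lborel"
    using A by (subst (asm) AE_iff_null_sets[symmetric]) auto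
  then have "A \<in> null_sets lebesgue" by (simp add: null_sets_completionI)
  then have "negligible A" by (simp add: negligible_iff_null_sets)
  then show False using open_not_negligible[OF A] by blast
qed

end

text \<open>A continuous function takes values below any level above its infimum on an open set,
  which contains rationals. This makes the infimum of a random loss measurable.\<close>

lemma INF_rat_eq_INF:
  fixes g :: "real \<Rightarrow> real"
  assumes "continuous_on UNIV g"
  shows "(INF q::rat. ereal (g (of_rat q))) = (INF u. ereal (g u))"
proof (rule antisym)
  show "(INF u. ereal (g u)) \<le> (INF q::rat. ereal (g (of_rat q)))"
    by (intro INF_greatest INF_lower) auto
  show "(INF q::rat. ereal (g (of_rat q))) \<le> (INF u. ereal (g u))"
  proof (rule INF_greatest, rule ccontr)
    fix u
    assume "\<not> (INF q::rat. ereal (g (of_rat q))) \<le> ereal (g u)"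
    then have "ereal (g u) < (INF q::rat. ereal (g (of_rat q)))" by (simp add: not_le)
    then obtain c where "ereal (g u) < ereal c" and c2: "ereal c < (INF q::rat. ereal (g (of_rat q)))"
      using ereal_dense2 by blast
    then have c1: "g u < c" by simp
    have "open (g -` {..<c})" using assms by (intro open_vimage) auto
    moreover have "u \<in> g -` {..<c}" using c1 by simp
    ultimately obtain e where e: "e > 0" "\<And>y. dist y u < e \<Longrightarrow> y \<in> g -` {..<c}"
      unfolding open_dist by blast
    obtain q where q: "u < of_rat q" "of_rat q < u + e" using of_rat_dense[of u "u + e"] e by auto
    then have "g (of_rat q) < c" using e(2)[of "of_rat q"] by (simp add: dist_real_def)
    moreover have "(INF q::rat. ereal (g (of_rat q))) \<le> ereal (g (of_rat q))" by (rule INF_lower) simp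
    ultimately have "ereal c < ereal c" using c2 by (metis ereal_less_eq(3) less_imp_le less_le_trans order_trans)
    then show False by simp
  qed
qed

lemma setting_convex_losses:
  assumes gs: "gaussian_setting M U Y G \<Y> l" and L: "assumption_L M Y G \<Y> l"
  shows "convex_losses M (vimage_algebra (space M) (\<lambda>\<omega>. (U \<omega>, Y \<omega>)) (borel \<Otimes>\<^sub>M borel))
    (\<lambda>\<omega>. l (Y \<omega>)) (\<lambda>\<omega>. deriv (l (Y \<omega>)))"
proof -
  let ?F = "vimage_algebra (space M) (\<lambda>\<omega>. (U \<omega>, Y \<omega>)) (borel \<Otimes>\<^sub>M borel)"
  interpret prob_space M using gs by (simp add: gaussian_setting_def)
  have Y [measurable]: "Y \<in> borel_measurable M" and YY: "\<And>\<omega>. \<omega> \<in> space M \<Longrightarrow> Y \<omega> \<in> \<Y>"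
    and dU: "distributed M lborel U std_normal_density"
    and l_meas: "\<And>t. (\<lambda>y. l y t) \<in> borel_measurable (restrict_space borel \<Y>)"
    using gs by (auto simp: gaussian_setting_def)
  have U [measurable]: "U \<in> borel_measurable M" using distributed_measurable[OF dU] by simp
  have UY: "(\<lambda>\<omega>. (U \<omega>, Y \<omega>)) \<in> measurable ?F (borel \<Otimes>\<^sub>M borel)"
    by (rule measurable_vimage_algebra1) (simp add: space_pair_measure)
  show ?thesis
  proof (intro convex_losses.intro convex_losses_axioms.intro)
    show "prob_space M" by (rule prob_space_axioms)
    show "subalgebra M ?F"
    proof -
      have "sets ?F \<subseteq> sets M" by (rule sets_image_in_sets) simp_all
      then show ?thesis by (simp add: subalgebra_def)
    qed
    show "(\<lambda>\<omega>. l (Y \<omega>) t) \<in> borel_measurable ?F" for t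
    proof (rule measurable_compose[OF _ l_meas[of t]])
      show "Y \<in> measurable ?F (restrict_space borel \<Y>)"
        using measurable_compose[OF UY measurable_snd] YY by (intro measurable_restrict_space2) auto
    qed
    show "C1_strictly_convex (l (Y \<omega>)) (deriv (l (Y \<omega>)))" if "\<omega> \<in> space M" for \<omega>
      using L YY[OF that] by (intro C1_strictly_convexI) (auto simp: assumption_L_def)
  qed
qed

locale gaussian_data =
  fixes M :: "'a measure" and U Y G :: "'a \<Rightarrow> real" and \<Y> :: "real set"
    and l :: "real \<Rightarrow> real \<Rightarrow> real"
  assumes gs: "gaussian_setting M U Y G \<Y> l"
    and N: "assumption_N M U Y \<Y> l"
    and L: "assumption_L M Y G \<Y> l"
begin

abbreviation UY_algebra :: "'a measure" where
  "UY_algebra \<equiv> vimage_algebra (space M) (\<lambda>\<omega>. (U \<omega>, Y \<omega>)) (borel \<Otimes>\<^sub>M borel)"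

sublocale convex_losses M UY_algebra "\<lambda>\<omega>. l (Y \<omega>)" "\<lambda>\<omega>. deriv (l (Y \<omega>))"
  by (rule setting_convex_losses[OF gs L])

lemma Omega_inc_eq: "Omega_inc M Y l = Inc"
  unfolding Omega_inc_def Inc_def using C1_strictly_convex.strict_mono_iff[OF f_C1] by auto

lemma Omega_dec_eq: "Omega_dec M Y l = Dec"
  unfolding Omega_dec_def Dec_def using C1_strictly_convex.strict_antimono_iff[OF f_C1] by auto

lemma Omega_coer_eq: "Omega_coer M Y l = space M - (Inc \<union> Dec)"
proof -
  have "coercive (l (Y \<omega>)) \<longleftrightarrow> \<omega> \<notin> Inc \<and> \<omega> \<notin> Dec" if "\<omega> \<in> space M" for \<omega>
  proof -
    interpret C1_strictly_convex "l (Y \<omega>)" "deriv (l (Y \<omega>))" using that by (rule f_C1)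
    show ?thesis
      unfolding coercive_iff Inc_def Dec_def using that sign_cases by auto (metis less_irrefl)+
  qed
  then show ?thesis unfolding Omega_coer_def by blast
qed

lemma Inc_Dec_sets [measurable]: "Inc \<in> sets M" "Dec \<in> sets M"
  using Inc_F Dec_F sets_F by auto

sublocale gaussian_losses M UY_algebra "\<lambda>\<omega>. l (Y \<omega>)" "\<lambda>\<omega>. deriv (l (Y \<omega>))" U G
proof
  have dU: "distributed M lborel U std_normal_density" and dG: "distributed M lborel G std_normal_density"
    using gs by (auto simp: gaussian_setting_def)
  have "(\<lambda>\<omega>. (U \<omega>, Y \<omega>)) \<in> measurable UY_algebra (borel \<Otimes>\<^sub>M borel)"
    by (rule measurable_vimage_algebra1) (simp add: space_pair_measure)
  from measurable_compose[OF this measurable_fst] show "U \<in> borel_measurable UY_algebra" by simp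
  show "L2 U" "ip U U = 1" "L2 G" "ip G G = 1" "expectation G = 0"
    using std_normal_moments[OF dU] std_normal_moments[OF dG] by auto
  show "prob {\<omega> \<in> space M. G \<omega> > r} > 0" for r
    using std_normal_open_pos[OF dG, of "{r<..}"] by (simp add: vimage_def Int_def conj_commute)
  show "prob {\<omega> \<in> space M. G \<omega> < r} > 0" for r
    using std_normal_open_pos[OF dG, of "{..<r}"] by (simp add: vimage_def Int_def conj_commute)
  show "indep_set (sets (vimage_algebra (space M) G borel)) (sets UY_algebra)"
    using gs by (simp add: gaussian_setting_def)
  show "\<not> (AE \<omega> in M. \<omega> \<notin> Inc \<and> \<omega> \<notin> Dec)"
  proof
    assume "AE \<omega> in M. \<omega> \<notin> Inc \<and> \<omega> \<notin> Dec"
    then have "AE \<omega> in M. \<omega> \<in> Omega_coer M Y l"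
      using AE_space by eventually_elim (simp add: Omega_coer_eq)
    then have "prob (Omega_coer M Y l) = 1" by (subst prob_eq_1) (auto simp: Omega_coer_eq)
    then show False using L by (simp add: assumption_L_def)
  qed
  \<comment> \<open>The squared excess of \<open>U\<close> keeps \<open>U\<^sup>2\<close> on the
    coercive part and one sign of \<open>U\<close> on each monotone part, as in the second
    inequality of (N); the first belongs to \<open>- U\<close>.\<close>
  have "expectation (\<lambda>\<omega>. (excess \<omega> (U \<omega>))\<^sup>2) = expectation (\<lambda>\<omega>. (U \<omega>)\<^sup>2 * (indicat_real (Omega_coer M Y l) \<omega>
            + indicat_real (Omega_dec M Y l \<inter> {\<omega>. U \<omega> < 0}) \<omega>
            + indicat_real (Omega_inc M Y l \<inter> {\<omega>. U \<omega> > 0}) \<omega>))"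
    unfolding Omega_coer_eq Omega_dec_eq Omega_inc_eq
    by (intro Bochner_Integration.integral_cong)
      (auto simp: excess_def indicator_def max_def min_def dest: Inc_Dec_disjoint)
  then show "expectation (\<lambda>\<omega>. (excess \<omega> (U \<omega>))\<^sup>2) > 0" using N by (simp add: assumption_N_def)
  have "expectation (\<lambda>\<omega>. (excess \<omega> (- U \<omega>))\<^sup>2) = expectation (\<lambda>\<omega>. (U \<omega>)\<^sup>2 * (indicat_real (Omega_coer M Y l) \<omega>
            + indicat_real (Omega_dec M Y l \<inter> {\<omega>. U \<omega> > 0}) \<omega>
            + indicat_real (Omega_inc M Y l \<inter> {\<omega>. U \<omega> < 0}) \<omega>))"
    unfolding Omega_coer_eq Omega_dec_eq Omega_inc_eq
    by (intro Bochner_Integration.integral_cong)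
      (auto simp: excess_def indicator_def max_def min_def dest: Inc_Dec_disjoint)
  then show "expectation (\<lambda>\<omega>. (excess \<omega> (- U \<omega>))\<^sup>2) > 0" using N by (simp add: assumption_N_def)
qed

lemma phi_eq: "phi M U Y G l t = ip (Z t) (Z t)"
proof -
  let ?x = "\<lambda>\<omega>. G \<omega> + U \<omega> * t"
  have i: "integrable M (\<lambda>\<omega>. (h (?x \<omega>))\<^sup>2 * indicat_real A \<omega>)"
    if A [measurable]: "A \<in> sets M" and [measurable]: "h \<in> borel_measurable borel"
      and h: "\<And>x. \<bar>h x\<bar> \<le> \<bar>x\<bar>" for A and h :: "real \<Rightarrow> real"
  proof -
    have "L2 (\<lambda>\<omega>. h (?x \<omega>) * indicat_real A \<omega>)"
    proof (rule L2_bound[OF L2_GU[of t]])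
      show "AE \<omega> in M. \<bar>h (?x \<omega>) * indicat_real A \<omega>\<bar> \<le> \<bar>?x \<omega>\<bar>"
        using h by (auto simp: indicator_def)
    qed measurable
    moreover have "(h (?x \<omega>) * indicat_real A \<omega>)\<^sup>2 = (h (?x \<omega>))\<^sup>2 * indicat_real A \<omega>" for \<omega>
      by (auto simp: indicator_def)
    ultimately show ?thesis by (simp add: L2_def)
  qed
  let ?c = "\<lambda>\<omega>. (?x \<omega>)\<^sup>2 * indicat_real (space M - (Inc \<union> Dec)) \<omega>"
  let ?i = "\<lambda>\<omega>. (max (?x \<omega>) 0)\<^sup>2 * indicat_real Inc \<omega>"
  let ?d = "\<lambda>\<omega>. (max (- ?x \<omega>) 0)\<^sup>2 * indicat_real Dec \<omega>"
  have int: "integrable M ?c" "integrable M ?i" "integrable M ?d"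
    by (rule i[of _ "\<lambda>x. x"] i[of _ "\<lambda>x. max x 0"] i[of _ "\<lambda>x. max (- x) 0"]; simp)+
  have sq: "(- x - y)\<^sup>2 = (x + y)\<^sup>2" for x y :: real by (simp add: power2_eq_square algebra_simps)
  have "ip (Z t) (Z t) = expectation (\<lambda>\<omega>. ?c \<omega> + ?i \<omega> + ?d \<omega>)"
    unfolding ip_self Z_def
    by (intro Bochner_Integration.integral_cong)
      (auto simp: excess_def indicator_def max_def min_def sq dest: Inc_Dec_disjoint)
  then show ?thesis
    unfolding phi_def Omega_coer_eq Omega_dec_eq Omega_inc_eq using int by simp
qed

text \<open>Along a direction of recession the growth bound of (L) tends to minus infinity, but
  there the excess vanishes and the integrable infimum serves as lower bound. Since \<open>D\<close>
  is positive, subtracting both the absolute infimum and \<open>D\<close> gives one intercept for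
  all cases.\<close>

lemma lower_bound:
  obtains R b where "integrable M R" "b > 0"
    "AE \<omega> in M. \<forall>u. R \<omega> + \<bar>excess \<omega> u\<bar> / b \<le> l (Y \<omega>) u"
proof -
  obtain b and D :: "real \<Rightarrow> real" where b: "b > 0" and D: "integrable M (\<lambda>\<omega>. D (Y \<omega>))" "AE \<omega> in M. D (Y \<omega>) > 0"
    and low: "AE \<omega> in M. \<forall>u.
           (\<omega> \<in> Omega_inc M Y l \<longrightarrow> l (Y \<omega>) u \<ge> - D (Y \<omega>) + u / b) \<and>
           (\<omega> \<in> Omega_coer M Y l \<longrightarrow> l (Y \<omega>) u \<ge> - D (Y \<omega>) + \<bar>u\<bar> / b) \<and>
           (\<omega> \<in> Omega_dec M Y l \<longrightarrow> l (Y \<omega>) u \<ge> - D (Y \<omega>) - u / b)"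
    using L unfolding assumption_L_def by blast
  define m where "m \<omega> = (INF u. ereal (l (Y \<omega>) u))" for \<omega>
  have "(\<lambda>\<omega>. INF q::rat. ereal (l (Y \<omega>) (of_rat q))) \<in> borel_measurable M"
    using measurable_F[OF f_meas] by (intro borel_measurable_INF borel_measurable_ereal) auto
  moreover have "(INF q::rat. ereal (l (Y \<omega>) (of_rat q))) = m \<omega>" if "\<omega> \<in> space M" for \<omega>
    unfolding m_def
    using C1_strictly_convex.isCont_f[OF f_C1[OF that]]
    by (intro INF_rat_eq_INF) (simp add: continuous_on_eq_continuous_at)
  ultimately have m [measurable]: "m \<in> borel_measurable M" by (simp cong: measurable_cong)
  have fin: "(\<integral>\<^sup>+\<omega>. e2ennreal \<bar>m \<omega>\<bar> \<partial>M) < \<infinity>" using L by (simp add: assumption_L_def m_def)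
  have "AE \<omega> in M. e2ennreal \<bar>m \<omega>\<bar> \<noteq> \<infinity>"
    using fin by (intro nn_integral_PInf_AE) auto
  then have m_fin: "AE \<omega> in M. \<bar>m \<omega>\<bar> \<noteq> \<infinity>" by eventually_elim auto
  have m_int: "integrable M (\<lambda>\<omega>. \<bar>real_of_ereal (m \<omega>)\<bar>)"
  proof (rule integrableI_nonneg)
    have "(\<integral>\<^sup>+\<omega>. ennreal \<bar>real_of_ereal (m \<omega>)\<bar> \<partial>M) = (\<integral>\<^sup>+\<omega>. e2ennreal \<bar>m \<omega>\<bar> \<partial>M)"
    proof (rule nn_integral_cong_AE)
      show "AE \<omega> in M. ennreal \<bar>real_of_ereal (m \<omega>)\<bar> = e2ennreal \<bar>m \<omega>\<bar>"
        using m_fin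
      proof eventually_elim
        case (elim \<omega>)
        then obtain r where "m \<omega> = ereal r" by auto
        then show ?case by (simp add: e2ennreal_ereal)
      qed
    qed
    then show "(\<integral>\<^sup>+\<omega>. ennreal \<bar>real_of_ereal (m \<omega>)\<bar> \<partial>M) < \<infinity>" using fin by simp
    show "AE \<omega> in M. 0 \<le> \<bar>real_of_ereal (m \<omega>)\<bar>" by (intro AE_I2 abs_ge_zero)
  qed measurable
  show ?thesis
  proof (rule that[of "\<lambda>\<omega>. - \<bar>real_of_ereal (m \<omega>)\<bar> - D (Y \<omega>)" b])
    show "integrable M (\<lambda>\<omega>. - \<bar>real_of_ereal (m \<omega>)\<bar> - D (Y \<omega>))" using m_int D(1) by auto
    show "AE \<omega> in M. \<forall>u. - \<bar>real_of_ereal (m \<omega>)\<bar> - D (Y \<omega>) + \<bar>excess \<omega> u\<bar> / b \<le> l (Y \<omega>) u"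
      using m_fin D(2) low AE_space
    proof eventually_elim
      case (elim \<omega>)
      then obtain r where r: "m \<omega> = ereal r" by auto
      have ge: "r \<le> l (Y \<omega>) u" for u
      proof -
        have "m \<omega> \<le> ereal (l (Y \<omega>) u)" unfolding m_def by (rule INF_lower) simp
        then show ?thesis by (simp add: r)
      qed
      show ?case
      proof
        fix u
        have "r \<le> l (Y \<omega>) u" by (rule ge)
        moreover have "excess \<omega> u = 0 \<or> - D (Y \<omega>) + \<bar>excess \<omega> u\<bar> / b \<le> l (Y \<omega>) u"
          using elim(3)[rule_format, of u] elim(4)
          unfolding Omega_inc_eq Omega_dec_eq Omega_coer_eq
          by (auto simp: excess_def max_def min_def)
        ultimately show "- \<bar>real_of_ereal (m \<omega>)\<bar> - D (Y \<omega>) + \<bar>excess \<omega> u\<bar> / b \<le> l (Y \<omega>) u"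
          using elim(2) r by (auto simp: r)
      qed
    qed
  qed (rule b)
qed

end

theorem theorem2p7:
  fixes M :: "'a measure"
    and U Y G :: "'a \<Rightarrow> real"
    and \<Y> :: "real set"
    and l :: "real \<Rightarrow> real \<Rightarrow> real"
    and \<delta> :: real
  assumes "1 < \<delta>"
    and "gaussian_setting M U Y G \<Y> l"
    and "assumption_N M U Y \<Y> l"
    and "assumption_L M Y G \<Y> l"
  shows "(ereal \<delta> \<le> delta_infty M U Y G l \<longrightarrow> \<not> (\<exists>s. is_solution M U Y G l \<delta> s)) \<and>
         (ereal \<delta> > delta_infty M U Y G l \<longrightarrow> (\<exists>!s. is_solution M U Y G l \<delta> s))"
proof -
  interpret gaussian_data M U Y G \<Y> l using assms(2-4) by unfold_locales
  obtain R b where R: "integrable M R" "b > 0"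
    "AE \<omega> in M. \<forall>u. R \<omega> + \<bar>excess \<omega> u\<bar> / b \<le> l (Y \<omega>) u"
    using lower_bound by blast
  interpret solvable_losses M UY_algebra "\<lambda>\<omega>. l (Y \<omega>)" "\<lambda>\<omega>. deriv (l (Y \<omega>))" U G R b \<delta>
    using R assms(1,4) by unfold_locales (auto simp: assumption_L_def)
  have sol_iff: "is_solution M U Y G l \<delta> (\<gamma>, a, \<sigma>) \<longleftrightarrow> sol \<gamma> a \<sigma>" for \<gamma> a \<sigma>
    unfolding is_solution_def sol_def D_def P_def Let_def by simp
  obtain t where t: "\<And>s. ip (Z t) (Z t) \<le> ip (Z s) (Z s)" using ip_Z_attains_min by blast
  have inf_eq: "(INF t. phi M U Y G l t) = ip (Z t) (Z t)"
    unfolding phi_eq by (rule cInf_eq_minimum) (use t in auto)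
  have inf_nonneg: "0 \<le> ip (Z t) (Z t)" by (rule ip_self_nonneg)
  \<comment> \<open>If the attained minimum is 0, then \<delta>_\<infinity> is infinite and both
    sides are false; otherwise the claim is inversion of positive numbers.\<close>
  have threshold: "delta_infty M U Y G l < ereal \<delta> \<longleftrightarrow> 1 / \<delta> < ip (Z t) (Z t)"
  proof (cases "ip (Z t) (Z t) = 0")
    case False
    then have "ip (Z t) (Z t) > 0" using inf_nonneg by simp
    then show ?thesis using assms(1) by (simp add: delta_infty_def inf_eq field_simps)
  qed (use assms(1) in \<open>simp add: delta_infty_def inf_eq\<close>)
  show ?thesis
  proof (intro conjI impI)
    assume "ereal \<delta> \<le> delta_infty M U Y G l"
    then have "\<not> 1 / \<delta> < ip (Z t) (Z t)" using threshold by (simp flip: not_less)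
    then show "\<not> (\<exists>s. is_solution M U Y G l \<delta> s)"
      using sol_imp_ip_Z_gt sol_iff by (metis prod_cases3)
  next
    assume "delta_infty M U Y G l < ereal \<delta>"
    then have "1 / \<delta> < ip (Z s) (Z s)" for s using threshold t[of s] by linarith
    then obtain \<gamma> a \<sigma> where s: "sol \<gamma> a \<sigma>" using sol_exists by blast
    show "\<exists>!s. is_solution M U Y G l \<delta> s"
    proof (rule ex1I)
      show "is_solution M U Y G l \<delta> (\<gamma>, a, \<sigma>)" using s sol_iff by simp
      show "s' = (\<gamma>, a, \<sigma>)" if "is_solution M U Y G l \<delta> s'" for s'
        using that s sol_iff sol_unique by (cases s') blast
    qed
  qed
qed

end
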